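(* There is an algorithm (called MinimumStarColoringFlow in the paper) which, given any non-empty finite simple connected graph $G=(V,E)$ with node capacities $\kappa_v\in\mathbb{N}_{\ge0}$ for $v\in V$, computes $x^*(G)$ with a runtime of $\mathcal{O}\bigl(\log(\Delta)\cdot|E|\cdot\min\{|V|^{2/3},|E|^{1/2}\}\bigr)$, where $\Delta=\Delta(G)$ is the maximum degree of $G$.
   Context: Let $G=(V,E)$ be a finite simple graph with node capacities $\kappa_v\in\mathbb{N}_{\ge0}$ (taken to be $\Delta(G)$ if no capacities are given). Each node $v\in V$ has its own distinct color $C(v)$. A star coloring $C$ assigns to each edge $e\in E$ a color $C(e)$ with $C(e)=C(v)$ for some endpoint $v\in e$. For $v\in V$ let $x(G,C,v)=|\{C(e):e\in E,\ v\in e\}|$ be the number of different colors of edges incident to $v$. The star coloring $C$ is valid if $x(G,C,v)\le\kappa_v$ for all $v\in V$. Let $x(G,C)=\max_{v\in V}x(G,C,v)$ and $x^*(G)=\min_C x(G,C)$, the minimum over all valid star colorings, with $x^*(G)=\infty$ if no valid star coloring exists. *)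

theory Defs
  imports Complex_Main "HOL-Library.Extended_Nat"
begin

section \<open>Graphs\<close>

definition simple_graph :: "'v set \<Rightarrow> 'v set set \<Rightarrow> bool" where
  "simple_graph V E \<longleftrightarrow> finite V \<and> (\<forall>e\<in>E. e \<subseteq> V \<and> card e = 2)"

definition connected_graph :: "'v set \<Rightarrow> 'v set set \<Rightarrow> bool" where
  "connected_graph V E \<longleftrightarrow> (\<forall>u\<in>V. \<forall>v\<in>V. (u, v) \<in> {(a, b). {a, b} \<in> E}\<^sup>*)"

definition degree :: "'v set set \<Rightarrow> 'v \<Rightarrow> nat" where
  "degree E v = card {e \<in> E. v \<in> e}"

definition max_degree :: "'v set \<Rightarrow> 'v set set \<Rightarrow> nat" where
  "max_degree V E = Max (degree E ` V)"


section \<open>Star colorings\<close>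

text \<open>
  A coloring has a part \<open>c\<close> on the nodes and a part \<open>C\<close> on the edges. Colors are natural
  numbers, which is enough to give the nodes of any finite graph distinct colors.
\<close>

definition star_coloring ::
    "'v set \<Rightarrow> 'v set set \<Rightarrow> ('v \<Rightarrow> nat) \<Rightarrow> ('v set \<Rightarrow> nat) \<Rightarrow> bool" where
  "star_coloring V E c C \<longleftrightarrow> inj_on c V \<and> (\<forall>e\<in>E. \<exists>v\<in>e. C e = c v)"

definition colors_at :: "'v set set \<Rightarrow> ('v set \<Rightarrow> nat) \<Rightarrow> 'v \<Rightarrow> nat" where
  "colors_at E C v = card {C e | e. e \<in> E \<and> v \<in> e}"

definition valid_star_coloring ::
    "'v set \<Rightarrow> 'v set set \<Rightarrow> ('v \<Rightarrow> nat) \<Rightarrow> ('v \<Rightarrow> nat) \<Rightarrow> ('v set \<Rightarrow> nat) \<Rightarrow> bool" where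
  "valid_star_coloring V E \<kappa> c C \<longleftrightarrow>
     star_coloring V E c C \<and> (\<forall>v\<in>V. colors_at E C v \<le> \<kappa> v)"

definition max_colors :: "'v set \<Rightarrow> 'v set set \<Rightarrow> ('v set \<Rightarrow> nat) \<Rightarrow> nat" where
  "max_colors V E C = Max (colors_at E C ` V)"

text \<open>An infimum in \<^typ>\<open>enat\<close> is attained if the set is non-empty, and is \<open>\<infinity>\<close> otherwise.\<close>

definition min_star_colors :: "'v set \<Rightarrow> 'v set set \<Rightarrow> ('v \<Rightarrow> nat) \<Rightarrow> enat" where
  "min_star_colors V E \<kappa> =
     Inf {enat (max_colors V E C) | c C. valid_star_coloring V E \<kappa> c C}"


section \<open>Random access machine with uniform cost\<close>

text \<open>
  Algorithms are programs of a structured language over the memory of a random access machine: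
  finitely many registers and zero-initialized arrays, each holding natural numbers, with
  indirect addressing only through array indices. Every operation costs one step. The only
  arithmetic is addition and truncated subtraction: a unit-cost multiplication on unbounded
  numbers would make the model unreasonably powerful. A program mentions
  finitely many fixed arrays, which could be interleaved in one memory at constant-factor cost.
\<close>

datatype exp =
    Const nat
  | Reg nat
  | Read nat exp  \<comment> \<open>array name, index\<close>
  | Plus exp exp
  | Minus exp exp

datatype com =
    Skip
  | Assign nat exp
  | Write nat exp exp  \<comment> \<open>array name, index, value\<close>
  | Seq com com
  | If exp com com     \<comment> \<open>a condition holds if its value is non-zero\<close>
  | While exp com

record state =
  reg :: "nat \<Rightarrow> nat"
  arr :: "nat \<Rightarrow> nat \<Rightarrow> nat"

fun val :: "state \<Rightarrow> exp \<Rightarrow> nat" where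
  "val s (Const k) = k"
| "val s (Reg r) = reg s r"
| "val s (Read a e) = arr s a (val s e)"
| "val s (Plus e1 e2) = val s e1 + val s e2"
| "val s (Minus e1 e2) = val s e1 - val s e2"

fun cost :: "exp \<Rightarrow> nat" where
  "cost (Const k) = 1"
| "cost (Reg r) = 1"
| "cost (Read a e) = cost e + 1"
| "cost (Plus e1 e2) = cost e1 + cost e2 + 1"
| "cost (Minus e1 e2) = cost e1 + cost e2 + 1"

text \<open>\<open>run P s t s'\<close>: started in \<open>s\<close>, program \<open>P\<close> halts after exactly \<open>t\<close> steps in \<open>s'\<close>.\<close>

inductive run :: "com \<Rightarrow> state \<Rightarrow> nat \<Rightarrow> state \<Rightarrow> bool" where
  Skip: "run Skip s 1 s"
| Assign: "run (Assign r e) s (cost e + 1) (s\<lparr>reg := (reg s)(r := val s e)\<rparr>)"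
| Write: "run (Write a i e) s (cost i + cost e + 1)
     (s\<lparr>arr := (arr s)(a := (arr s a)(val s i := val s e))\<rparr>)"
| Seq: "run P s t s' \<Longrightarrow> run Q s' t' s'' \<Longrightarrow> run (Seq P Q) s (t + t') s''"
| IfTrue: "val s b \<noteq> 0 \<Longrightarrow> run P s t s' \<Longrightarrow> run (If b P Q) s (cost b + 1 + t) s'"
| IfFalse: "val s b = 0 \<Longrightarrow> run Q s t s' \<Longrightarrow> run (If b P Q) s (cost b + 1 + t) s'"
| WhileTrue: "val s b \<noteq> 0 \<Longrightarrow> run P s t s' \<Longrightarrow> run (While b P) s' t' s'' \<Longrightarrow>
     run (While b P) s (cost b + 1 + t + t') s''"
| WhileFalse: "val s b = 0 \<Longrightarrow> run (While b P) s (cost b + 1) s"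

inductive_cases run_SkipE: "run Skip s t s'"
inductive_cases run_AssignE: "run (Assign r e) s t s'"
inductive_cases run_WriteE: "run (Write a i e) s t s'"
inductive_cases run_SeqE: "run (Seq P Q) s t s'"

lemma run_deterministic:
  "run P s t s' \<Longrightarrow> run P s u s'' \<Longrightarrow> t = u \<and> s' = s''"
proof (induction arbitrary: u s'' rule: run.induct)
  case (Seq P s t s1 Q t' s2)
  then show ?case by (elim run_SeqE) blast
next
  case (IfTrue s b P t s1 Q)
  note IH = IfTrue.IH and nz = IfTrue.hyps(1)
  from IfTrue.prems show ?case
  proof cases
    case (IfTrue t1)
    with IH show ?thesis by blast
  qed (use nz in simp)
next
  case (IfFalse s b Q t s1 P)
  note IH = IfFalse.IH and z = IfFalse.hyps(1)
  from IfFalse.prems show ?case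
  proof cases
    case (IfFalse t1)
    with IH show ?thesis by blast
  qed (use z in simp)
next
  case (WhileTrue s b P t s1 t' s2)
  note IH = WhileTrue.IH and nz = WhileTrue.hyps(1)
  from WhileTrue.prems show ?case
  proof cases
    case (WhileTrue t1 s3 t2)
    with IH show ?thesis by blast
  qed (use nz in simp)
next
  case (WhileFalse s b P)
  from WhileFalse.prems show ?case
    by cases (use WhileFalse.hyps in simp_all)
qed (auto elim: run_SkipE run_AssignE run_WriteE)


section \<open>Input and output\<close>

text \<open>
  The input is the word \<open>|V|, |E|\<close>, capacities, edge list. The nodes are numbered from \<open>0\<close> in
  an arbitrary order, and every edge is listed once, in an arbitrary order and orientation, as
  the pair of the numbers of its endpoints.
\<close>

definition encodes :: "'v set \<Rightarrow> 'v set set \<Rightarrow> ('v \<Rightarrow> nat) \<Rightarrow> nat list \<Rightarrow> bool" where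
  "encodes V E \<kappa> w \<longleftrightarrow>
     (\<exists>vs es. distinct vs \<and> set vs = V \<and>
        (\<forall>(i, j)\<in>set es. i < length vs \<and> j < length vs) \<and>
        distinct (map (\<lambda>(i, j). {vs ! i, vs ! j}) es) \<and>
        set (map (\<lambda>(i, j). {vs ! i, vs ! j}) es) = E \<and>
        w = [length vs, length es] @ map \<kappa> vs @ concat (map (\<lambda>(i, j). [i, j]) es))"

lemma encodes_exists:
  assumes "simple_graph V E"
  shows "\<exists>w. encodes V E \<kappa> w"
proof -
  have fV: "finite V" and E: "\<And>e. e \<in> E \<Longrightarrow> e \<subseteq> V \<and> card e = 2"
    using assms by (auto simp: simple_graph_def)
  obtain vs where vs: "set vs = V" "distinct vs"
    using finite_distinct_list[OF fV] by blast
  have "E \<subseteq> Pow V" using E by blast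
  then have "finite E" using fV by (meson finite_Pow_iff finite_subset)
  then obtain xs where xs: "set xs = E" "distinct xs"
    using finite_distinct_list by blast
  have "\<exists>p. fst p < length vs \<and> snd p < length vs \<and> {vs ! fst p, vs ! snd p} = e"
    if e: "e \<in> E" for e
  proof -
    obtain a b where ab: "e = {a, b}" using E[OF e] by (auto simp: card_2_iff)
    then have "a \<in> set vs" "b \<in> set vs" using E[OF e] vs by auto
    then obtain i j where "i < length vs" "vs ! i = a" "j < length vs" "vs ! j = b"
      by (auto simp: in_set_conv_nth)
    then show ?thesis using ab by (intro exI[of _ "(i, j)"]) auto
  qed
  then obtain f where f: "\<And>e. e \<in> E \<Longrightarrow> fst (f e) < length vs \<and> snd (f e) < length vs \<and>
      {vs ! fst (f e), vs ! snd (f e)} = e"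
    by metis
  have m: "map (\<lambda>(i, j). {vs ! i, vs ! j}) (map f xs) = xs"
    using f xs by (auto simp: case_prod_beta intro!: map_idI)
  have "\<forall>(i, j)\<in>set (map f xs). i < length vs \<and> j < length vs"
    using f xs by (auto simp: case_prod_beta)
  then show ?thesis
    unfolding encodes_def using vs xs
    by (intro exI[of _ vs] exI[of _ "map f xs"] exI conjI) (simp_all only: m)
qed

definition initial_state :: "nat list \<Rightarrow> state" where
  "initial_state w =
     \<lparr>reg = (\<lambda>_. 0), arr = (\<lambda>a i. if a = 0 \<and> i < length w then w ! i else 0)\<rparr>"

definition encode_result :: "enat \<Rightarrow> nat" where
  "encode_result x = (case x of enat k \<Rightarrow> Suc k | \<infinity> \<Rightarrow> 0)"

text \<open>The result is read off from register \<open>0\<close>.\<close>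

definition computes_within :: "com \<Rightarrow> nat list \<Rightarrow> enat \<Rightarrow> real \<Rightarrow> bool" where
  "computes_within P w x T \<longleftrightarrow>
     (\<exists>t s. run P (initial_state w) t s \<and> reg s 0 = encode_result x \<and> real t \<le> T)"

end

theory Submission
  imports Defs "HOL-Library.FuncSet"
begin

text \<open>
  An edge that carries the color of its endpoint \<open>u\<close> contributes a color of its own at the other
  endpoint \<open>v\<close>, and at \<open>u\<close> only the color of \<open>u\<close>, which all edges colored by \<open>u\<close> share. Let \<open>v\<close>
  \<^emph>\<open>own\<close> that edge, and let the \<^emph>\<open>load\<close> of a node be the number of edges that it owns. A node of
  degree \<open>d\<close> and load \<open>l\<close> then sees \<open>l\<close> colors if \<open>l = d\<close> and \<open>l + 1\<close> otherwise. Hence a valid star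
  coloring with at most \<open>k\<close> colors at every node is the same thing as an orientation of the graph
  in which each node has a load below a bound that depends on \<open>k\<close>, its degree and its capacity
  (\<open>feasible_iff_coloring\<close>). The bound grows with \<open>k\<close> and is constant from the maximum degree on,
  so a binary search with \<open>O(log \<Delta>)\<close> feasibility tests finds the least \<open>k\<close>.

  A test starts from any orientation and passes edges on, one at a time, from the overloaded nodes
  to the nodes with slack. This is a flow problem with unit capacities on the edges, solved in
  two stages with a parameter \<open>D\<close>.

  The first stage is push-relabel with distance labels up to \<open>D\<close>. Between two relabelings of a node
  its incidence list is scanned at most once, so that the stage takes \<open>O((n + m) D)\<close> steps. At its end
  all overloaded nodes have label \<open>D\<close>, and all nodes with slack have label \<open>0\<close>.

  The second stage looks for augmenting paths by breadth-first search until there are no overloaded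
  nodes or the search is stuck, in which case the reached set proves infeasibility. For
  \<open>1 \<le> i \<le> D\<close> the set \<open>S\<close> of nodes with label at least \<open>i\<close> separates the overloaded nodes from the
  nodes with slack, so every augmentation lowers the number of owned edges that leave \<open>S\<close>. Such an
  edge leads from level \<open>i\<close> to level \<open>i - 1\<close>. As the levels are disjoint, some \<open>i\<close> has at most \<open>m / D\<close>
  of them, and, as the graph is simple, some \<open>i\<close> has at most \<open>(n / D)\<^sup>2\<close>. If \<open>D\<close> is the least positive
  number with \<open>D\<^sup>2 \<ge> m\<close> or \<open>D\<^sup>3 \<ge> n\<^sup>2\<close>, then one of these bounds is at most \<open>D\<close> (\<open>small_cut\<close>), and so
  \<open>D + 1\<close> searches of \<open>O(n + m)\<close> steps are enough. Moreover \<open>D - 1\<close> is at most \<open>m\<^sup>1\<^sup>/\<^sup>2\<close> and \<open>n\<^sup>2\<^sup>/\<^sup>3\<close>, and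
  \<open>n \<le> 2 m\<close> holds in a connected graph with at least two nodes, so one test takes
  \<open>O(m min(n\<^sup>2\<^sup>/\<^sup>3, m\<^sup>1\<^sup>/\<^sup>2))\<close> steps.

  All inner loops of the program have straight-line bodies. The state after such a body is computed
  by \<open>exec\<close>, so that an invariant is checked by rewriting, and the cost of a loop is the initial
  value of a variant times the length of its body.
\<close>

section \<open>Running time of programs\<close>

notation Seq (infixr ";;" 60)

definition terminates :: "com \<Rightarrow> state \<Rightarrow> nat \<Rightarrow> (state \<Rightarrow> bool) \<Rightarrow> bool" where
  "terminates P s T Q \<longleftrightarrow> (\<exists>t s'. run P s t s' \<and> t \<le> T \<and> Q s')"

fun reg_writes :: "com \<Rightarrow> nat set" where
  "reg_writes Skip = {}"
| "reg_writes (Assign r e) = {r}"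
| "reg_writes (Write a i e) = {}"
| "reg_writes (P ;; Q) = reg_writes P \<union> reg_writes Q"
| "reg_writes (If b P Q) = reg_writes P \<union> reg_writes Q"
| "reg_writes (While b P) = reg_writes P"

fun arr_writes :: "com \<Rightarrow> nat set" where
  "arr_writes Skip = {}"
| "arr_writes (Assign r e) = {}"
| "arr_writes (Write a i e) = {a}"
| "arr_writes (P ;; Q) = arr_writes P \<union> arr_writes Q"
| "arr_writes (If b P Q) = arr_writes P \<union> arr_writes Q"
| "arr_writes (While b P) = arr_writes P"

text \<open>
The frame of a program, read off from its assignments. The rules below hand it to the continuation,
so that the invariant of a loop only has to speak of what the loop changes.
\<close>

definition same :: "com \<Rightarrow> state \<Rightarrow> state \<Rightarrow> bool" where
  "same P s s' \<longleftrightarrow> (\<forall>r. r \<notin> reg_writes P \<longrightarrow> reg s' r = reg s r) \<and>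
     (\<forall>a. a \<notin> arr_writes P \<longrightarrow> arr s' a = arr s a)"

lemma same_reg: "same P s s' \<Longrightarrow> r \<notin> reg_writes P \<Longrightarrow> reg s' r = reg s r"
  and same_arr: "same P s s' \<Longrightarrow> a \<notin> arr_writes P \<Longrightarrow> arr s' a = arr s a"
  by (auto simp: same_def)

lemma same_refl: "same P s s"
  by (simp add: same_def)

lemma run_same: "run P s t s' \<Longrightarrow> same P s s'"
  by (induction rule: run.induct) (auto simp: same_def)

lemma terminates_mono:
  "terminates P s T Q \<Longrightarrow> T \<le> T' \<Longrightarrow> (\<And>s'. Q s' \<Longrightarrow> same P s s' \<Longrightarrow> Q' s') \<Longrightarrow>
    terminates P s T' Q'"
  unfolding terminates_def using run_same order_trans by blast

lemma terminates_Seq: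
  assumes "terminates P s Ta R" and "\<And>s'. R s' \<Longrightarrow> same P s s' \<Longrightarrow> terminates Q s' Tb S"
    and "Ta + Tb \<le> T"
  shows "terminates (P ;; Q) s T S"
proof -
  obtain t s' where 1: "run P s t s'" "t \<le> Ta" "R s'"
    using assms(1) by (auto simp: terminates_def)
  then obtain u s'' where 2: "run Q s' u s''" "u \<le> Tb" "S s''"
    using assms(2) run_same by (fastforce simp: terminates_def)
  show ?thesis unfolding terminates_def
    using run.Seq[OF 1(1) 2(1)] 1 2 assms(3) by (intro exI[of _ "t+u"] exI[of _ s'']) auto
qed

lemma terminates_If:
  assumes "val s b \<noteq> 0 \<Longrightarrow> terminates P s Ta R" and "val s b = 0 \<Longrightarrow> terminates Q s Ta R"
    and "cost b + 1 + Ta \<le> T"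
  shows "terminates (If b P Q) s T R"
proof (cases "val s b = 0")
  case True
  then obtain t s' where "run Q s t s'" "t \<le> Ta" "R s'"
    using assms(2) by (auto simp: terminates_def)
  with True assms(3) show ?thesis unfolding terminates_def
    by (intro exI[of _ "cost b + 1 + t"] exI[of _ s']) (use run.IfFalse in auto)
next
  case False
  then obtain t s' where "run P s t s'" "t \<le> Ta" "R s'"
    using assms(1) by (auto simp: terminates_def)
  with False assms(3) show ?thesis unfolding terminates_def
    by (intro exI[of _ "cost b + 1 + t"] exI[of _ s']) (use run.IfTrue in auto)
qed

text \<open>
A loop-free program has an explicit final state and a bound on its cost that does not depend on the
state. The clauses of \<open>exec\<close> and \<open>len\<close> for loops are dummies.
\<close>

fun straight :: "com \<Rightarrow> bool" where
  "straight (P ;; Q) \<longleftrightarrow> straight P \<and> straight Q"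
| "straight (If b P Q) \<longleftrightarrow> straight P \<and> straight Q"
| "straight (While b P) \<longleftrightarrow> False"
| "straight _ \<longleftrightarrow> True"

fun exec :: "com \<Rightarrow> state \<Rightarrow> state" where
  "exec Skip s = s"
| "exec (Assign r e) s = s\<lparr>reg := (reg s)(r := val s e)\<rparr>"
| "exec (Write a i e) s = s\<lparr>arr := (arr s)(a := (arr s a)(val s i := val s e))\<rparr>"
| "exec (P ;; Q) s = exec Q (exec P s)"
| "exec (If b P Q) s = (if val s b = 0 then exec Q s else exec P s)"
| "exec (While b P) s = s"

fun len :: "com \<Rightarrow> nat" where
  "len Skip = 1"
| "len (Assign r e) = cost e + 1"
| "len (Write a i e) = cost i + cost e + 1"
| "len (P ;; Q) = len P + len Q"
| "len (If b P Q) = cost b + 1 + max (len P) (len Q)"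
| "len (While b P) = 0"

lemma run_exec: "straight P \<Longrightarrow> \<exists>t\<le>len P. run P s t (exec P s)"
proof (induction P arbitrary: s)
  case (Seq P Q)
  obtain t u where "run P s t (exec P s)" "t \<le> len P"
    "run Q (exec P s) u (exec Q (exec P s))" "u \<le> len Q"
    using Seq.IH(1)[of s] Seq.IH(2)[of "exec P s"] Seq.prems by auto
  then show ?case by (intro exI[of _ "t+u"]) (auto intro: run.intros)
next
  case (If b P Q)
  obtain t u where tu: "run P s t (exec P s)" "t \<le> len P" "run Q s u (exec Q s)" "u \<le> len Q"
    using If.IH(1)[of s] If.IH(2)[of s] If.prems by auto
  show ?case
  proof (cases "val s b = 0")
    case True
    with tu run.IfFalse[OF True tu(3)] show ?thesis
      by (intro exI[of _ "cost b + 1 + u"]) auto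
  next
    case False
    with tu run.IfTrue[OF False tu(1)] show ?thesis
      by (intro exI[of _ "cost b + 1 + t"]) auto
  qed
next
  case Skip
  show ?case using run.Skip[of s] by fastforce
next
  case (Assign r e)
  show ?case using run.Assign[of r e s] by fastforce
next
  case (Write a i e)
  show ?case using run.Write[of a i e s] by fastforce
qed simp

lemma terminates_straight:
  "straight P \<Longrightarrow> len P \<le> T \<Longrightarrow> Q (exec P s) \<Longrightarrow> terminates P s T Q"
  unfolding terminates_def using run_exec[of P s] order_trans by blast

lemma same_trans: "same P s s' \<Longrightarrow> same P s' s'' \<Longrightarrow> same P s s''"
  by (auto simp: same_def)

lemma terminates_While:
  assumes inv: "I s0"
    and body: "\<And>s. I s \<Longrightarrow> same P s0 s \<Longrightarrow> val s b \<noteq> 0 \<Longrightarrow>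
      terminates P s c (\<lambda>s'. I s' \<and> f s' < (f s :: nat))"
    and T: "f s0 * (c + cost b + 1) + cost b + 1 \<le> T"
  shows "terminates (While b P) s0 T (\<lambda>s. I s \<and> val s b = 0)"
proof -
  have "\<exists>t s'. run (While b P) s t s' \<and> t \<le> f s * (c + cost b + 1) + cost b + 1 \<and>
      I s' \<and> val s' b = 0" if "I s" "same P s0 s" for s
    using that
  proof (induction "f s" arbitrary: s rule: less_induct)
    case less
    show ?case
    proof (cases "val s b = 0")
      case True
      with less.prems show ?thesis
        by (intro exI[of _ "cost b + 1"] exI[of _ s]) (use run.WhileFalse[OF True] in auto)
    next
      case False
      then obtain t s' where 1: "run P s t s'" "t \<le> c" "I s'" "f s' < f s"
        using body[of s] less.prems by (auto simp: terminates_def)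
      then have "same P s0 s'" using run_same same_trans less.prems(2) by blast
      then obtain u s'' where 2: "run (While b P) s' u s''"
          "u \<le> f s' * (c + cost b + 1) + cost b + 1" "I s''" "val s'' b = 0"
        using less.hyps[of s'] 1 by blast
      have "Suc (f s') * (c + cost b + 1) \<le> f s * (c + cost b + 1)"
        using 1(4) by (intro mult_right_mono) auto
      then have "cost b + 1 + t + u \<le> f s * (c + cost b + 1) + cost b + 1"
        using 1(2) 2(2) by simp
      then show ?thesis using run.WhileTrue[OF False 1(1) 2(1)] 2(3,4) by blast
    qed
  qed
  from this[OF inv same_refl] T show ?thesis
    unfolding terminates_def by (meson order_trans)
qed

lemma terminates_While_straight:
  assumes "I s0" and "straight P"
    and "\<And>s. I s \<Longrightarrow> same P s0 s \<Longrightarrow> val s b \<noteq> 0 \<Longrightarrow> I (exec P s) \<and> f (exec P s) < (f s :: nat)"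
    and "f s0 * (len P + cost b + 1) + cost b + 1 \<le> T"
  shows "terminates (While b P) s0 T (\<lambda>s. I s \<and> val s b = 0)"
  by (rule terminates_While[where c = "len P" and f = f])
    (use assms in \<open>auto intro!: terminates_straight\<close>)

lemma terminates_for:
  assumes "I s0" and "straight P"
    and "\<And>s. I s \<Longrightarrow> reg s i < reg s m \<Longrightarrow> I (exec P s) \<and>
      reg (exec P s) m - reg (exec P s) i < reg s m - reg s i"
    and "(len P + 4) * (reg s0 m - reg s0 i) + 4 \<le> T"
  shows "terminates (While (Minus (Reg m) (Reg i)) P) s0 T (\<lambda>s. I s \<and> reg s m \<le> reg s i)"
  by (rule terminates_mono[OF terminates_While_straight[where f = "\<lambda>s. reg s m - reg s i" and I = I]])
    (use assms in \<open>auto simp: algebra_simps\<close>)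


section \<open>Half-edge graphs and orientations\<close>

text \<open>
Each edge is split into two half-edges, one at each endpoint, numbered below \<open>M\<close>; \<open>par\<close> maps a
half-edge to the other half of its edge.
\<close>

locale half_edge_graph =
  fixes n M :: nat and tail par :: "nat \<Rightarrow> nat"
  assumes par_less: "h < M \<Longrightarrow> par h < M"
    and par_par: "h < M \<Longrightarrow> par (par h) = h"
    and tail_less: "h < M \<Longrightarrow> tail h < n"
    and loopfree: "h < M \<Longrightarrow> tail (par h) \<noteq> tail h"
    and simple: "inj_on (\<lambda>h. (tail h, tail (par h))) {..<M}"
begin

abbreviation tip :: "nat \<Rightarrow> nat" where "tip h \<equiv> tail (par h)"

definition deg :: "nat \<Rightarrow> nat" where "deg v = card {h. h < M \<and> tail h = v}"

text \<open>
The half of an edge with value \<open>1\<close> is the one at the node that owns the edge.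
\<close>

definition orientation :: "(nat \<Rightarrow> nat) \<Rightarrow> bool" where
  "orientation own \<longleftrightarrow> (\<forall>h<M. own h + own (par h) = 1)"

definition load :: "(nat \<Rightarrow> nat) \<Rightarrow> nat \<Rightarrow> nat" where
  "load own v = (\<Sum>h | h < M \<and> tail h = v. own h)"

definition inner :: "nat set \<Rightarrow> nat set" where
  "inner S = {h. h < M \<and> tail h \<in> S \<and> tip h \<in> S}"

definition outflow :: "(nat \<Rightarrow> nat) \<Rightarrow> nat set \<Rightarrow> nat" where
  "outflow own S = (\<Sum>h | h < M \<and> tail h \<in> S \<and> tip h \<notin> S. own h)"

text \<open>
The strict inequality lets \<open>cap v = 0\<close> express that no load at all is admissible at \<open>v\<close>, as needed
for a node of positive degree that may not see any color. Accordingly, a node is overloaded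
if \<open>cap v \<le> load v\<close>, and it has slack if \<open>load v + 1 < cap v\<close>.
\<close>

definition feasible :: "(nat \<Rightarrow> nat) \<Rightarrow> bool" where
  "feasible cap \<longleftrightarrow> (\<exists>own. orientation own \<and> (\<forall>v<n. load own v < cap v))"

lemma own_cases: "orientation own \<Longrightarrow> h < M \<Longrightarrow> own h = 0 \<or> own h = 1"
  by (auto simp: orientation_def)

lemma own_par: "orientation own \<Longrightarrow> h < M \<Longrightarrow> own (par h) = 1 - own h"
  unfolding orientation_def by (metis add_diff_cancel_left')

lemma par_neq: "h < M \<Longrightarrow> par h \<noteq> h"
  using loopfree by metis

text \<open>
Both halves of an edge inside \<open>S\<close> lie in \<open>inner S\<close>, and exactly one of them is owned. So the owned
edges inside \<open>S\<close> number half of \<open>inner S\<close>, whatever the orientation.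
\<close>

lemma sum_inner:
  assumes "orientation own"
  shows "2 * (\<Sum>h\<in>inner S. own h) = card (inner S)"
proof -
  have "bij_betw par (inner S) (inner S)"
    by (rule bij_betwI[where g = par]) (auto simp: inner_def par_less par_par)
  then have "(\<Sum>h\<in>inner S. own (par h)) = (\<Sum>h\<in>inner S. own h)"
    by (rule sum.reindex_bij_betw)
  then have "2 * (\<Sum>h\<in>inner S. own h) = (\<Sum>h\<in>inner S. own h + own (par h))"
    by (simp add: sum.distrib)
  also have "\<dots> = (\<Sum>h\<in>inner S. 1)"
    using assms by (intro sum.cong) (auto simp: inner_def orientation_def)
  finally show ?thesis by simp
qed

lemma sum_inner_eq:
  "orientation own \<Longrightarrow> orientation own' \<Longrightarrow> (\<Sum>h\<in>inner S. own h) = (\<Sum>h\<in>inner S. own' h)"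
  using sum_inner[of own S] sum_inner[of own' S] by simp

lemma sum_load:
  assumes "finite S"
  shows "(\<Sum>v\<in>S. load own v) = (\<Sum>h\<in>inner S. own h) + outflow own S"
proof -
  have "(\<Sum>v\<in>S. load own v) = (\<Sum>h\<in>(\<Union>v\<in>S. {h. h < M \<and> tail h = v}). own h)"
    unfolding load_def using assms by (subst sum.UNION_disjoint) auto
  also have "(\<Union>v\<in>S. {h. h < M \<and> tail h = v}) =
      inner S \<union> {h. h < M \<and> tail h \<in> S \<and> tip h \<notin> S}"
    by (auto simp: inner_def)
  also have "(\<Sum>h\<in>\<dots>. own h) = (\<Sum>h\<in>inner S. own h) + outflow own S"
    unfolding outflow_def by (rule sum.union_disjoint) (auto simp: inner_def)
  finally show ?thesis .
qed

text \<open>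
If no owned edge leaves \<open>S\<close>, then the total load on \<open>S\<close> is the number of edges inside \<open>S\<close>, which is
the least possible in any orientation. A solution would have at most the present load on every node
of \<open>S\<close> and strictly less on the overloaded node \<open>a\<close>, hence a smaller total.
\<close>

lemma closed_infeasible:
  assumes own: "orientation own" and S: "S \<subseteq> {..<n}"
    and closed: "\<And>h. h < M \<Longrightarrow> own h = 1 \<Longrightarrow> tail h \<in> S \<Longrightarrow> tip h \<in> S"
    and full: "\<And>v. v \<in> S \<Longrightarrow> cap v \<le> load own v + 1"
    and a: "a \<in> S" "cap a \<le> load own a"
  shows "\<not> feasible cap"
proof
  assume "feasible cap"
  then obtain own' where own': "orientation own'" "\<And>v. v < n \<Longrightarrow> load own' v < cap v"
    by (auto simp: feasible_def)
  have fin: "finite S" using S finite_subset by blast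
  have "outflow own S = 0"
    unfolding outflow_def using closed own_cases[OF own] by (intro sum.neutral) auto
  then have "(\<Sum>v\<in>S. load own v) \<le> (\<Sum>v\<in>S. load own' v)"
    using sum_load[OF fin] sum_inner_eq[OF own own'(1)] by simp
  moreover have "(\<Sum>v\<in>S. load own' v) < (\<Sum>v\<in>S. load own v)"
  proof (rule sum_strict_mono_ex1[OF fin])
    show "\<forall>v\<in>S. load own' v \<le> load own v"
    proof
      fix v assume v: "v \<in> S"
      then have "load own' v < cap v" using own'(2) S by auto
      then show "load own' v \<le> load own v" using full[OF v] by linarith
    qed
    have "load own' a < cap a" using own'(2) S a by auto
    then show "\<exists>v\<in>S. load own' v < load own v" using a by (intro bexI[of _ a]) auto
  qed
  ultimately show False by simp
qed

lemma orientation_flip: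
  assumes "orientation own" "h < M"
  shows "orientation (own(h := 0, par h := 1))"
  unfolding orientation_def
proof (intro allI impI)
  fix g assume g: "g < M"
  have "par g = par h \<longleftrightarrow> g = h" "par g = h \<longleftrightarrow> g = par h"
    using par_par g assms(2) by metis+
  then show "(own(h := 0, par h := 1)) g + (own(h := 0, par h := 1)) (par g) = 1"
    using assms g par_neq[of h] par_neq[of g] par_par[OF assms(2)]
    by (auto simp: orientation_def)
qed

lemma load_flip:
  assumes own: "orientation own" and h: "h < M" "own h = 1"
  shows "load (own(h := 0, par h := 1)) =
    (load own)(tail h := load own (tail h) - 1, tip h := load own (tip h) + 1)"
proof
  fix v
  let ?own' = "own(h := 0, par h := 1)"
  have p0: "own (par h) = 0" using own_par[OF own h(1)] h(2) by simp
  have ne: "par h \<noteq> h" "tip h \<noteq> tail h" using par_neq h(1) loopfree by auto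
  have pM: "par h < M" using par_less h by simp
  define X where "X = {g. g < M \<and> tail g = v} - {h, par h}"
  have fX: "finite X" by (simp add: X_def)
  have same: "(\<Sum>g\<in>X. ?own' g) = (\<Sum>g\<in>X. own g)"
    by (intro sum.cong) (auto simp: X_def)
  consider "v = tail h" | "v = tip h" "v \<noteq> tail h" | "v \<noteq> tail h" "v \<noteq> tip h" by blast
  then show "load ?own' v =
    ((load own)(tail h := load own (tail h) - 1, tip h := load own (tip h) + 1)) v"
  proof cases
    case 1
    then have "{g. g < M \<and> tail g = v} = insert h X" "h \<notin> X"
      using h ne by (auto simp: X_def)
    then show ?thesis using 1 same ne h fX by (simp add: load_def)
  next
    case 2
    then have "{g. g < M \<and> tail g = v} = insert (par h) X" "par h \<notin> X"
      using pM ne by (auto simp: X_def)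
    then show ?thesis using 2 same ne p0 fX by (simp add: load_def)
  next
    case 3
    then have "{g. g < M \<and> tail g = v} = X" by (auto simp: X_def)
    then show ?thesis using 3 same by (simp add: load_def)
  qed
qed

lemma load_pos:
  assumes "h < M" "own h = 1"
  shows "load own (tail h) \<ge> 1"
proof -
  have "own h \<le> (\<Sum>g | g < M \<and> tail g = tail h. own g)"
    using assms by (intro member_le_sum) auto
  then show ?thesis using assms by (simp add: load_def)
qed

lemma sum_deg: "(\<Sum>v<n. deg v) = M"
proof -
  have "(\<Sum>v<n. deg v) = card (\<Union>v<n. {h. h < M \<and> tail h = v})"
    unfolding deg_def by (subst card_UN_disjoint) auto
  also have "(\<Union>v<n. {h. h < M \<and> tail h = v}) = {..<M}"
    using tail_less by auto
  finally show ?thesis by simp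
qed

text \<open>
An edge owned by \<open>v\<close> can be passed on to its other endpoint, so it is a residual arc out of \<open>v\<close>.
Valid labels drop by at most one along residual arcs.
\<close>

definition valid_labels :: "(nat \<Rightarrow> nat) \<Rightarrow> (nat \<Rightarrow> nat) \<Rightarrow> bool" where
  "valid_labels own d \<longleftrightarrow> (\<forall>h<M. own h = 1 \<longrightarrow> d (tail h) \<le> d (tip h) + 1)"

lemma exists_small_term:
  fixes f :: "nat \<Rightarrow> nat"
  assumes "D \<ge> 1" "(\<Sum>i=1..D. f i) \<le> B"
  shows "\<exists>i\<in>{1..D}. D * f i \<le> B"
proof (rule ccontr)
  assume neg: "\<not> ?thesis"
  have "D * (\<Sum>i=1..D. f i) = (\<Sum>i=1..D. D * f i)" by (simp add: sum_distrib_left)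
  also have "\<dots> \<ge> (\<Sum>i=1..D. B + 1)"
    using neg by (intro sum_mono) (auto simp: not_le Suc_leI)
  finally have "D * (B + 1) \<le> D * (\<Sum>i=1..D. f i)" by simp
  then have "B + 1 \<le> (\<Sum>i=1..D. f i)" using assms(1) by (subst (asm) mult_le_cancel1) auto
  then show False using assms(2) by simp
qed

text \<open>
Owned edges that leave the set of labels at least \<open>i\<close> lead from level \<open>i\<close> to level \<open>i - 1\<close>. For
distinct \<open>i\<close> these edges are distinct, so the smallest of the \<open>D\<close> cuts has at most \<open>M / (2 D)\<close> edges.
There are also at most as many as pairs of nodes in the two levels, and averaging over \<open>i\<close> gives two
consecutive levels with at most \<open>2 n / D\<close> nodes in total, hence at most \<open>(n / D)\<^sup>2\<close> pairs.
\<close>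

lemma small_cut:
  assumes own: "orientation own" and d: "valid_labels own d"
    and D: "D \<ge> 1" "M \<le> 2 * D^2 \<or> n^2 \<le> D^3"
  obtains i where "1 \<le> i" "i \<le> D" "outflow own {v. v < n \<and> i \<le> d v} \<le> D"
proof -
  define S where "S i = {v. v < n \<and> i \<le> d v}" for i
  define A where "A i = {h. h < M \<and> tail h \<in> S i \<and> tip h \<notin> S i \<and> own h = 1}" for i
  define L where "L i = {v. v < n \<and> d v = i}" for i
  have lev: "d (tail h) = i \<and> d (tip h) + 1 = i" if "h \<in> A i" for h i
    using that d tail_less[of h] tail_less[OF par_less, of h]
    by (fastforce simp: A_def S_def valid_labels_def)
  have out: "outflow own (S i) = card (A i)" for i
  proof -
    have "outflow own (S i) = (\<Sum>h\<in>A i. own h)"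
      unfolding outflow_def 
      by (rule sum.mono_neutral_right) (use own_cases[OF own] in \<open>fastforce simp: A_def\<close>)+
    also have "\<dots> = (\<Sum>h\<in>A i. 1)" by (intro sum.cong) (auto simp: A_def)
    finally show ?thesis by simp
  qed
  have "\<exists>i\<in>{1..D}. card (A i) \<le> D"
    using D(2)
  proof
    assume M: "M \<le> 2 * D^2"
    have "(\<Sum>i=1..D. card (A i)) = card (\<Union>i\<in>{1..D}. A i)"
    proof (rule card_UN_disjoint[symmetric])
      show "\<forall>i\<in>{1..D}. finite (A i)" by (simp add: A_def)
      show "\<forall>i\<in>{1..D}. \<forall>j\<in>{1..D}. i \<noteq> j \<longrightarrow> A i \<inter> A j = {}" using lev by blast
    qed simp
    also have "\<dots> \<le> card {h. h < M \<and> own h = 1}"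
      by (intro card_mono) (auto simp: A_def)
    also have "card {h. h < M \<and> own h = 1} = (\<Sum>h\<in>{h. h < M \<and> own h = 1}. own h)" by simp
    also have "\<dots> = (\<Sum>h<M. own h)"
      by (rule sum.mono_neutral_left) (use own_cases[OF own] in \<open>fastforce+\<close>)
    also have "{..<M} = inner {..<n}"
      using tail_less par_less by (auto simp: inner_def)
    finally have "2 * (\<Sum>i=1..D. card (A i)) \<le> card (inner {..<n})"
      using sum_inner[OF own, of "{..<n}"] by linarith
    also have "inner {..<n} \<subseteq> {..<M}" by (auto simp: inner_def)
    then have "card (inner {..<n}) \<le> M" using card_mono[of "{..<M}"] by fastforce
    finally have "(\<Sum>i=1..D. card (A i)) \<le> D^2" using M by linarith
    from exists_small_term[OF D(1) this] obtain i where "i\<in>{1..D}" "D * card (A i) \<le> D * D"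
      by (auto simp: power2_eq_square)
    then show ?thesis using D(1) by auto
  next
    assume n: "n^2 \<le> D^3"
    have L: "(\<Sum>i\<in>I. card (L i)) \<le> n" if "finite I" for I
    proof -
      have "(\<Sum>i\<in>I. card (L i)) = card (\<Union>i\<in>I. L i)"
        using that by (intro card_UN_disjoint[symmetric]) (auto simp: L_def)
      also have "\<dots> \<le> card {..<n}" by (intro card_mono) (auto simp: L_def)
      finally show ?thesis by simp
    qed
    have "(\<Sum>i=1..D. card (L (i - 1))) = (\<Sum>i\<in>(\<lambda>i. i - 1) ` {1..D}. card (L i))"
      by (subst sum.reindex) (auto simp: inj_on_def)
    also have "\<dots> \<le> n" by (rule L) simp
    finally have "(\<Sum>i=1..D. card (L i) + card (L (i - 1))) \<le> 2 * n"
      using L[of "{1..D}"] by (simp add: sum.distrib)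
    from exists_small_term[OF D(1) this] obtain i where
      i: "i \<in> {1..D}" "D * (card (L i) + card (L (i - 1))) \<le> 2 * n" by blast
    let ?a = "card (L i)" and ?b = "card (L (i - 1))"
    have "card (A i) \<le> card (L i \<times> L (i - 1))"
    proof (rule card_inj_on_le[of "\<lambda>h. (tail h, tip h)"])
      show "inj_on (\<lambda>h. (tail h, tip h)) (A i)"
        by (rule inj_on_subset[OF simple]) (auto simp: A_def)
      show "(\<lambda>h. (tail h, tip h)) ` A i \<subseteq> L i \<times> L (i - 1)"
        using lev tail_less par_less by (force simp: L_def A_def)
    qed (auto simp: L_def)
    also have "\<dots> = ?a * ?b" by (simp add: card_cartesian_product)
    finally have "4 * card (A i) \<le> 4 * (?a * ?b)" by simp
    also have "\<dots> \<le> (?a + ?b)^2"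
    proof -
      have "4 * (int ?a * int ?b) \<le> (int ?a + int ?b)^2"
        using zero_le_power2[of "int ?a - int ?b"] by (simp add: power2_eq_square algebra_simps)
      then show ?thesis by (metis (mono_tags) of_nat_add of_nat_le_iff of_nat_mult of_nat_numeral of_nat_power)
    qed
    finally have "D^2 * (4 * card (A i)) \<le> (D * (?a + ?b))^2"
      by (simp add: power_mult_distrib)
    also have "\<dots> \<le> (2 * n)^2" using i(2) by (rule power_mono) simp
    also have "\<dots> \<le> D^2 * (4 * D)" using n by (simp add: power_mult_distrib power3_eq_cube power2_eq_square)
    finally have "card (A i) \<le> D" using D(1) by simp
    then show ?thesis using i(1) by blast
  qed
  then obtain i where "i \<in> {1..D}" "outflow own (S i) \<le> D" by (auto simp: out)
  then show ?thesis using that[of i] by (auto simp: S_def)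
qed

end


section \<open>Memory layout\<close>

text \<open>
Registers. \<open>rN\<close>, \<open>rME\<close> and \<open>rM\<close> hold the numbers of nodes, edges and half-edges, \<open>rDMAX\<close> the maximum degree
and \<open>rD\<close> the label bound \<open>D\<close>, computed with its square and cube in \<open>rSQ\<close> and \<open>rCUBE\<close> and with \<open>n\<^sup>2\<close> in
\<open>rN2\<close>. The binary search uses \<open>rLO\<close>, \<open>rHI\<close>, \<open>rA\<close> and the tested value \<open>rK\<close>; a test answers in \<open>rFLAG\<close>.
\<open>rSP\<close> is the height of the stack of push-relabel, \<open>rQH\<close> and \<open>rQT\<close> are the ends of the queue of the
search, \<open>rC\<close> its position in the current incidence list, \<open>rSTOP\<close> and \<open>rGO\<close> end loops early. \<open>rV\<close>, \<open>rH\<close>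
and \<open>rW\<close> are a node, a half-edge out of it, and the node at its other end.
\<close>

abbreviation (input) rN :: nat where "rN \<equiv> 2"
abbreviation (input) rM :: nat where "rM \<equiv> 3"
abbreviation (input) rI :: nat where "rI \<equiv> 4"
abbreviation (input) rK :: nat where "rK \<equiv> 5"
abbreviation (input) rD :: nat where "rD \<equiv> 6"
abbreviation (input) rSP :: nat where "rSP \<equiv> 7"
abbreviation (input) rV :: nat where "rV \<equiv> 8"
abbreviation (input) rH :: nat where "rH \<equiv> 9"
abbreviation (input) rW :: nat where "rW \<equiv> 10"
abbreviation (input) rQH :: nat where "rQH \<equiv> 11"
abbreviation (input) rQT :: nat where "rQT \<equiv> 12"
abbreviation (input) rSTOP :: nat where "rSTOP \<equiv> 13"
abbreviation (input) rC :: nat where "rC \<equiv> 14"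
abbreviation (input) rFLAG :: nat where "rFLAG \<equiv> 15"
abbreviation (input) rGO :: nat where "rGO \<equiv> 16"
abbreviation (input) rLO :: nat where "rLO \<equiv> 17"
abbreviation (input) rHI :: nat where "rHI \<equiv> 18"
abbreviation (input) rA :: nat where "rA \<equiv> 19"
abbreviation (input) rDMAX :: nat where "rDMAX \<equiv> 20"
abbreviation (input) rSQ :: nat where "rSQ \<equiv> 21"
abbreviation (input) rCUBE :: nat where "rCUBE \<equiv> 22"
abbreviation (input) rN2 :: nat where "rN2 \<equiv> 23"
abbreviation (input) rME :: nat where "rME \<equiv> 24"

text \<open>
Arrays. Incidence lists are linked through \<open>aFIRST\<close> and \<open>aNEXT\<close>; a pointer is \<open>0\<close> at the end of a list
and \<open>h + 1\<close> at half-edge \<open>h\<close>. Push-relabel keeps labels in \<open>aLAB\<close>, current positions in \<open>aCUR\<close> and a stack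
in \<open>aSTK\<close>. The search has its queue in \<open>aQ\<close>; \<open>aLEV\<close> is one more than the distance from the sources, or \<open>0\<close>
if the node has not been reached, and \<open>aVIA\<close> points to the half-edge through which a node was reached.
\<close>

abbreviation (input) aIN :: nat where "aIN \<equiv> 0"
abbreviation (input) aTAIL :: nat where "aTAIL \<equiv> 2"
abbreviation (input) aPAR :: nat where "aPAR \<equiv> 3"
abbreviation (input) aFIRST :: nat where "aFIRST \<equiv> 4"
abbreviation (input) aNEXT :: nat where "aNEXT \<equiv> 5"
abbreviation (input) aDEG :: nat where "aDEG \<equiv> 6"
abbreviation (input) aOWN :: nat where "aOWN \<equiv> 7"
abbreviation (input) aLOAD :: nat where "aLOAD \<equiv> 8"
abbreviation (input) aCAP :: nat where "aCAP \<equiv> 9"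
abbreviation (input) aLAB :: nat where "aLAB \<equiv> 10"
abbreviation (input) aCUR :: nat where "aCUR \<equiv> 11"
abbreviation (input) aSTK :: nat where "aSTK \<equiv> 12"
abbreviation (input) aLEV :: nat where "aLEV \<equiv> 13"
abbreviation (input) aVIA :: nat where "aVIA \<equiv> 14"
abbreviation (input) aQ :: nat where "aQ \<equiv> 15"

text \<open>
The minimum, by truncated subtraction. In a condition it acts as a conjunction.
\<close>

definition Mini :: "exp \<Rightarrow> exp \<Rightarrow> exp" where
  "Mini a b = Minus a (Minus a b)"

lemma val_Mini [simp]: "val s (Mini a b) = min (val s a) (val s b)"
  by (simp add: Mini_def)

lemma min_eq_0_nat [simp]: "min a b = (0::nat) \<longleftrightarrow> a = 0 \<or> b = 0"
  by (auto simp: min_def)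

lemma cost_Mini [simp]: "cost (Mini a b) = 2 * cost a + cost b + 2"
  by (simp add: Mini_def)

definition incr :: "nat \<Rightarrow> com" where
  "incr r = Assign r (Plus (Reg r) (Const 1))"

text \<open>
Non-zero if and only if the node in register \<open>r\<close> is overloaded.
\<close>

definition active_exp :: "nat \<Rightarrow> exp" where
  "active_exp r = Minus (Plus (Read aLOAD (Reg r)) (Const 1)) (Read aCAP (Reg r))"

text \<open>
The edge of half-edge \<open>rH\<close> passes from its owner \<open>rV\<close> to the other endpoint \<open>rW\<close>.
\<close>

definition flip :: com where
  "flip =
     Write aOWN (Reg rH) (Const 0) ;;
     Write aOWN (Read aPAR (Reg rH)) (Const 1) ;;
     Write aLOAD (Reg rV) (Minus (Read aLOAD (Reg rV)) (Const 1)) ;;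
     Write aLOAD (Reg rW) (Plus (Read aLOAD (Reg rW)) (Const 1))"


section \<open>Push-relabel with bounded labels\<close>

text \<open>
One elementary step for the node on top of the stack: drop it if there is nothing to do, advance its
position by one half-edge and push along it if that is admissible, or relabel at the end of the list.
As labels are valid, an owned half-edge is admissible as soon as the label drops at all.
\<close>

definition push_relabel_body :: com where
  "push_relabel_body =
     Assign rV (Read aSTK (Minus (Reg rSP) (Const 1))) ;;
     If (Mini (active_exp rV) (Minus (Reg rD) (Read aLAB (Reg rV))))
       (If (Read aCUR (Reg rV))
          (Assign rH (Minus (Read aCUR (Reg rV)) (Const 1)) ;;
           Assign rW (Read aTAIL (Read aPAR (Reg rH))) ;;
           Write aCUR (Reg rV) (Read aNEXT (Reg rH)) ;;
           If (Mini (Read aOWN (Reg rH)) (Minus (Read aLAB (Reg rV)) (Read aLAB (Reg rW))))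
             (flip ;; Write aSTK (Reg rSP) (Reg rW) ;; incr rSP)
             Skip)
          (Write aLAB (Reg rV) (Plus (Read aLAB (Reg rV)) (Const 1)) ;;
           Write aCUR (Reg rV) (Read aFIRST (Reg rV))))
       (Assign rSP (Minus (Reg rSP) (Const 1)))"


text \<open>
Every incidence list is sorted by descending half-edge number. Hence the half-edges that a list
position \<open>c\<close> has already passed are those with number at least \<open>c\<close>, and no list needs to be represented
in the logic.
\<close>

locale linked_graph = half_edge_graph +
  fixes first nxt :: "nat \<Rightarrow> nat"
  assumes first_le: "first v \<le> M"
    and first_tail: "first v = 0 \<or> tail (first v - 1) = v"
    and first_gap: "first v \<le> h \<Longrightarrow> h < M \<Longrightarrow> tail h \<noteq> v"
    and nxt_le: "g < M \<Longrightarrow> nxt g \<le> g"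
    and nxt_tail: "g < M \<Longrightarrow> nxt g = 0 \<or> tail (nxt g - 1) = tail g"
    and nxt_gap: "g < M \<Longrightarrow> nxt g \<le> h \<Longrightarrow> h < g \<Longrightarrow> tail h \<noteq> tail g"
begin

definition env :: "state \<Rightarrow> bool" where
  "env s \<longleftrightarrow> reg s rN = n \<and> reg s rM = M \<and> arr s aTAIL = tail \<and> arr s aPAR = par \<and>
     arr s aFIRST = first \<and> arr s aNEXT = nxt \<and> arr s aDEG = deg"

text \<open>
Besides the usual invariants of push-relabel: the half-edges already passed by the current position
of a node are not admissible, and every overloaded node with a label below \<open>D\<close> is on the stack
(other entries and repeated entries do no harm).
\<close>

definition pr_inv :: "nat \<Rightarrow> (nat \<Rightarrow> nat) \<Rightarrow> (nat \<Rightarrow> nat) \<Rightarrow> (nat \<Rightarrow> nat) \<Rightarrow> (nat \<Rightarrow> nat) \<Rightarrow> (nat \<Rightarrow> nat) \<Rightarrow> nat \<Rightarrow> bool" where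
  "pr_inv D cap own d cur stk sp \<longleftrightarrow>
     orientation own \<and> valid_labels own d \<and> (\<forall>v<n. d v \<le> D) \<and>
     (\<forall>v<n. load own v + 1 < cap v \<longrightarrow> d v = 0) \<and>
     (\<forall>v<n. cur v \<le> M \<and> (cur v = 0 \<or> tail (cur v - 1) = v)) \<and>
     (\<forall>h<M. cur (tail h) \<le> h \<and> own h = 1 \<longrightarrow> d (tail h) \<le> d (tip h)) \<and>
     (\<forall>v<n. cap v \<le> load own v \<and> d v < D \<longrightarrow> v \<in> stk ` {..<sp}) \<and>
     (\<forall>i<sp. stk i < n)"

definition pending :: "(nat \<Rightarrow> nat) \<Rightarrow> nat set" where
  "pending cur = {h. h < M \<and> h < cur (tail h)}"

text \<open>
The half-edges still to be scanned, counting \<open>deg v + 1\<close> steps for each relabeling of \<open>v\<close> that may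
still happen: one for the relabeling and one for every half-edge of the new scan.
\<close>

definition potential :: "nat \<Rightarrow> (nat \<Rightarrow> nat) \<Rightarrow> (nat \<Rightarrow> nat) \<Rightarrow> nat" where
  "potential D d cur = (\<Sum>v<n. (D - d v) * (deg v + 1)) + card (pending cur)"

lemma pr_pop:
  assumes "pr_inv D cap own d cur stk sp" "sp > 0"
    and "\<not> (cap (stk (sp - 1)) \<le> load own (stk (sp - 1)) \<and> d (stk (sp - 1)) < D)"
  shows "pr_inv D cap own d cur stk (sp - 1)"
proof -
  obtain k where k: "sp = Suc k" using assms(2) by (cases sp) auto
  have "v \<in> stk ` {..<k}"
    if "v < n" "cap v \<le> load own v" "d v < D" for v
  proof -
    have "v \<in> stk ` {..<sp}" using assms(1) that by (auto simp: pr_inv_def)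
    then show ?thesis using assms(3) that k by (auto simp: lessThan_Suc)
  qed
  then show ?thesis using assms(1) k by (auto simp: pr_inv_def)
qed

text \<open>
At the end of its list \<open>v\<close> has no admissible half-edge, so the labels of all targets are at least that
of \<open>v\<close>, and incrementing it keeps the labels valid. A node with slack keeps label \<open>0\<close>, since only
overloaded nodes are relabeled.
\<close>

lemma pr_relabel:
  assumes inv: "pr_inv D cap own d cur stk sp" and v: "v < n" "cap v \<le> load own v" "d v < D" "cur v = 0"
  shows "pr_inv D cap own (d(v := d v + 1)) (cur(v := first v)) stk sp"
    and "potential D (d(v := d v + 1)) (cur(v := first v)) < potential D d cur"
proof -
  let ?d = "d(v := d v + 1)" and ?cur = "cur(v := first v)"
  have up: "d (tail h) < d (tip h) + 1" if "h < M" "own h = 1" "tail h = v" for h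
    using inv that v(4) by (force simp: pr_inv_def)
  have "valid_labels own ?d"
    unfolding valid_labels_def
  proof (intro allI impI)
    fix h assume h: "h < M" "own h = 1"
    have "d (tail h) \<le> d (tip h) + 1" using inv h by (auto simp: pr_inv_def valid_labels_def)
    then show "?d (tail h) \<le> ?d (tip h) + 1" using up[OF h] loopfree[OF h(1)] by auto
  qed
  moreover have "?d (tail h) \<le> ?d (tip h)" if h: "h < M" "?cur (tail h) \<le> h" "own h = 1" for h
  proof -
    have "tail h \<noteq> v" using h first_gap[of v h] by auto
    then have "d (tail h) \<le> d (tip h)" using inv h by (auto simp: pr_inv_def)
    then show ?thesis using \<open>tail h \<noteq> v\<close> by auto
  qed
  moreover have "\<forall>u<n. ?cur u \<le> M \<and> (?cur u = 0 \<or> tail (?cur u - 1) = u)"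
    using inv first_le first_tail by (auto simp: pr_inv_def)
  ultimately show "pr_inv D cap own ?d ?cur stk sp"
    using inv v unfolding pr_inv_def by auto
  have "(\<Sum>u<n. (D - d u) * (deg u + 1)) =
      (D - d v) * (deg v + 1) + (\<Sum>u\<in>{..<n} - {v}. (D - d u) * (deg u + 1))"
    using v by (intro sum.remove) auto
  moreover have "(\<Sum>u<n. (D - ?d u) * (deg u + 1)) =
      (D - ?d v) * (deg v + 1) + (\<Sum>u\<in>{..<n} - {v}. (D - ?d u) * (deg u + 1))"
    using v by (intro sum.remove) auto
  moreover have "(\<Sum>u\<in>{..<n} - {v}. (D - ?d u) * (deg u + 1)) =
      (\<Sum>u\<in>{..<n} - {v}. (D - d u) * (deg u + 1))"
    by (intro sum.cong) auto
  moreover have "(D - d v) * (deg v + 1) = (D - ?d v) * (deg v + 1) + (deg v + 1)"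
  proof -
    have "D - d v = Suc (D - ?d v)" using v by auto
    then show ?thesis by simp
  qed
  moreover have "pending ?cur \<subseteq> pending cur \<union> {h. h < M \<and> tail h = v}"
    by (auto simp: pending_def)
  then have "card (pending ?cur) \<le> card (pending cur \<union> {h. h < M \<and> tail h = v})"
    by (intro card_mono) (auto simp: pending_def)
  then have "card (pending ?cur) \<le> card (pending cur) + deg v"
    using card_Un_le[of "pending cur" "{h. h < M \<and> tail h = v}"] by (simp add: deg_def)
  ultimately show "potential D ?d ?cur < potential D d cur"
    unfolding potential_def by linarith
qed

lemma pr_scan_potential:
  assumes inv: "pr_inv D cap own d cur stk sp" and v: "v < n" "cur v \<noteq> 0"
  shows "potential D d (cur(v := nxt (cur v - 1))) < potential D d cur"
proof -
  let ?h = "cur v - 1"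
  have h: "?h < M" "tail ?h = v"
    using inv v by (force simp: pr_inv_def)+
  have "pending (cur(v := nxt ?h)) \<subseteq> pending cur - {?h}"
  proof
    fix g assume g: "g \<in> pending (cur(v := nxt ?h))"
    then have "tail g = v \<Longrightarrow> g < nxt ?h" by (auto simp: pending_def)
    with g v(2) h nxt_le[OF h(1)] show "g \<in> pending cur - {?h}"
      by (auto simp: pending_def split: if_splits)
  qed
  then have "card (pending (cur(v := nxt ?h))) \<le> card (pending cur - {?h})"
    by (intro card_mono) (auto simp: pending_def)
  also have "\<dots> < card (pending cur)"
    using h v by (intro card_Diff1_less) (auto simp: pending_def)
  finally show ?thesis unfolding potential_def by simp
qed

lemma pr_scan:
  assumes inv: "pr_inv D cap own d cur stk sp" and v: "v < n" "cur v \<noteq> 0"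
    and h: "h = cur v - 1" and nadm: "own h = 1 \<Longrightarrow> d v \<le> d (tip h)"
  shows "pr_inv D cap own d (cur(v := nxt h)) stk sp"
proof -
  have hM: "h < M" "tail h = v" using inv v h by (force simp: pr_inv_def)+
  have "d (tail g) \<le> d (tip g)" if g: "g < M" "(cur(v := nxt h)) (tail g) \<le> g" "own g = 1" for g
  proof (cases "tail g = v \<and> g < cur v")
    case True
    then have "g = h" using nxt_gap[OF hM(1), of g] g hM h by fastforce
    then show ?thesis using nadm g hM by simp
  next
    case False
    then have "cur (tail g) \<le> g" using g by (auto split: if_splits)
    then show ?thesis using inv g by (auto simp: pr_inv_def)
  qed
  moreover have "nxt h \<le> M" "nxt h = 0 \<or> tail (nxt h - 1) = v"
    using nxt_le[OF hM(1)] nxt_tail[OF hM(1)] hM by auto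
  ultimately show ?thesis using inv unfolding pr_inv_def by auto
qed

text \<open>
The reversed half-edge leads upwards, so it is not admissible and may lie behind the current position
of its node. The sender is overloaded and so does not get slack; the receiver goes onto the stack.
\<close>

lemma pr_push:
  assumes inv: "pr_inv D cap own d cur stk sp" and v: "v < n" "cur v \<noteq> 0" "cap v \<le> load own v"
    and h: "h = cur v - 1" and adm: "own h = 1" "d (tip h) < d v"
  shows "pr_inv D cap (own(h := 0, par h := 1)) d (cur(v := nxt h)) (stk(sp := tip h)) (sp + 1)"
proof -
  let ?own = "own(h := 0, par h := 1)"
  have hM: "h < M" "tail h = v" using inv v h by (force simp: pr_inv_def)+
  have own: "orientation own" using inv by (simp add: pr_inv_def)
  have tp: "tip (par h) = v" using par_par[OF hM(1)] hM by simp
  have w: "tip h < n" using par_less tail_less hM by simp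
  note ld = load_flip[OF own hM(1) adm(1)]
  have "valid_labels ?own d"
    using inv adm tp by (auto simp: pr_inv_def valid_labels_def)
  moreover have "d u = 0" if u: "u < n" "load ?own u + 1 < cap u" for u
  proof -
    have "load own u + 1 < cap u" using u(2) v(3) hM unfolding ld by (auto split: if_splits)
    then show ?thesis using inv u(1) by (auto simp: pr_inv_def)
  qed
  moreover have "d (tail g) \<le> d (tip g)"
    if g: "g < M" "(cur(v := nxt h)) (tail g) \<le> g" "?own g = 1" for g
  proof (cases "g = par h")
    case True
    then show ?thesis using adm tp by simp
  next
    case False
    then have gh: "g \<noteq> h" "own g = 1" using g by (auto split: if_splits)
    have "cur (tail g) \<le> g"
    proof (cases "tail g = v \<and> g < cur v")
      case True
      then have "g = h" using nxt_gap[OF hM(1), of g] g hM h by fastforce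
      then show ?thesis using gh by simp
    qed (use g in \<open>auto split: if_splits\<close>)
    then show ?thesis using inv g gh by (auto simp: pr_inv_def)
  qed
  moreover have "nxt h \<le> M" "nxt h = 0 \<or> tail (nxt h - 1) = v"
    using nxt_le[OF hM(1)] nxt_tail[OF hM(1)] hM by auto
  moreover have "u \<in> (stk(sp := tip h)) ` {..<sp + 1}"
    if u: "u < n" "cap u \<le> load ?own u" "d u < D" for u
  proof (cases "u = tip h")
    case True
    then show ?thesis by (intro image_eqI[of _ _ sp]) auto
  next
    case False
    then have "cap u \<le> load own u" using u(2) unfolding ld by (auto split: if_splits)
    then have "u \<in> stk ` {..<sp}" using inv u by (auto simp: pr_inv_def)
    then show ?thesis by (fastforce simp: image_iff)
  qed
  ultimately show ?thesis
    using inv orientation_flip[OF own hM(1)] w unfolding pr_inv_def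
    by (auto simp del: fun_upd_apply simp: fun_upd_apply[of cur] fun_upd_apply[of stk])
qed

definition pr_state where
  "pr_state D cap s \<longleftrightarrow> env s \<and> reg s rD = D \<and> arr s aCAP = cap \<and>
     arr s aLOAD = load (arr s aOWN) \<and>
     pr_inv D cap (arr s aOWN) (arr s aLAB) (arr s aCUR) (arr s aSTK) (reg s rSP)"

text \<open>
The weight \<open>2\<close> on the potential pays for the stack entry that a push creates.
\<close>

lemma push_relabel_step:
  assumes "pr_state D cap s" "reg s rSP \<noteq> 0"
  defines "\<mu> \<equiv> \<lambda>s. 2 * potential D (arr s aLAB) (arr s aCUR) + reg s rSP"
  shows "pr_state D cap (exec push_relabel_body s) \<and> \<mu> (exec push_relabel_body s) < \<mu> s"
proof -
  define v where "v = arr s aSTK (reg s rSP - 1)"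
  define own where "own = arr s aOWN"
  define d where "d = arr s aLAB"
  define cur where "cur = arr s aCUR"
  define stk where "stk = arr s aSTK"
  define sp where "sp = reg s rSP"
  note defs = v_def own_def d_def cur_def stk_def sp_def
  have env: "reg s rN = n" "reg s rM = M" "arr s aTAIL = tail" "arr s aPAR = par"
     "arr s aFIRST = first" "arr s aNEXT = nxt" "arr s aDEG = deg" "reg s rD = D"
     "arr s aCAP = cap" "arr s aLOAD = load own"
    and inv: "pr_inv D cap own d cur stk sp"
    using assms(1) by (auto simp: pr_state_def env_def defs)
  have sp: "sp > 0" using assms(2) by (simp add: sp_def)
  have v: "v < n" using inv sp by (auto simp: pr_inv_def defs)
  have v_stk: "stk (sp - 1) = v" by (simp add: defs)
  let ?s = "exec push_relabel_body s"
  note prog = push_relabel_body_def active_exp_def flip_def incr_def env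
    defs(2-6)[symmetric]
  have env': "env ?s" "reg ?s rD = D" "arr ?s aCAP = cap"
    using env by (simp_all add: env_def push_relabel_body_def flip_def incr_def)
  show ?thesis
  proof (cases "cap v \<le> load own v \<and> d v < D")
    case False
    have "arr ?s aOWN = own" "arr ?s aLOAD = load own" "arr ?s aLAB = d" "arr ?s aCUR = cur"
        "arr ?s aSTK = stk" "reg ?s rSP = sp - 1"
      using False v_stk by (auto simp: prog)
    then show ?thesis
      using pr_pop[OF inv sp] False sp v_stk env' by (simp add: pr_state_def \<mu>_def defs(2-6)[symmetric])
  next
    case act: True
    show ?thesis
    proof (cases "cur v = 0")
      case True
      have "arr ?s aOWN = own" "arr ?s aLOAD = load own" "arr ?s aLAB = d(v := d v + 1)"
          "arr ?s aCUR = cur(v := first v)" "arr ?s aSTK = stk" "reg ?s rSP = sp"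
        using act True v_stk by (simp_all add: prog)
      then show ?thesis
        using pr_relabel[OF inv v] act True env'
        by (simp add: pr_state_def \<mu>_def defs(2-6)[symmetric])
    next
      case cv: False
      define h where "h = cur v - 1"
      have cv_h: "cur v - Suc 0 = h" by (simp add: h_def)
      note pot = pr_scan_potential[OF inv v cv, folded h_def]
      have hM: "h < M" "tail h = v" using inv v cv by (force simp: pr_inv_def h_def)+
      have own: "orientation own" using inv by (simp add: pr_inv_def)
      show ?thesis
      proof (cases "own h = 1 \<and> d (tip h) < d v")
        case True
        have ld: "load (own(h := 0, par h := 1)) =
            (load own)(v := load own v - 1, tip h := load own (tip h) + 1)"
          using load_flip[OF own hM(1)] True hM by simp
        have "tip h \<noteq> v" using loopfree hM by auto
        then have "arr ?s aOWN = own(h := 0, par h := 1)" "arr ?s aLAB = d"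
            "arr ?s aLOAD = (load own)(v := load own v - 1, tip h := load own (tip h) + 1)"
            "arr ?s aCUR = cur(v := nxt h)" "arr ?s aSTK = stk(sp := tip h)" "reg ?s rSP = sp + 1"
          using act cv v_stk True by (simp_all add: prog cv_h)
        then show ?thesis
          using pr_push[OF inv v cv _ h_def] act True pot env'
          by (simp add: pr_state_def \<mu>_def defs(2-6)[symmetric] ld[simplified])
      next
        case False
        then have nadm: "own h = 0 \<or> d v \<le> d (tip h)" "own h = 1 \<Longrightarrow> d v \<le> d (tip h)"
          using own_cases[OF own hM(1)] by auto
        have "arr ?s aOWN = own" "arr ?s aLOAD = load own" "arr ?s aLAB = d"
            "arr ?s aCUR = cur(v := nxt h)" "arr ?s aSTK = stk" "reg ?s rSP = sp"
          using act cv v_stk nadm(1) by (auto simp: prog cv_h)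
        then show ?thesis
          using pr_scan[OF inv v cv h_def nadm(2)] pot env'
          by (simp add: pr_state_def \<mu>_def defs(2-6)[symmetric])
      qed
    qed
  qed
qed

lemma push_relabel_terminates:
  assumes "pr_state D cap s" "reg s rSP = n" "c = len push_relabel_body + 2"
    "c * (2 * (D * (M + n) + M) + n + 1) \<le> T"
  shows "terminates (While (Reg rSP) push_relabel_body) s T
    (\<lambda>s. pr_state D cap s \<and> reg s rSP = 0)"
proof -
  let ?\<mu> = "\<lambda>s. 2 * potential D (arr s aLAB) (arr s aCUR) + reg s rSP"
  have "card (pending (arr s aCUR)) \<le> card {..<M}"
    by (intro card_mono) (auto simp: pending_def)
  moreover have "(\<Sum>v<n. (D - arr s aLAB v) * (deg v + 1)) \<le> (\<Sum>v<n. D * (deg v + 1))"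
    by (intro sum_mono mult_right_mono) auto
  moreover have "(\<Sum>v<n. D * (deg v + 1)) = D * (M + n)"
    unfolding sum_distrib_left[symmetric] sum.distrib sum_deg by simp
  ultimately have "potential D (arr s aLAB) (arr s aCUR) \<le> D * (M + n) + M"
    unfolding potential_def by simp
  then have mu: "?\<mu> s \<le> 2 * (D * (M + n) + M) + n" using assms(2) by simp
  then have "?\<mu> s * c + c \<le> (2 * (D * (M + n) + M) + n) * c + c" by (intro add_mono mult_right_mono mu order_refl le0)
  also have "\<dots> \<le> T" using assms(4) by (simp add: algebra_simps)
  finally have le: "?\<mu> s * c + c \<le> T" .
  have "terminates (While (Reg rSP) push_relabel_body) s T
      (\<lambda>s. pr_state D cap s \<and> val s (Reg rSP) = 0)"
    by (rule terminates_While_straight[where f = ?\<mu>])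
      (use assms(1) push_relabel_step le assms(3) in
        \<open>auto simp: push_relabel_body_def flip_def incr_def\<close>)
  then show ?thesis by simp
qed

end


section \<open>Augmenting along shortest paths\<close>

text \<open>
The sources of the search are all overloaded nodes at once.
\<close>

definition bfs_reset_body :: com where
  "bfs_reset_body =
     If (active_exp rI)
       (Write aLEV (Reg rI) (Const 1) ;; Write aQ (Reg rQT) (Reg rI) ;; incr rQT)
       (Write aLEV (Reg rI) (Const 0)) ;;
     Write aVIA (Reg rI) (Const 0) ;; incr rI"

text \<open>
The search stops when it reaches a node with slack, which is then left in \<open>rW\<close>. It sets \<open>rSTOP\<close> to the
length of the queue, which is positive and makes the loop condition \<open>bfs_cond\<close> zero.
\<close>

definition bfs_body :: com where
  "bfs_body =
     Assign rV (Read aQ (Reg rQH)) ;;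
     If (Reg rC)
       (Assign rH (Minus (Reg rC) (Const 1)) ;;
        Assign rW (Read aTAIL (Read aPAR (Reg rH))) ;;
        Assign rC (Read aNEXT (Reg rH)) ;;
        If (Mini (Read aOWN (Reg rH)) (Minus (Const 1) (Read aLEV (Reg rW))))
          (Write aLEV (Reg rW) (Plus (Read aLEV (Reg rV)) (Const 1)) ;;
           Write aVIA (Reg rW) (Plus (Reg rH) (Const 1)) ;;
           Write aQ (Reg rQT) (Reg rW) ;; incr rQT ;;
           If (Minus (Read aCAP (Reg rW)) (Plus (Read aLOAD (Reg rW)) (Const 1)))
             (Assign rSTOP (Reg rQT)) Skip)
          Skip)
       (incr rQH ;; Assign rC (Read aFIRST (Read aQ (Reg rQH))))"

definition bfs_cond :: exp where
  "bfs_cond = Minus (Minus (Reg rQT) (Reg rQH)) (Reg rSTOP)"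

text \<open>
Walks back from \<open>rW\<close> to a source and passes on the edges of the path, beginning with the last one.
\<close>

definition trace_body :: com where
  "trace_body =
     Assign rH (Minus (Read aVIA (Reg rW)) (Const 1)) ;;
     Assign rV (Read aTAIL (Reg rH)) ;; flip ;; Assign rW (Reg rV)"

context linked_graph
begin

text \<open>
From every reached node, the pointers in \<open>via\<close> lead back along residual arcs, one level at a time,
to an overloaded node.
\<close>

definition bfs_tree :: "(nat \<Rightarrow> nat) \<Rightarrow> (nat \<Rightarrow> nat) \<Rightarrow> (nat \<Rightarrow> nat) \<Rightarrow> (nat \<Rightarrow> nat) \<Rightarrow> bool" where
  "bfs_tree own cap lev via \<longleftrightarrow> (\<forall>v<n. lev v \<noteq> 0 \<longrightarrow>
     (if via v = 0 then cap v \<le> load own v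
      else via v \<le> M \<and> own (via v - 1) = 1 \<and> tip (via v - 1) = v \<and>
        lev (tail (via v - 1)) \<noteq> 0 \<and> lev v = lev (tail (via v - 1)) + 1))"

text \<open>
The half-edges that the search has looked at: all those of nodes that have left the queue, and those
of its first node that lie behind the list position \<open>c\<close>.
\<close>

definition scanned :: "(nat \<Rightarrow> nat) \<Rightarrow> nat \<Rightarrow> nat \<Rightarrow> nat \<Rightarrow> nat set" where
  "scanned q qh qt c = {h. h < M \<and> (tail h \<in> q ` {..<qh} \<or> qh < qt \<and> tail h = q qh \<and> c \<le> h)}"

text \<open>
A level is at most the length of the queue, since every new level comes with a new node. This bounds
the length of the path that is traced back.
\<close>

definition bfs_inv :: "(nat \<Rightarrow> nat) \<Rightarrow> (nat \<Rightarrow> nat) \<Rightarrow> (nat \<Rightarrow> nat) \<Rightarrow> (nat \<Rightarrow> nat) \<Rightarrow>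
    (nat \<Rightarrow> nat) \<Rightarrow> nat \<Rightarrow> nat \<Rightarrow> nat \<Rightarrow> bool" where
  "bfs_inv own cap lev via q qh qt c \<longleftrightarrow>
     inj_on q {..<qt} \<and> q ` {..<qt} = {v. v < n \<and> lev v \<noteq> 0} \<and> qh \<le> qt \<and>
     (\<forall>v<n. lev v \<le> qt) \<and> (\<forall>v<n. cap v \<le> load own v \<longrightarrow> lev v \<noteq> 0) \<and>
     bfs_tree own cap lev via \<and>
     (\<forall>h\<in>scanned q qh qt c. own h = 1 \<longrightarrow> lev (tip h) \<noteq> 0) \<and>
     (qh < qt \<longrightarrow> c \<le> M \<and> (c = 0 \<or> tail (c - 1) = q qh))"

lemma queue_le:
  assumes "inj_on q {..<qt}" "q ` {..<qt} = {v. v < n \<and> P v}"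
  shows "qt \<le> n"
proof -
  have "qt = card (q ` {..<qt})" using assms(1) by (simp add: card_image)
  also have "\<dots> \<le> card {..<n}" using assms(2) by (intro card_mono) auto
  finally show ?thesis by simp
qed

lemma scanned_scan:
  assumes "qh < qt" "c \<noteq> 0" "c \<le> M" "tail (c - 1) = q qh"
  shows "scanned q qh qt (nxt (c - 1)) = insert (c - 1) (scanned q qh qt c)"
proof -
  have "c - 1 < M" using assms by simp
  note nx = nxt_le[OF this] nxt_gap[OF this]
  have "c - 1 \<le> h" if "nxt (c - 1) \<le> h" "tail h = q qh" for h
    using nx(2)[OF that(1)] that(2) assms(4) by (metis leI)
  then show ?thesis using assms nx(1) \<open>c - 1 < M\<close> unfolding scanned_def by fastforce
qed

lemma finite_scanned: "finite (scanned q qh qt c)"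
  by (simp add: scanned_def)

lemma scanned_advance:
  assumes "qh < qt"
  shows "scanned q (qh + 1) qt (first (q (qh + 1))) = scanned q qh qt 0"
  using assms first_gap unfolding scanned_def by (auto simp: lessThan_Suc)

lemma scanned_upd: "qh < qt \<Longrightarrow> scanned (q(qt := w)) qh (qt + 1) c = scanned q qh qt c"
proof -
  assume "qh < qt"
  moreover from this have "(q(qt := w)) ` {..<qh} = q ` {..<qh}" by (auto simp: image_iff)
  ultimately show ?thesis by (auto simp: scanned_def)
qed

lemma bfs_skip:
  assumes inv: "bfs_inv own cap lev via q qh qt c" and c: "qh < qt" "c \<noteq> 0"
    and nadm: "own (c - 1) = 1 \<Longrightarrow> lev (tip (c - 1)) \<noteq> 0"
  shows "bfs_inv own cap lev via q qh qt (nxt (c - 1))"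
proof -
  have c': "c \<le> M" "tail (c - 1) = q qh" using inv c by (auto simp: bfs_inv_def)
  then have "c - 1 < M" using c by simp
  note nx = nxt_le[OF this] nxt_tail[OF this]
  show ?thesis
    using inv nadm nx c c' scanned_scan[where q = q, OF c c'] by (auto simp: bfs_inv_def)
qed

lemma bfs_advance:
  assumes inv: "bfs_inv own cap lev via q qh qt 0" and c: "qh < qt"
  shows "bfs_inv own cap lev via q (qh + 1) qt (first (q (qh + 1)))"
  using inv c first_le first_tail unfolding bfs_inv_def scanned_advance[OF c] by auto

lemma bfs_discover:
  assumes inv: "bfs_inv own cap lev via q qh qt c" and c: "qh < qt" "c \<noteq> 0"
    and h: "h = c - 1" and w: "w = tip h" and adm: "own h = 1" "lev w = 0"
  shows "bfs_inv own cap (lev(w := lev (q qh) + 1)) (via(w := c)) (q(qt := w)) qh (qt + 1) (nxt h)"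
proof -
  let ?lev = "lev(w := lev (q qh) + 1)" and ?via = "via(w := c)" and ?q = "q(qt := w)"
  have c': "c \<le> M" "tail h = q qh" using inv c h by (auto simp: bfs_inv_def)
  then have hM: "h < M" using c h by simp
  note nx = nxt_le[OF this] nxt_tail[OF this]
  have wn: "w < n" using w par_less[OF hM] tail_less by simp
  have inj: "inj_on q {..<qt}" and im: "q ` {..<qt} = {v. v < n \<and> lev v \<noteq> 0}"
    and tree: "bfs_tree own cap lev via"
    using inv by (auto simp: bfs_inv_def)
  have "w \<notin> q ` {..<qt}" using im adm by auto
  have "inj_on ?q {..<qt + 1}"
    using inj \<open>w \<notin> q ` {..<qt}\<close> by (auto simp: inj_on_def less_Suc_eq)
  moreover have "?q ` {..<qt + 1} = {v. v < n \<and> ?lev v \<noteq> 0}"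
  proof -
    have "?q ` {..<qt + 1} = insert w (q ` {..<qt})" by (auto simp: lessThan_Suc image_iff)
    then show ?thesis using im wn by auto
  qed
  moreover have vl: "lev (q qh) \<noteq> 0" "q qh < n" using im c by auto
  have "\<forall>v<n. ?lev v \<le> qt + 1" using inv vl by (auto simp: bfs_inv_def intro: le_SucI)
  moreover have "bfs_tree own cap ?lev ?via"
    unfolding bfs_tree_def
  proof (intro allI impI)
    fix v assume v: "v < n" "?lev v \<noteq> 0"
    show "if ?via v = 0 then cap v \<le> load own v
      else ?via v \<le> M \<and> own (?via v - 1) = 1 \<and> tip (?via v - 1) = v \<and>
        ?lev (tail (?via v - 1)) \<noteq> 0 \<and> ?lev v = ?lev (tail (?via v - 1)) + 1"
    proof (cases "v = w")
      case True
      have "q qh \<noteq> w" using vl adm by auto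
      then show ?thesis using True c c' h w adm vl by simp
    next
      case False
      have "tail (via v - 1) \<noteq> w" if "via v \<noteq> 0"
        using tree v that False adm unfolding bfs_tree_def by (auto split: if_splits)
      then show ?thesis using tree v False unfolding bfs_tree_def by auto
    qed
  qed
  moreover have "?lev (tip g) \<noteq> 0" if "g \<in> scanned ?q qh (qt + 1) (nxt h)" "own g = 1" for g
    using that scanned_upd[OF c(1), of q w] scanned_scan[where q = q, OF c c'(1)] c'(2) h w inv
    by (auto simp: bfs_inv_def)
  ultimately show ?thesis
    using inv nx hM c c' by (auto simp: bfs_inv_def)
qed

text \<open>
While the search goes on, no reached node has slack. This makes an exhausted search a proof of
infeasibility.
\<close>

definition bfs_state :: "(nat \<Rightarrow> nat) \<Rightarrow> (nat \<Rightarrow> nat) \<Rightarrow> state \<Rightarrow> bool" where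
  "bfs_state own cap s \<longleftrightarrow> env s \<and> arr s aCAP = cap \<and> arr s aOWN = own \<and>
     arr s aLOAD = load own \<and>
     bfs_inv own cap (arr s aLEV) (arr s aVIA) (arr s aQ) (reg s rQH) (reg s rQT) (reg s rC) \<and>
     (if reg s rSTOP = 0 then \<forall>v<n. arr s aLEV v \<noteq> 0 \<longrightarrow> cap v \<le> load own v + 1
      else reg s rQT \<le> reg s rSTOP \<and> reg s rW < n \<and> arr s aLEV (reg s rW) \<noteq> 0 \<and>
        load own (reg s rW) + 1 < cap (reg s rW))"

text \<open>
Every step scans one more half-edge or removes one more node from the queue.
\<close>

lemma bfs_step:
  assumes own: "orientation own" and st: "bfs_state own cap s" "val s bfs_cond \<noteq> 0"
  defines "\<mu> \<equiv> \<lambda>s. (n - reg s rQH) + (M - card (scanned (arr s aQ) (reg s rQH) (reg s rQT) (reg s rC)))"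
  shows "bfs_state own cap (exec bfs_body s) \<and> \<mu> (exec bfs_body s) < \<mu> s"
proof -
  define lev where "lev = arr s aLEV"
  define via where "via = arr s aVIA"
  define q where "q = arr s aQ"
  define qh where "qh = reg s rQH"
  define qt where "qt = reg s rQT"
  define c where "c = reg s rC"
  note defs = lev_def via_def q_def qh_def qt_def c_def
  have env: "reg s rN = n" "reg s rM = M" "arr s aTAIL = tail" "arr s aPAR = par"
     "arr s aFIRST = first" "arr s aNEXT = nxt" "arr s aDEG = deg"
     "arr s aCAP = cap" "arr s aLOAD = load own" "arr s aOWN = own"
    and inv: "bfs_inv own cap lev via q qh qt c"
    using st(1) by (auto simp: bfs_state_def env_def defs)
  have qt: "qh < qt" using st(2) by (simp add: bfs_cond_def defs)
  have stop: "reg s rSTOP = 0" and nodef: "\<forall>v<n. lev v \<noteq> 0 \<longrightarrow> cap v \<le> load own v + 1"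
    using st by (auto simp: bfs_cond_def bfs_state_def defs split: if_splits)
  have "qt \<le> n" using queue_le inv by (auto simp: bfs_inv_def)
  have fin: "card (scanned q' qh' qt' c') \<le> M" for q' qh' qt' c'
    using card_mono[of "{..<M}" "scanned q' qh' qt' c'"] by (auto simp: scanned_def)
  let ?s = "exec bfs_body s"
  note prog = bfs_body_def incr_def env stop defs[symmetric]
  have env': "env ?s" "arr ?s aCAP = cap" "arr ?s aOWN = own" "arr ?s aLOAD = load own"
    using env by (simp_all add: env_def bfs_body_def incr_def)
  note fold = bfs_state_def \<mu>_def env' defs[symmetric]
  show ?thesis
  proof (cases "c = 0")
    case True
    have "arr ?s aLEV = lev" "arr ?s aVIA = via" "arr ?s aQ = q" "reg ?s rQH = qh + 1"
        "reg ?s rQT = qt" "reg ?s rC = first (q (qh + 1))" "reg ?s rSTOP = 0"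
      using True by (simp_all add: prog)
    then show ?thesis
      using bfs_advance[of own cap lev via q qh qt] inv True qt \<open>qt \<le> n\<close> nodef scanned_advance[OF qt, of q]
      by (simp add: fold)
  next
    case cz: False
    define h where "h = c - 1"
    define w where "w = tip h"
    have c_h: "c - Suc 0 = h" "Suc h = c" using cz by (simp_all add: h_def)
    have c': "c \<le> M" "tail h = q qh" using inv qt cz by (auto simp: bfs_inv_def h_def)
    then have hM: "h < M" using cz h_def by simp
    have new: "card (scanned q qh qt (nxt h)) = card (scanned q qh qt c) + 1"
    proof -
      have "h \<notin> scanned q qh qt c"
      proof
        assume "h \<in> scanned q qh qt c"
        then have "tail h \<in> q ` {..<qh}" using c_h by (auto simp: scanned_def)
        then obtain j where "j < qh" "q j = q qh" using c'(2) by auto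
        then show False using inv qt inj_onD[of q "{..<qt}" j qh] by (auto simp: bfs_inv_def)
      qed
      then show ?thesis using scanned_scan[where q = q, OF qt cz c'(1), folded h_def, OF c'(2)]
        by (simp add: finite_scanned)
    qed
    then have less: "M - card (scanned q qh qt (nxt h)) < M - card (scanned q qh qt c)"
      using fin[of q qh qt "nxt h"] by linarith
    show ?thesis
    proof (cases "own h = 1 \<and> lev w = 0")
      case True
      have eqs: "arr ?s aLEV = lev(w := lev (q qh) + 1)" "arr ?s aVIA = via(w := c)"
          "arr ?s aQ = q(qt := w)" "reg ?s rQH = qh" "reg ?s rQT = qt + 1" "reg ?s rC = nxt h"
          "reg ?s rW = w" "reg ?s rSTOP = (if load own w + 1 < cap w then qt + 1 else 0)"
        using True cz by (simp_all add: prog c_h w_def)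
      have inv': "bfs_inv own cap (lev(w := lev (q qh) + 1)) (via(w := c)) (q(qt := w)) qh (qt + 1) (nxt h)"
        using bfs_discover[OF inv qt cz h_def w_def] True by simp
      have "w < n" using w_def par_less[OF hM] tail_less by simp
      then have "if reg ?s rSTOP = 0 then \<forall>v<n. arr ?s aLEV v \<noteq> 0 \<longrightarrow> cap v \<le> load own v + 1
          else reg ?s rQT \<le> reg ?s rSTOP \<and> reg ?s rW < n \<and> arr ?s aLEV (reg ?s rW) \<noteq> 0 \<and>
            load own (reg ?s rW) + 1 < cap (reg ?s rW)"
        using nodef unfolding eqs by auto
      then have "bfs_state own cap ?s"
        unfolding bfs_state_def using inv' env' by (simp only: eqs simp_thms)
      then show ?thesis
        using less scanned_upd[OF qt, of q w "nxt h"] by (simp add: \<mu>_def eqs defs[symmetric])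
    next
      case False
      then have nadm: "own h = 0 \<or> lev w \<noteq> 0" "own h = 1 \<Longrightarrow> lev w \<noteq> 0"
        using own_cases[OF own hM] by auto
      have "arr ?s aLEV = lev" "arr ?s aVIA = via" "arr ?s aQ = q" "reg ?s rQH = qh"
          "reg ?s rQT = qt" "reg ?s rC = nxt h" "reg ?s rSTOP = 0"
        using nadm(1) cz by (auto simp: prog c_h w_def)
      moreover have "bfs_inv own cap lev via q qh qt (nxt h)"
        using bfs_skip[OF inv qt cz] nadm(2) by (simp add: h_def w_def)
      ultimately show ?thesis using nodef less by (simp add: fold)
    qed
  qed
qed


lemma bfs_terminates:
  assumes own: "orientation own" and st: "bfs_state own cap s"
    and T: "(len bfs_body + 6) * (n + M + 1) \<le> T"
  shows "terminates (While bfs_cond bfs_body) s T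
    (\<lambda>s. bfs_state own cap s \<and> val s bfs_cond = 0)"
proof -
  let ?\<mu> = "\<lambda>s. (n - reg s rQH) + (M - card (scanned (arr s aQ) (reg s rQH) (reg s rQT) (reg s rC)))"
  have "?\<mu> s * (len bfs_body + 6) + (len bfs_body + 6) \<le> (n + M) * (len bfs_body + 6) + (len bfs_body + 6)"
    by (intro add_mono mult_right_mono) auto
  also have "\<dots> \<le> T" using T by (simp add: algebra_simps)
  finally have "?\<mu> s * (len bfs_body + 6) + (len bfs_body + 6) \<le> T" .
  then show ?thesis
    by (intro terminates_While_straight[where f = ?\<mu>] st bfs_step[OF own])
      (auto simp: bfs_body_def incr_def bfs_cond_def)
qed

text \<open>
Once the queue is empty, the reached set is closed under residual arcs, has no node with slack and
contains all overloaded nodes, so it obstructs every solution.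
\<close>

lemma bfs_exhausted_infeasible:
  assumes own: "orientation own" and st: "bfs_state own cap s" "val s bfs_cond = 0" "reg s rSTOP = 0"
    and a: "a < n" "cap a \<le> load own a"
  shows "\<not> feasible cap"
proof -
  define lev where "lev = arr s aLEV"
  define via where "via = arr s aVIA"
  define q where "q = arr s aQ"
  define W where "W = {v. v < n \<and> lev v \<noteq> 0}"
  obtain qh qt c where inv: "bfs_inv own cap lev via q qh qt c" and qt: "qt = reg s rQT" "qt \<le> qh"
    using st by (auto simp: bfs_state_def bfs_cond_def lev_def via_def q_def)
  have W: "W = q ` {..<qt}" "qh = qt" using inv qt by (auto simp: bfs_inv_def W_def)
  have closed: "tip h \<in> W" if "h < M" "own h = 1" "tail h \<in> W" for h
  proof -
    have "h \<in> scanned q qh qt c" using that W by (simp add: scanned_def)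
    then have "lev (tip h) \<noteq> 0" using inv that by (auto simp: bfs_inv_def)
    then show ?thesis using par_less that(1) tail_less by (simp add: W_def)
  qed
  have full: "cap v \<le> load own v + 1" if "v \<in> W" for v
    using st that by (auto simp: bfs_state_def W_def lev_def)
  have "a \<in> W" using inv a by (auto simp: bfs_inv_def W_def)
  then show ?thesis
    using closed_infeasible[OF own, of W cap a] closed full a(2) by (auto simp: W_def)
qed

text \<open>
Stated with sums because subtraction is truncated; this also covers \<open>a = b\<close>, where tracing starts.
\<close>

definition moved :: "(nat \<Rightarrow> nat) \<Rightarrow> (nat \<Rightarrow> nat) \<Rightarrow> nat \<Rightarrow> nat \<Rightarrow> bool" where
  "moved own own' a b \<longleftrightarrow> (\<forall>v. load own' v + of_bool (v = a) = load own v + of_bool (v = b))"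

text \<open>
The edges of the path between \<open>w\<close> and \<open>b\<close> have been passed on, so that \<open>w\<close> has lost a unit of load
which \<open>b\<close> has gained. The tree edges of nodes no farther from the sources than \<open>w\<close> are still owned.
\<close>

definition trace_inv :: "(nat \<Rightarrow> nat) \<Rightarrow> (nat \<Rightarrow> nat) \<Rightarrow> (nat \<Rightarrow> nat) \<Rightarrow> (nat \<Rightarrow> nat) \<Rightarrow> nat \<Rightarrow> nat \<Rightarrow> bool" where
  "trace_inv own own' lev via b w \<longleftrightarrow>
     orientation own' \<and> moved own own' w b \<and> w < n \<and> lev w \<noteq> 0 \<and>
     (\<forall>v<n. lev v \<noteq> 0 \<and> lev v \<le> lev w \<and> via v \<noteq> 0 \<longrightarrow> own' (via v - 1) = 1)"

text \<open>
A tree edge determines the node that was reached through it, so the edge of \<open>w\<close> is not the tree edge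
of a node closer to the sources, and flipping it leaves the rest of the path owned.
\<close>

lemma trace_flip:
  assumes tree: "bfs_tree own cap lev via" and inv: "trace_inv own own' lev via b w"
    and w: "via w \<noteq> 0" and h: "h = via w - 1"
  shows "trace_inv own (own'(h := 0, par h := 1)) lev via b (tail h)"
    and "lev (tail h) < lev w" "h < M" "own' h = 1" "tip h = w"
proof -
  have "via w \<le> M" using tree inv w by (auto simp: bfs_tree_def trace_inv_def)
  then have "h < M" using w h by simp
  then have t: "h < M" "tip h = w" "lev (tail h) \<noteq> 0" "lev w = lev (tail h) + 1"
    using tree inv w h by (auto simp: bfs_tree_def trace_inv_def)
  show "lev (tail h) < lev w" "h < M" "tip h = w" using t by auto
  show own'h: "own' h = 1" using inv w h by (auto simp: trace_inv_def)
  have own': "orientation own'" using inv by (simp add: trace_inv_def)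
  note ld = load_flip[OF own' t(1) own'h]
  have ne: "tail h \<noteq> w" using loopfree[OF t(1)] t(2) by auto
  have pos: "load own' (tail h) \<ge> 1" using load_pos[of h own'] t(1) own'h by simp
  have "moved own (own'(h := 0, par h := 1)) (tail h) b"
    unfolding moved_def ld
  proof
    fix v
    have "load own' v + of_bool (v = w) = load own v + of_bool (v = b)"
      using inv by (auto simp: trace_inv_def moved_def)
    then show "((load own')(tail h := load own' (tail h) - 1, tip h := load own' (tip h) + 1)) v +
        of_bool (v = tail h) = load own v + of_bool (v = b)"
      using ne pos t(2) by (auto split: if_splits)
  qed
  moreover have "(own'(h := 0, par h := 1)) (via v - 1) = 1"
    if v: "v < n" "lev v \<noteq> 0" "lev v \<le> lev (tail h)" "via v \<noteq> 0" for v
  proof -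
    have "tip (via v - 1) = v" "own' (via v - 1) = 1"
      using tree inv v t(4) by (auto simp: bfs_tree_def trace_inv_def)
    moreover have "v \<noteq> w" using v(3) t(4) by auto
    ultimately show ?thesis using t(2) by auto
  qed
  ultimately show "trace_inv own (own'(h := 0, par h := 1)) lev via b (tail h)"
    using orientation_flip[OF own' t(1)] t(3) tail_less[OF t(1)] by (simp add: trace_inv_def)
qed

definition trace_state :: "(nat \<Rightarrow> nat) \<Rightarrow> (nat \<Rightarrow> nat) \<Rightarrow> nat \<Rightarrow> state \<Rightarrow> bool" where
  "trace_state own cap b s \<longleftrightarrow> env s \<and> arr s aCAP = cap \<and> arr s aLOAD = load (arr s aOWN) \<and>
     bfs_tree own cap (arr s aLEV) (arr s aVIA) \<and>
     trace_inv own (arr s aOWN) (arr s aLEV) (arr s aVIA) b (reg s rW)"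

lemma trace_step:
  assumes st: "trace_state own cap b s" "arr s aVIA (reg s rW) \<noteq> 0"
  defines "\<mu> \<equiv> \<lambda>s. arr s aLEV (reg s rW)"
  shows "trace_state own cap b (exec trace_body s) \<and> \<mu> (exec trace_body s) < \<mu> s"
proof -
  define own' where "own' = arr s aOWN"
  define lev where "lev = arr s aLEV"
  define via where "via = arr s aVIA"
  define w where "w = reg s rW"
  define h where "h = via w - 1"
  note defs = own'_def lev_def via_def w_def
  have env: "reg s rN = n" "reg s rM = M" "arr s aTAIL = tail" "arr s aPAR = par"
     "arr s aFIRST = first" "arr s aNEXT = nxt" "arr s aDEG = deg"
     "arr s aCAP = cap" "arr s aLOAD = load own'"
    and tree: "bfs_tree own cap lev via" and inv: "trace_inv own own' lev via b w"
    using st(1) by (auto simp: trace_state_def env_def defs)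
  have w: "via w \<noteq> 0" using st(2) by (simp add: defs)
  note tf = trace_flip[OF tree inv w h_def]
  have own': "orientation own'" using inv by (simp add: trace_inv_def)
  have ld: "load (own'(h := 0, par h := 1)) =
      (load own')(tail h := load own' (tail h) - 1, w := load own' w + 1)"
    using load_flip[OF own' tf(3,4)] tf(5) by simp
  have ne: "tail h \<noteq> w" using loopfree[OF tf(3)] tf(5) by auto
  let ?s = "exec trace_body s"
  have h': "via w - Suc 0 = h" by (simp add: h_def)
  note prog = trace_body_def flip_def env defs[symmetric] h'
  have "env ?s" "arr ?s aCAP = cap"
    using env by (simp_all add: env_def trace_body_def flip_def)
  moreover have "arr ?s aOWN = own'(h := 0, par h := 1)" "arr ?s aLEV = lev" "arr ?s aVIA = via"
      "reg ?s rW = tail h"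
      "arr ?s aLOAD = (load own')(tail h := load own' (tail h) - 1, w := load own' w + 1)"
    using ne by (simp_all add: prog)
  ultimately show ?thesis
    using tf(1,2) tree by (simp add: trace_state_def \<mu>_def defs[symmetric] ld[simplified])
qed

lemma trace_terminates:
  assumes st: "trace_state own cap b s" and "arr s aLEV (reg s rW) \<le> n"
    and T: "(len trace_body + 3) * (n + 1) \<le> T"
  shows "terminates (While (Read aVIA (Reg rW)) trace_body) s T
    (\<lambda>s. trace_state own cap b s \<and> arr s aVIA (reg s rW) = 0)"
proof -
  let ?\<mu> = "\<lambda>s. arr s aLEV (reg s rW)"
  have "?\<mu> s * (len trace_body + 3) + (len trace_body + 3) \<le> n * (len trace_body + 3) + (len trace_body + 3)"
    using assms(2) by (intro add_mono mult_right_mono) auto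
  also have "\<dots> \<le> T" using T by (simp add: algebra_simps)
  finally have le: "?\<mu> s * (len trace_body + 3) + (len trace_body + 3) \<le> T" .
  have "terminates (While (Read aVIA (Reg rW)) trace_body) s T
    (\<lambda>s. trace_state own cap b s \<and> val s (Read aVIA (Reg rW)) = 0)"
    by (rule terminates_While_straight[where f = ?\<mu>])
      (use st trace_step le in \<open>auto simp: trace_body_def flip_def\<close>)
  then show ?thesis by simp
qed

end


text \<open>
Searches for one augmenting path. \<open>rGO\<close> becomes \<open>0\<close> with the answer in \<open>rFLAG\<close> if there is no overloaded
node left, or if no node with slack can be reached.
\<close>

definition augment_body :: com where
  "augment_body =
     (Assign rQT (Const 0) ;; Assign rI (Const 0)) ;;
     While (Minus (Reg rN) (Reg rI)) bfs_reset_body ;;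
     If (Reg rQT)
       ((Assign rQH (Const 0) ;; Assign rSTOP (Const 0) ;;
         Assign rC (Read aFIRST (Read aQ (Const 0)))) ;;
        While bfs_cond bfs_body ;;
        If (Reg rSTOP)
          (While (Read aVIA (Reg rW)) trace_body)
          (Assign rGO (Const 0)))
       (Assign rFLAG (Const 1) ;; Assign rGO (Const 0))"

definition augment :: com where
  "augment = (Assign rFLAG (Const 0) ;; Assign rGO (Const 1)) ;; While (Reg rGO) augment_body"

definition augment_cost :: nat where
  "augment_cost = len bfs_reset_body + len bfs_body + len trace_body + 40"

context linked_graph
begin

definition base :: "(nat \<Rightarrow> nat) \<Rightarrow> (nat \<Rightarrow> nat) \<Rightarrow> state \<Rightarrow> bool" where
  "base own cap s \<longleftrightarrow> env s \<and> arr s aCAP = cap \<and> arr s aOWN = own \<and> arr s aLOAD = load own"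

definition reset_inv :: "(nat \<Rightarrow> nat) \<Rightarrow> (nat \<Rightarrow> nat) \<Rightarrow> state \<Rightarrow> bool" where
  "reset_inv own cap s \<longleftrightarrow> base own cap s \<and> reg s rI \<le> n \<and> inj_on (arr s aQ) {..<reg s rQT} \<and>
     arr s aQ ` {..<reg s rQT} = {v. v < reg s rI \<and> cap v \<le> load own v} \<and>
     (\<forall>v<reg s rI. arr s aLEV v = of_bool (cap v \<le> load own v) \<and> arr s aVIA v = 0)"

lemma reset_step:
  assumes inv: "reset_inv own cap s" and i: "reg s rI < n"
  shows "reset_inv own cap (exec bfs_reset_body s) \<and>
    n - reg (exec bfs_reset_body s) rI < n - reg s rI"
proof -
  define i where "i = reg s rI"
  define qt where "qt = reg s rQT"
  define q where "q = arr s aQ"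
  define lev where "lev = arr s aLEV"
  define via where "via = arr s aVIA"
  note defs = i_def qt_def q_def lev_def via_def
  have env: "arr s aCAP = cap" "arr s aLOAD = load own"
    and q: "inj_on q {..<qt}" "q ` {..<qt} = {v. v < i \<and> cap v \<le> load own v}"
    and lv: "\<And>v. v < i \<Longrightarrow> lev v = of_bool (cap v \<le> load own v) \<and> via v = 0"
    using inv by (auto simp: reset_inv_def base_def defs)
  let ?s = "exec bfs_reset_body s"
  note prog = bfs_reset_body_def active_exp_def incr_def env defs[symmetric]
  have b: "base own cap ?s"
    using inv by (auto simp: reset_inv_def base_def env_def bfs_reset_body_def incr_def)
  have lt: "{v. v < Suc i \<and> P v} = {v. v < i \<and> P v} \<union> (if P i then {i} else {})" for P
    by (auto simp: less_Suc_eq)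
  show ?thesis
  proof (cases "cap i \<le> load own i")
    case True
    have eqs: "arr ?s aLEV = lev(i := 1)" "arr ?s aVIA = via(i := 0)" "arr ?s aQ = q(qt := i)"
        "reg ?s rQT = qt + 1" "reg ?s rI = i + 1"
      using True by (simp_all add: prog)
    have "i \<notin> q ` {..<qt}" using q(2) by auto
    then have "inj_on (q(qt := i)) {..<qt + 1}" using q(1) by (auto simp: inj_on_def less_Suc_eq)
    moreover have "(q(qt := i)) ` {..<qt + 1} = insert i (q ` {..<qt})"
      by (auto simp: lessThan_Suc image_iff)
    ultimately show ?thesis
      unfolding reset_inv_def eqs using b lv q(2) i True
      by (auto simp: lt less_Suc_eq defs[symmetric])
  next
    case False
    have eqs: "arr ?s aLEV = lev(i := 0)" "arr ?s aVIA = via(i := 0)" "arr ?s aQ = q"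
        "reg ?s rQT = qt" "reg ?s rI = i + 1"
      using False by (simp_all add: prog)
    show ?thesis
      unfolding reset_inv_def eqs using b lv q i False
      by (auto simp: lt less_Suc_eq defs[symmetric])
  qed
qed

lemma bfs_start:
  assumes inv: "reset_inv own cap s" "reg s rI = n" and qt: "reg s rQT \<noteq> 0"
    and eqs: "reg s' rQH = 0" "reg s' rSTOP = 0" "reg s' rC = first (arr s aQ 0)"
      "reg s' rQT = reg s rQT" "arr s' = arr s" "base own cap s'"
  shows "bfs_state own cap s'"
proof -
  have "bfs_inv own cap (arr s aLEV) (arr s aVIA) (arr s aQ) 0 (reg s rQT) (first (arr s aQ 0))"
    unfolding bfs_inv_def
  proof (intro conjI)
    show "bfs_tree own cap (arr s aLEV) (arr s aVIA)"
      using inv by (auto simp: bfs_tree_def reset_inv_def of_bool_def split: if_splits)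
    show "arr s aQ ` {..<reg s rQT} = {v. v < n \<and> arr s aLEV v \<noteq> 0}"
      using inv by (auto simp: reset_inv_def of_bool_def split: if_splits)
    show "\<forall>h\<in>scanned (arr s aQ) 0 (reg s rQT) (first (arr s aQ 0)).
        own h = 1 \<longrightarrow> arr s aLEV (tip h) \<noteq> 0"
      using first_gap by (auto simp: scanned_def)
  qed (use inv qt first_le first_tail in \<open>auto simp: reset_inv_def of_bool_def\<close>)
  moreover have "\<forall>v<n. arr s aLEV v \<noteq> 0 \<longrightarrow> cap v \<le> load own v + 1"
    using inv by (auto simp: reset_inv_def of_bool_def split: if_splits)
  ultimately show ?thesis using eqs(6) by (simp add: bfs_state_def base_def eqs)
qed

text \<open>
\<open>S\<close> is any set that separates the overloaded nodes from those with slack. Augmenting neither creates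
an overloaded node nor one with slack, so \<open>S\<close> stays fixed while its outflow bounds the number of
augmentations to come.
\<close>

definition aug_state :: "(nat \<Rightarrow> nat) \<Rightarrow> nat set \<Rightarrow> state \<Rightarrow> bool" where
  "aug_state cap S s \<longleftrightarrow> base (arr s aOWN) cap s \<and> orientation (arr s aOWN) \<and> S \<subseteq> {..<n} \<and>
     (\<forall>v<n. cap v \<le> load (arr s aOWN) v \<longrightarrow> v \<in> S) \<and>
     (\<forall>v<n. load (arr s aOWN) v + 1 < cap v \<longrightarrow> v \<notin> S) \<and>
     (if reg s rGO = 0 then reg s rFLAG = of_bool (feasible cap)
      else reg s rGO = 1 \<and> reg s rFLAG = 0)"

definition remaining :: "nat set \<Rightarrow> state \<Rightarrow> nat" where
  "remaining S s = (if reg s rGO = 0 then 0 else outflow (arr s aOWN) S + 1)"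

text \<open>
The load inside \<open>S\<close> is the outflow plus the constant number of edges inside \<open>S\<close>.
\<close>

lemma outflow_moved:
  assumes own: "orientation own" "orientation own'" and mv: "moved own own' a b"
    and S: "finite S" "a \<in> S" "b \<notin> S"
  shows "outflow own' S + 1 = outflow own S"
proof -
  have "(\<Sum>v\<in>S. load own' v) + (\<Sum>v\<in>S. of_bool (v = a)) =
      (\<Sum>v\<in>S. load own v) + (\<Sum>v\<in>S. of_bool (v = b))"
    unfolding sum.distrib[symmetric] using mv by (intro sum.cong) (auto simp: moved_def)
  moreover have "(\<Sum>v\<in>S. of_bool (v = a)) = (1 :: nat)"
    using S by (simp add: of_bool_def sum.delta)
  moreover have "(\<Sum>v\<in>S. of_bool (v = b)) = (0 :: nat)"
    using S by (intro sum.neutral) auto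
  ultimately show ?thesis
    using sum_load[OF S(1), of own] sum_load[OF S(1), of own'] sum_inner_eq[OF own] by simp
qed

lemma trace_init:
  assumes "bfs_tree own cap lev via" "orientation own" "b < n" "lev b \<noteq> 0"
  shows "trace_inv own own lev via b b"
proof -
  have "own (via v - 1) = 1" if "v < n" "lev v \<noteq> 0" "via v \<noteq> 0" for v
    using assms(1) that unfolding bfs_tree_def by presburger
  then show ?thesis using assms by (simp add: trace_inv_def moved_def)
qed

lemma augment_traced:
  assumes st: "aug_state cap S s" "reg s rGO \<noteq> 0" and own: "own = arr s aOWN"
    and b: "b < n" "load own b + 1 < cap b"
    and tr: "trace_state own cap b s'" "arr s' aVIA (reg s' rW) = 0"
    and same: "reg s' rGO = reg s rGO" "reg s' rFLAG = reg s rFLAG"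
  shows "aug_state cap S s' \<and> remaining S s' < remaining S s"
proof -
  define a where "a = reg s' rW"
  define own' where "own' = arr s' aOWN"
  have inv: "trace_inv own own' (arr s' aLEV) (arr s' aVIA) b a"
    using tr by (simp add: trace_state_def own'_def a_def)
  then have mv: "moved own own' a b" and own': "orientation own'" and a: "a < n"
    by (auto simp: trace_inv_def)
  have act: "cap a \<le> load own a"
    using inv tr by (auto simp: trace_state_def bfs_tree_def trace_inv_def a_def)
  have ori: "orientation own" and S: "S \<subseteq> {..<n}" using st own by (auto simp: aug_state_def)
  have aS: "a \<in> S" and bS: "b \<notin> S" using st a act b by (auto simp: aug_state_def own)
  have ld: "load own' v + of_bool (v = a) = load own v + of_bool (v = b)" for v
    using mv by (auto simp: moved_def)
  have "v \<in> S" if "v < n" "cap v \<le> load own' v" for v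
  proof -
    have "cap v \<le> load own v" using ld[of v] that b by (cases "v = b"; cases "v = a") auto
    then show ?thesis using st that by (auto simp: aug_state_def own)
  qed
  moreover have "v \<notin> S" if "v < n" "load own' v + 1 < cap v" for v
  proof -
    have "load own v + 1 < cap v" using ld[of v] that act by (cases "v = b"; cases "v = a") auto
    then show ?thesis using st that by (auto simp: aug_state_def own)
  qed
  moreover have "outflow own' S + 1 = outflow own S"
    using outflow_moved[OF ori own' mv _ aS bS] S finite_subset by blast
  ultimately show ?thesis
    using st tr own' same S own
    by (auto simp: aug_state_def remaining_def trace_state_def base_def own'_def[symmetric])
qed

lemma augment_step:
  assumes st: "aug_state cap S s" "reg s rGO \<noteq> 0"
  shows "terminates augment_body s (augment_cost * (n + M + 1))
    (\<lambda>s'. aug_state cap S s' \<and> remaining S s' < remaining S s)"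
proof -
  define own where "own = arr s aOWN"
  have own: "orientation own" and b: "base own cap s" and go: "reg s rGO = 1" "reg s rFLAG = 0"
    using st by (auto simp: aug_state_def own_def)
  let ?keep = "\<lambda>s'. reg s' rGO = reg s rGO \<and> reg s' rFLAG = reg s rFLAG"
  let ?post = "\<lambda>s'. aug_state cap S s' \<and> remaining S s' < remaining S s"
  have finish: "?post s'"
    if "base own cap s'" "reg s' rGO = 0" "reg s' rFLAG = of_bool (feasible cap)" for s'
    using that st own by (auto simp: aug_state_def remaining_def base_def own_def[symmetric])
  define X where "X = n + M + 1"
  let ?Ta = "(len bfs_reset_body + 4) * X" and ?Tb = "(len bfs_body + 6) * X"
    and ?Tc = "(len trace_body + 3) * X"
  have Ta: "(len bfs_reset_body + 4) * n + 4 \<le> ?Ta" and Tb: "?Tb = (len bfs_body + 6) * (n + M + 1)"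
    and Tc: "(len trace_body + 3) * (n + 1) \<le> ?Tc" and X1: "X \<ge> 1"
    by (simp_all add: X_def algebra_simps)
  show ?thesis
    unfolding augment_body_def
  proof (rule terminates_Seq[where Ta = 4 and Tb = "?Ta + ?Tb + ?Tc + 20" and
        R = "\<lambda>s'. reset_inv own cap s' \<and> reg s' rI = 0 \<and> ?keep s'"])
    show "terminates (Assign rQT (Const 0) ;; Assign rI (Const 0)) s 4
        (\<lambda>s'. reset_inv own cap s' \<and> reg s' rI = 0 \<and> ?keep s')"
      using b by (intro terminates_straight) (auto simp: reset_inv_def base_def env_def)
    have "4 + (?Ta + ?Tb + ?Tc + 20) \<le> augment_cost * X"
      using X1 by (simp add: augment_cost_def algebra_simps)
    then show "4 + (?Ta + ?Tb + ?Tc + 20) \<le> augment_cost * (n + M + 1)" by (simp add: X_def)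
  next
    fix s1 assume s1: "reset_inv own cap s1 \<and> reg s1 rI = 0 \<and> ?keep s1"
    show "terminates (While (Minus (Reg rN) (Reg rI)) bfs_reset_body ;;
       If (Reg rQT)
         ((Assign rQH (Const 0) ;; Assign rSTOP (Const 0) ;;
           Assign rC (Read aFIRST (Read aQ (Const 0)))) ;;
          While bfs_cond bfs_body ;;
          If (Reg rSTOP) (While (Read aVIA (Reg rW)) trace_body) (Assign rGO (Const 0)))
         (Assign rFLAG (Const 1) ;; Assign rGO (Const 0))) s1 (?Ta + ?Tb + ?Tc + 20) ?post"
    proof (rule terminates_Seq[where Ta = ?Ta and Tb = "?Tb + ?Tc + 20" and
          R = "\<lambda>s'. reset_inv own cap s' \<and> reg s' rI = n \<and> ?keep s'"])
      have "terminates (While (Minus (Reg rN) (Reg rI)) bfs_reset_body) s1 ?Ta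
          (\<lambda>s. reset_inv own cap s \<and> reg s rN \<le> reg s rI)"
      proof (rule terminates_for)
        show "straight bfs_reset_body" by (simp add: bfs_reset_body_def incr_def)
        have N: "reg t rN = n" if "reset_inv own cap t" for t
          using that by (simp add: reset_inv_def base_def env_def)
        show "reset_inv own cap (exec bfs_reset_body t) \<and>
            reg (exec bfs_reset_body t) rN - reg (exec bfs_reset_body t) rI < reg t rN - reg t rI"
          if "reset_inv own cap t" "reg t rI < reg t rN" for t
          using reset_step[of own cap t] that N[of t] N[of "exec bfs_reset_body t"] by simp
      qed (use s1 Ta in \<open>simp_all add: reset_inv_def base_def env_def\<close>)
      then show "terminates (While (Minus (Reg rN) (Reg rI)) bfs_reset_body) s1 ?Ta
          (\<lambda>s'. reset_inv own cap s' \<and> reg s' rI = n \<and> ?keep s')"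
        by (rule terminates_mono)
          (use s1 in \<open>auto simp: reset_inv_def base_def env_def same_def bfs_reset_body_def incr_def\<close>)
    next
      fix s2 assume s2: "reset_inv own cap s2 \<and> reg s2 rI = n \<and> ?keep s2"
      show "terminates (If (Reg rQT)
         ((Assign rQH (Const 0) ;; Assign rSTOP (Const 0) ;;
           Assign rC (Read aFIRST (Read aQ (Const 0)))) ;;
          While bfs_cond bfs_body ;;
          If (Reg rSTOP) (While (Read aVIA (Reg rW)) trace_body) (Assign rGO (Const 0)))
         (Assign rFLAG (Const 1) ;; Assign rGO (Const 0))) s2 (?Tb + ?Tc + 20) ?post"
      proof (rule terminates_If[where Ta = "?Tb + ?Tc + 18"])
        assume "val s2 (Reg rQT) = 0"
        then have "\<forall>v<n. load own v < cap v"
          using s2 by (auto simp: reset_inv_def not_le[symmetric])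
        then have "feasible cap" using own by (auto simp: feasible_def)
        then show "terminates (Assign rFLAG (Const 1) ;; Assign rGO (Const 0)) s2 (?Tb + ?Tc + 18) ?post"
          using s2 by (intro terminates_straight finish) (auto simp: reset_inv_def base_def env_def)
      next
        assume qt: "val s2 (Reg rQT) \<noteq> 0"
        then have "arr s2 aQ 0 \<in> arr s2 aQ ` {..<reg s2 rQT}" by auto
        then obtain a where a: "a < n" "cap a \<le> load own a"
          using s2 by (auto simp: reset_inv_def)
        show "terminates ((Assign rQH (Const 0) ;; Assign rSTOP (Const 0) ;;
           Assign rC (Read aFIRST (Read aQ (Const 0)))) ;;
          While bfs_cond bfs_body ;;
          If (Reg rSTOP) (While (Read aVIA (Reg rW)) trace_body) (Assign rGO (Const 0)))
          s2 (?Tb + ?Tc + 18) ?post"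
        proof (rule terminates_Seq[where Ta = 8 and Tb = "?Tb + ?Tc + 10" and
              R = "\<lambda>s'. bfs_state own cap s' \<and> ?keep s'"])
          show "terminates (Assign rQH (Const 0) ;; Assign rSTOP (Const 0) ;;
              Assign rC (Read aFIRST (Read aQ (Const 0)))) s2 8
              (\<lambda>s'. bfs_state own cap s' \<and> ?keep s')"
            using s2 qt by (intro terminates_straight conjI bfs_start[of own cap s2])
              (auto simp: reset_inv_def base_def env_def)
        next
          fix s3 assume s3: "bfs_state own cap s3 \<and> ?keep s3"
          show "terminates (While bfs_cond bfs_body ;;
              If (Reg rSTOP) (While (Read aVIA (Reg rW)) trace_body) (Assign rGO (Const 0)))
              s3 (?Tb + ?Tc + 10) ?post"
          proof (rule terminates_Seq[where Ta = "?Tb" and Tb = "?Tc + 10" and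
                R = "\<lambda>s'. bfs_state own cap s' \<and> val s' bfs_cond = 0 \<and> ?keep s'"])
            show "terminates (While bfs_cond bfs_body) s3 ?Tb
                (\<lambda>s'. bfs_state own cap s' \<and> val s' bfs_cond = 0 \<and> ?keep s')"
              by (rule terminates_mono[OF bfs_terminates[OF own _ Tb[THEN eq_refl[OF sym]]]])
                (use s3 in \<open>auto simp: same_def bfs_body_def incr_def\<close>)
          next
            fix s4 assume s4: "bfs_state own cap s4 \<and> val s4 bfs_cond = 0 \<and> ?keep s4"
            have inv4: "bfs_inv own cap (arr s4 aLEV) (arr s4 aVIA) (arr s4 aQ)
                (reg s4 rQH) (reg s4 rQT) (reg s4 rC)" using s4 by (simp add: bfs_state_def)
            show "terminates (If (Reg rSTOP) (While (Read aVIA (Reg rW)) trace_body) (Assign rGO (Const 0)))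
                s4 (?Tc + 10) ?post"
            proof (rule terminates_If[where Ta = "?Tc + 8"])
              assume "val s4 (Reg rSTOP) = 0"
              then show "terminates (Assign rGO (Const 0)) s4 (?Tc + 8) ?post"
                using bfs_exhausted_infeasible[where s = s4 and cap = cap, OF own _ _ _ a] s4 go
                by (intro terminates_straight finish) (auto simp: bfs_state_def base_def env_def)
            next
              assume "val s4 (Reg rSTOP) \<noteq> 0"
              define b where "b = reg s4 rW"
              have b: "b < n" "load own b + 1 < cap b" "arr s4 aLEV b \<noteq> 0"
                using s4 \<open>val s4 (Reg rSTOP) \<noteq> 0\<close> by (auto simp: bfs_state_def b_def)
              have "arr s4 aLEV b \<le> reg s4 rQT" using inv4 b(1) by (auto simp: bfs_inv_def)
              also have "\<dots> \<le> n" using queue_le inv4 by (auto simp: bfs_inv_def)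
              finally have lev: "arr s4 aLEV (reg s4 rW) \<le> n" by (simp add: b_def)
              have "trace_state own cap b s4"
                using s4 trace_init[where lev = "arr s4 aLEV" and cap = cap, OF _ own b(1,3)] inv4
                by (simp add: trace_state_def bfs_state_def bfs_inv_def b_def[symmetric])
              from trace_terminates[OF this lev Tc]
              show "terminates (While (Read aVIA (Reg rW)) trace_body) s4 (?Tc + 8) ?post"
              proof (rule terminates_mono)
                fix s5 assume s5: "trace_state own cap b s5 \<and> arr s5 aVIA (reg s5 rW) = 0"
                  "same (While (Read aVIA (Reg rW)) trace_body) s4 s5"
                have "reg s5 rGO = reg s rGO" "reg s5 rFLAG = reg s rFLAG"
                  using s5(2) s4 by (auto simp: same_def trace_body_def flip_def)
                then show "?post s5"
                  using augment_traced[OF st own_def b(1,2)] s5(1) by blast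
              qed simp
            qed simp
          qed simp
        qed simp
      qed simp
    qed simp
  qed
qed


text \<open>
Every iteration but the last moves one unit of load out of \<open>S\<close>, so there are at most \<open>B + 1\<close>.
\<close>

lemma augment_terminates:
  assumes b: "base own cap s" "orientation own" and S: "S \<subseteq> {..<n}"
      "\<And>v. v < n \<Longrightarrow> cap v \<le> load own v \<Longrightarrow> v \<in> S"
      "\<And>v. v < n \<Longrightarrow> load own v + 1 < cap v \<Longrightarrow> v \<notin> S"
    and out: "outflow own S \<le> B" and T: "(B + 1) * ((augment_cost + 2) * (n + M + 1)) + 6 \<le> T"
  shows "terminates augment s T (\<lambda>s. base (arr s aOWN) cap s \<and> orientation (arr s aOWN) \<and>
    reg s rFLAG = of_bool (feasible cap))"
  unfolding augment_def
proof (rule terminates_Seq[where Ta = 4 and Tb = "(B + 1) * ((augment_cost + 2) * (n + M + 1)) + 2"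
      and R = "\<lambda>s. aug_state cap S s \<and> remaining S s \<le> B + 1"])
  show "terminates (Assign rFLAG (Const 0) ;; Assign rGO (Const 1)) s 4
      (\<lambda>s. aug_state cap S s \<and> remaining S s \<le> B + 1)"
    using b S out by (intro terminates_straight)
      (auto simp: aug_state_def remaining_def base_def env_def)
  fix s' assume s': "aug_state cap S s' \<and> remaining S s' \<le> B + 1"
  have "remaining S s' * (augment_cost * (n + M + 1) + 2) \<le> (B + 1) * ((augment_cost + 2) * (n + M + 1))"
    using s' by (intro mult_mono) (auto simp: algebra_simps)
  then have "terminates (While (Reg rGO) augment_body) s' ((B + 1) * ((augment_cost + 2) * (n + M + 1)) + 2)
      (\<lambda>s. aug_state cap S s \<and> val s (Reg rGO) = 0)"
    by (intro terminates_While[where f = "remaining S" and c = "augment_cost * (n + M + 1)"])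
      (use s' augment_step in auto)
  then show "terminates (While (Reg rGO) augment_body) s' ((B + 1) * ((augment_cost + 2) * (n + M + 1)) + 2)
      (\<lambda>s. base (arr s aOWN) cap s \<and> orientation (arr s aOWN) \<and>
        reg s rFLAG = of_bool (feasible cap))"
    by (rule terminates_mono) (auto simp: aug_state_def)
qed (use T in simp)

end


section \<open>Deciding feasibility\<close>

definition setup_body :: com where
  "setup_body =
     If (Minus (Read aDEG (Reg rI)) (Mini (Reg rK) (Read aIN (Plus (Const 2) (Reg rI)))))
       (Write aCAP (Reg rI) (Mini (Reg rK) (Read aIN (Plus (Const 2) (Reg rI)))))
       (Write aCAP (Reg rI) (Plus (Read aDEG (Reg rI)) (Const 1))) ;;
     Write aLAB (Reg rI) (Const 0) ;;
     Write aCUR (Reg rI) (Read aFIRST (Reg rI)) ;;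
     Write aSTK (Reg rI) (Reg rI) ;;
     incr rI"

text \<open>
Neither the orientation nor the loads are reset, as every test may start from any orientation.
\<close>

definition check :: com where
  "check =
     Assign rI (Const 0) ;;
     While (Minus (Reg rN) (Reg rI)) setup_body ;;
     Assign rSP (Reg rN) ;;
     While (Reg rSP) push_relabel_body ;;
     augment"

definition check_cost :: nat where
  "check_cost = len setup_body + 2 * len push_relabel_body + augment_cost + 40"

context linked_graph
begin

text \<open>
A node of degree at most \<open>min k (\<kappa> v)\<close> is unconstrained. Any other node sees \<open>load + 1\<close> colors unless it
owns all of its edges, which are too many in any case.
\<close>

definition cap_of :: "(nat \<Rightarrow> nat) \<Rightarrow> nat \<Rightarrow> nat \<Rightarrow> nat" where
  "cap_of \<kappa> k v = (if deg v \<le> min k (\<kappa> v) then deg v + 1 else min k (\<kappa> v))"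

lemma feasible_cong: "(\<And>v. v < n \<Longrightarrow> cap v = cap' v) \<Longrightarrow> feasible cap = feasible cap'"
  by (auto simp: feasible_def)

definition setup_inv :: "(nat \<Rightarrow> nat) \<Rightarrow> nat \<Rightarrow> state \<Rightarrow> bool" where
  "setup_inv \<kappa> k s \<longleftrightarrow> reg s rN = n \<and> reg s rK = k \<and> reg s rI \<le> n \<and>
     arr s aDEG = deg \<and> arr s aFIRST = first \<and> (\<forall>v<n. arr s aIN (2 + v) = \<kappa> v) \<and>
     (\<forall>v<reg s rI. arr s aCAP v = cap_of \<kappa> k v \<and> arr s aLAB v = 0 \<and>
       arr s aCUR v = first v \<and> arr s aSTK v = v)"

lemma setup_step:
  assumes "setup_inv \<kappa> k s" "reg s rI < n"
  shows "setup_inv \<kappa> k (exec setup_body s) \<and> n - reg (exec setup_body s) rI < n - reg s rI"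
proof -
  have \<kappa>: "arr s aIN (Suc (Suc (reg s rI))) = \<kappa> (reg s rI)"
    using assms by (auto simp: setup_inv_def)
  have "arr (exec setup_body s) aCAP = (arr s aCAP)(reg s rI := cap_of \<kappa> k (reg s rI))"
    using assms by (auto simp: setup_inv_def setup_body_def incr_def \<kappa> cap_of_def)
  moreover have "arr (exec setup_body s) aLAB = (arr s aLAB)(reg s rI := 0)"
    "arr (exec setup_body s) aCUR = (arr s aCUR)(reg s rI := first (reg s rI))"
    "arr (exec setup_body s) aSTK = (arr s aSTK)(reg s rI := reg s rI)"
    "reg (exec setup_body s) rI = reg s rI + 1" "reg (exec setup_body s) rN = n"
    "reg (exec setup_body s) rK = k" "arr (exec setup_body s) aDEG = deg"
    "arr (exec setup_body s) aFIRST = first" "arr (exec setup_body s) aIN = arr s aIN"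
    using assms by (simp_all add: setup_inv_def setup_body_def incr_def)
  ultimately show ?thesis
    using assms by (auto simp: setup_inv_def less_Suc_eq)
qed

definition check_pre :: "(nat \<Rightarrow> nat) \<Rightarrow> nat \<Rightarrow> state \<Rightarrow> bool" where
  "check_pre \<kappa> D s \<longleftrightarrow> env s \<and> reg s rD = D \<and> (\<forall>v<n. arr s aIN (2 + v) = \<kappa> v) \<and>
     orientation (arr s aOWN) \<and> arr s aLOAD = load (arr s aOWN)"

lemma setup_frame:
  assumes "same (While b setup_body) s s'" "check_pre \<kappa> D s"
  shows "check_pre \<kappa> D s'"
  using assms(2) same_reg[OF assms(1)] same_arr[OF assms(1)]
  by (simp add: check_pre_def env_def setup_body_def incr_def)

lemma augment_frame:
  "same augment s s' \<Longrightarrow> reg s' rD = reg s rD" "same augment s s' \<Longrightarrow> arr s' aIN = arr s aIN"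
  by (erule same_reg same_arr, simp add: augment_def augment_body_def bfs_reset_body_def
      bfs_body_def trace_body_def flip_def incr_def)+

text \<open>
After push-relabel one of the level sets has outflow at most \<open>D\<close> and separates overloaded nodes, now
of label \<open>D\<close>, from nodes with slack, still of label \<open>0\<close>.
\<close>

lemma check_terminates:
  assumes pre: "check_pre \<kappa> D s" "reg s rK = k" and D: "D \<ge> 1" "M \<le> 2 * D^2 \<or> n^2 \<le> D^3"
  shows "terminates check s (check_cost * ((D + 1) * (n + M + 1)))
    (\<lambda>s. check_pre \<kappa> D s \<and> reg s rFLAG = of_bool (feasible (cap_of \<kappa> k)))"
proof -
  define Y where "Y = (D + 1) * (n + M + 1)"
  let ?Ta = "(len setup_body + 4) * Y" and ?Tb = "2 * (len push_relabel_body + 2) * Y"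
    and ?Tc = "(augment_cost + 2) * Y + 6"
  let ?post = "\<lambda>s. check_pre \<kappa> D s \<and> reg s rFLAG = of_bool (feasible (cap_of \<kappa> k))"
  have Y: "Y \<ge> 1" "n + 1 \<le> Y" "2 * (D * (M + n) + M) + n + 1 \<le> 2 * Y"
    by (simp_all add: Y_def algebra_simps)
  have total: "2 + (?Ta + (2 + (?Tb + ?Tc))) \<le> check_cost * ((D + 1) * (n + M + 1))"
    using Y(1) unfolding Y_def[symmetric] by (simp add: check_cost_def algebra_simps)
  have "(len setup_body + 4) * (n + 1) \<le> ?Ta" using Y(2) by (rule mult_left_mono) simp
  then have Ta: "(len setup_body + 4) * n + 4 \<le> ?Ta" by (simp add: algebra_simps)
  have "(len push_relabel_body + 2) * (2 * (D * (M + n) + M) + n + 1) \<le> (len push_relabel_body + 2) * (2 * Y)"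
    using Y(3) by (rule mult_left_mono) simp
  then have Tb: "(len push_relabel_body + 2) * (2 * (D * (M + n) + M) + n + 1) \<le> ?Tb"
    by (simp add: algebra_simps)
  let ?st = "\<lambda>s'. check_pre \<kappa> D s' \<and> setup_inv \<kappa> k s'"
  show ?thesis
    unfolding check_def
  proof (rule terminates_Seq[OF _ _ total])
    show "terminates (Assign rI (Const 0)) s 2 (\<lambda>s'. ?st s' \<and> reg s' rI = 0)"
      using pre by (intro terminates_straight) (auto simp: check_pre_def setup_inv_def env_def)
    fix s1 assume s1: "?st s1 \<and> reg s1 rI = 0"
    show "terminates (While (Minus (Reg rN) (Reg rI)) setup_body ;; Assign rSP (Reg rN) ;;
        While (Reg rSP) push_relabel_body ;; augment) s1 (?Ta + (2 + (?Tb + ?Tc))) ?post"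
    proof (rule terminates_Seq[OF _ _ order_refl])
      have "terminates (While (Minus (Reg rN) (Reg rI)) setup_body) s1 ?Ta
          (\<lambda>s. setup_inv \<kappa> k s \<and> reg s rN \<le> reg s rI)"
      proof (rule terminates_for)
        show "straight setup_body" by (simp add: setup_body_def incr_def)
        show "setup_inv \<kappa> k (exec setup_body t) \<and>
            reg (exec setup_body t) rN - reg (exec setup_body t) rI < reg t rN - reg t rI"
          if "setup_inv \<kappa> k t" "reg t rI < reg t rN" for t
        proof -
          have "reg t rN = n" using that by (simp add: setup_inv_def)
          with setup_step[of \<kappa> k t] that have "setup_inv \<kappa> k (exec setup_body t) \<and>
              n - reg (exec setup_body t) rI < n - reg t rI" by simp
          then show ?thesis using \<open>reg t rN = n\<close> by (simp add: setup_inv_def)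
        qed
      qed (use s1 Ta in \<open>simp_all add: setup_inv_def\<close>)
      then show "terminates (While (Minus (Reg rN) (Reg rI)) setup_body) s1 ?Ta
          (\<lambda>s'. ?st s' \<and> reg s' rI = n)"
        by (rule terminates_mono)
          (use s1 setup_frame in \<open>auto simp: setup_inv_def check_pre_def env_def\<close>)
    next
      fix s2 assume s2: "?st s2 \<and> reg s2 rI = n"
      show "terminates (Assign rSP (Reg rN) ;; While (Reg rSP) push_relabel_body ;; augment)
          s2 (2 + (?Tb + ?Tc)) ?post"
      proof (rule terminates_Seq[OF _ _ order_refl])
        show "terminates (Assign rSP (Reg rN)) s2 2 (\<lambda>s'. ?st s' \<and> reg s' rI = n \<and> reg s' rSP = n)"
          using s2 by (intro terminates_straight) (auto simp: check_pre_def setup_inv_def env_def)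
      next
        fix s3 assume s3: "?st s3 \<and> reg s3 rI = n \<and> reg s3 rSP = n"
        define cap where "cap = arr s3 aCAP"
        have cap: "feasible cap = feasible (cap_of \<kappa> k)"
          using s3 by (intro feasible_cong) (auto simp: setup_inv_def cap_def)
        have z: "\<And>v. v < n \<Longrightarrow> arr s3 aLAB v = 0" "\<And>v. v < n \<Longrightarrow> arr s3 aCUR v = first v"
            "\<And>v. v < n \<Longrightarrow> arr s3 aSTK v = v"
          using s3 by (auto simp: setup_inv_def)
        have "pr_inv D cap (arr s3 aOWN) (arr s3 aLAB) (arr s3 aCUR) (arr s3 aSTK) n"
          unfolding pr_inv_def
        proof (intro conjI)
          show "valid_labels (arr s3 aOWN) (arr s3 aLAB)"
            using z tail_less par_less by (auto simp: valid_labels_def)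
          show "\<forall>h<M. arr s3 aCUR (tail h) \<le> h \<and> arr s3 aOWN h = 1 \<longrightarrow>
              arr s3 aLAB (tail h) \<le> arr s3 aLAB (tip h)"
            using z tail_less par_less by auto
          show "\<forall>v<n. cap v \<le> load (arr s3 aOWN) v \<and> arr s3 aLAB v < D \<longrightarrow> v \<in> arr s3 aSTK ` {..<n}"
            using z(3) by (auto simp: image_iff intro!: bexI)
        qed (use z s3 first_le first_tail in \<open>auto simp: check_pre_def\<close>)
        then have pr: "pr_state D cap s3"
          using s3 by (auto simp: pr_state_def check_pre_def cap_def)
        show "terminates (While (Reg rSP) push_relabel_body ;; augment) s3 (?Tb + ?Tc) ?post"
        proof (rule terminates_Seq[OF _ _ order_refl])
          have "reg s3 rSP = n" using s3 by simp
          from push_relabel_terminates[OF pr this refl Tb]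
          show "terminates (While (Reg rSP) push_relabel_body) s3 ?Tb
              (\<lambda>s'. (pr_state D cap s' \<and> reg s' rSP = 0) \<and> (\<forall>v<n. arr s' aIN (2 + v) = \<kappa> v))"
            by (rule terminates_mono)
              (use s3 in \<open>auto simp: same_def push_relabel_body_def flip_def incr_def check_pre_def\<close>)
        next
          fix s4 assume s4: "(pr_state D cap s4 \<and> reg s4 rSP = 0) \<and> (\<forall>v<n. arr s4 aIN (2 + v) = \<kappa> v)"
          define own where "own = arr s4 aOWN"
          define d where "d = arr s4 aLAB"
          have inv: "pr_inv D cap own d (arr s4 aCUR) (arr s4 aSTK) 0"
            using s4 by (auto simp: pr_state_def own_def d_def)
          then have own: "orientation own" and vl: "valid_labels own d" by (auto simp: pr_inv_def)
          obtain i where i: "1 \<le> i" "i \<le> D" "outflow own {v. v < n \<and> i \<le> d v} \<le> D"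
            using small_cut[OF own vl D] by blast
          have "terminates augment s4 ?Tc (\<lambda>s. base (arr s aOWN) cap s \<and> orientation (arr s aOWN) \<and>
              reg s rFLAG = of_bool (feasible cap))"
          proof (rule augment_terminates[OF _ own _ _ _ i(3)])
            show "base own cap s4" using s4 by (auto simp: base_def pr_state_def own_def)
            show "v \<in> {v. v < n \<and> i \<le> d v}" if "v < n" "cap v \<le> load own v" for v
              using inv that i(2) by (force simp: pr_inv_def)
            show "v \<notin> {v. v < n \<and> i \<le> d v}" if "v < n" "load own v + 1 < cap v" for v
              using inv that i(1) by (force simp: pr_inv_def)
          qed (auto simp: Y_def algebra_simps)
          then show "terminates augment s4 ?Tc ?post"
            by (rule terminates_mono)
              (use s4 cap augment_frame in \<open>auto simp: base_def check_pre_def pr_state_def\<close>)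
        qed
      qed
    qed
  qed
qed

end


section \<open>Building the incidence lists\<close>

text \<open>
Edge \<open>j\<close> of the input becomes the half-edges \<open>2 j\<close> and \<open>2 j + 1\<close>, and the first endpoint owns it.
\<close>

definition edges_body :: com where
  "edges_body =
     Write aTAIL (Reg rI) (Read aIN (Plus (Const 2) (Plus (Reg rN) (Reg rI)))) ;;
     Write aTAIL (Plus (Reg rI) (Const 1)) (Read aIN (Plus (Const 3) (Plus (Reg rN) (Reg rI)))) ;;
     Write aPAR (Reg rI) (Plus (Reg rI) (Const 1)) ;;
     Write aPAR (Plus (Reg rI) (Const 1)) (Reg rI) ;;
     Write aOWN (Reg rI) (Const 1) ;;
     Assign rI (Plus (Reg rI) (Const 2))"

definition lists_body :: com where
  "lists_body =
     Assign rV (Read aTAIL (Reg rI)) ;;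
     Write aNEXT (Reg rI) (Read aFIRST (Reg rV)) ;;
     Write aFIRST (Reg rV) (Plus (Reg rI) (Const 1)) ;;
     Write aDEG (Reg rV) (Plus (Read aDEG (Reg rV)) (Const 1)) ;;
     Write aLOAD (Reg rV) (Plus (Read aLOAD (Reg rV)) (Read aOWN (Reg rI))) ;;
     incr rI"

definition degree_body :: com where
  "degree_body =
     Assign rDMAX (Plus (Reg rDMAX) (Minus (Read aDEG (Reg rI)) (Reg rDMAX))) ;;
     Assign rN2 (Plus (Reg rN2) (Reg rN)) ;;
     incr rI"

definition depth_cond :: exp where
  "depth_cond = Mini (Minus (Reg rME) (Reg rSQ)) (Minus (Reg rN2) (Reg rCUBE))"

text \<open>
Steps from \<open>D\<close> to \<open>D + 1\<close>, with the square and the cube updated by their binomial expansions.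
\<close>

definition depth_body :: com where
  "depth_body =
     Assign rCUBE (Plus (Reg rCUBE) (Plus (Plus (Reg rSQ) (Plus (Reg rSQ) (Reg rSQ)))
       (Plus (Plus (Reg rD) (Plus (Reg rD) (Reg rD))) (Const 1)))) ;;
     Assign rSQ (Plus (Reg rSQ) (Plus (Plus (Reg rD) (Reg rD)) (Const 1))) ;;
     incr rD"

text \<open>
Memory is initially zero, which spares the initialization of \<open>rI\<close>, \<open>rDMAX\<close>, \<open>rN2\<close> and the lists.
\<close>

definition prepare :: com where
  "prepare =
     (Assign rN (Read aIN (Const 0)) ;; Assign rME (Read aIN (Const 1)) ;;
      Assign rM (Plus (Reg rME) (Reg rME))) ;;
     While (Minus (Reg rM) (Reg rI)) edges_body ;;
     Assign rI (Const 0) ;;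
     While (Minus (Reg rM) (Reg rI)) lists_body ;;
     Assign rI (Const 0) ;;
     While (Minus (Reg rN) (Reg rI)) degree_body ;;
     (Assign rD (Const 1) ;; Assign rSQ (Const 1) ;; Assign rCUBE (Const 1)) ;;
     While depth_cond depth_body"

definition prepare_cost :: nat where
  "prepare_cost = len edges_body + len lists_body + len degree_body + len depth_body + 60"

definition mate :: "nat \<Rightarrow> nat \<Rightarrow> nat" where
  "mate m h = (if h < 2 * m then if even h then h + 1 else h - 1 else 0)"

text \<open>
The pointer to the last half-edge of \<open>v\<close> below \<open>i\<close>. It is what \<open>aFIRST\<close> contains after half-edges below
\<open>i\<close> have been prepended to the lists, and what \<open>aNEXT\<close> receives at \<open>i\<close>.
\<close>

primrec list_head :: "(nat \<Rightarrow> nat) \<Rightarrow> nat \<Rightarrow> nat \<Rightarrow> nat" where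
  "list_head tail v 0 = 0"
| "list_head tail v (Suc i) = (if tail i = v then Suc i else list_head tail v i)"

lemma list_head_le: "list_head tail v i \<le> i"
  by (induction i) auto

lemma list_head_tail: "list_head tail v i = 0 \<or> tail (list_head tail v i - 1) = v"
  by (induction i) auto

lemma list_head_gap: "list_head tail v i \<le> h \<Longrightarrow> h < i \<Longrightarrow> tail h \<noteq> v"
  by (induction i) (auto split: if_splits simp: less_Suc_eq)

text \<open>
The tails are those in memory, where cells that are never written contain \<open>0\<close>.
\<close>

locale encoded_graph = half_edge_graph n "2 * m" tail "mate m" for n m tail +
  fixes \<kappa> :: "nat \<Rightarrow> nat"
  assumes tail_beyond: "h \<ge> 2 * m \<Longrightarrow> tail h = 0"

sublocale encoded_graph \<subseteq> linked_graph n "2 * m" tail "mate m" "\<lambda>v. list_head tail v (2 * m)"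
    "\<lambda>h. if h < 2 * m then list_head tail (tail h) h else 0"
  by unfold_locales (use list_head_le list_head_tail list_head_gap in auto)

context encoded_graph
begin

definition max_deg :: nat where
  "max_deg = Max (insert 0 (deg ` {..<n}))"

definition start_own :: "nat \<Rightarrow> nat" where
  "start_own h = of_bool (h < 2 * m \<and> even h)"

lemma orientation_start_own: "orientation start_own"
  by (auto simp: orientation_def start_own_def mate_def elim!: oddE)

definition input_ok :: "state \<Rightarrow> bool" where
  "input_ok s \<longleftrightarrow> arr s aIN 0 = n \<and> arr s aIN 1 = m \<and> (\<forall>v<n. arr s aIN (2 + v) = \<kappa> v) \<and>
     (\<forall>h<2 * m. arr s aIN (2 + n + h) = tail h)"

definition edges_inv :: "state \<Rightarrow> bool" where
  "edges_inv s \<longleftrightarrow> reg s rN = n \<and> reg s rM = 2 * m \<and> even (reg s rI) \<and> reg s rI \<le> 2 * m \<and>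
     (\<forall>h<2 * m. arr s aIN (2 + n + h) = tail h) \<and>
     arr s aTAIL = (\<lambda>h. if h < reg s rI then tail h else 0) \<and>
     arr s aPAR = (\<lambda>h. if h < reg s rI then mate m h else 0) \<and>
     arr s aOWN = (\<lambda>h. of_bool (h < reg s rI \<and> even h))"

lemma edges_step:
  assumes "edges_inv s" "reg s rI < 2 * m"
  shows "edges_inv (exec edges_body s) \<and> reg (exec edges_body s) rI = reg s rI + 2"
proof -
  define i where "i = reg s rI"
  have i: "even i" "Suc i < 2 * m" using assms by (auto simp: edges_inv_def i_def elim!: evenE)
  have inp: "arr s aIN (Suc (Suc (n + i))) = tail i" "arr s aIN (3 + (n + i)) = tail (Suc i)"
  proof -
    have *: "\<And>h. h < 2 * m \<Longrightarrow> arr s aIN (2 + n + h) = tail h" using assms by (auto simp: edges_inv_def)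
    show "arr s aIN (Suc (Suc (n + i))) = tail i" using *[of i] i by simp
    show "arr s aIN (3 + (n + i)) = tail (Suc i)" using *[of "Suc i"] i by (simp add: eval_nat_numeral)
  qed
  have N: "reg s rN = n" using assms by (simp add: edges_inv_def)
  let ?s = "exec edges_body s"
  have lt: "h < Suc (Suc i) \<longleftrightarrow> h < i \<or> h = i \<or> h = Suc i" for h by auto
  have "arr ?s aTAIL = (\<lambda>h. if h < i + 2 then tail h else 0)"
    using assms inp N by (auto simp: edges_inv_def edges_body_def i_def[symmetric] fun_eq_iff lt)
  moreover have "arr ?s aPAR = (\<lambda>h. if h < i + 2 then mate m h else 0)"
    using assms N i by (auto simp: edges_inv_def edges_body_def i_def[symmetric] fun_eq_iff lt mate_def)
  moreover have "arr ?s aOWN = (\<lambda>h. of_bool (h < i + 2 \<and> even h))"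
    using assms N i by (auto simp: edges_inv_def edges_body_def i_def[symmetric] fun_eq_iff lt)
  moreover have "reg ?s rI = i + 2" "reg ?s rN = n" "reg ?s rM = 2 * m" "arr ?s aIN = arr s aIN"
    using assms by (simp_all add: edges_inv_def edges_body_def i_def)
  ultimately show ?thesis using assms i by (simp add: edges_inv_def i_def[symmetric])
qed

definition lists_inv :: "state \<Rightarrow> bool" where
  "lists_inv s \<longleftrightarrow> reg s rM = 2 * m \<and> reg s rI \<le> 2 * m \<and>
     arr s aTAIL = tail \<and> arr s aOWN = start_own \<and>
     arr s aFIRST = (\<lambda>v. list_head tail v (reg s rI)) \<and>
     arr s aNEXT = (\<lambda>h. if h < reg s rI then list_head tail (tail h) h else 0) \<and>
     arr s aDEG = (\<lambda>v. card {h. h < reg s rI \<and> tail h = v}) \<and>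
     arr s aLOAD = (\<lambda>v. \<Sum>h | h < reg s rI \<and> tail h = v. start_own h)"

lemma lists_step:
  assumes "lists_inv s" "reg s rI < 2 * m"
  shows "lists_inv (exec lists_body s) \<and> reg (exec lists_body s) rI = reg s rI + 1"
proof -
  define i where "i = reg s rI"
  let ?s = "exec lists_body s"
  have set: "{h. h < Suc i \<and> tail h = v} =
      (if tail i = v then insert i {h. h < i \<and> tail h = v} else {h. h < i \<and> tail h = v})" for v
    by (auto simp: less_Suc_eq)
  have T: "arr s aTAIL = tail" "arr s aOWN = start_own" using assms by (auto simp: lists_inv_def)
  note prog = lists_body_def incr_def i_def[symmetric] T
  have "arr ?s aFIRST = (arr s aFIRST)(tail i := i + 1)" by (simp add: prog)
  also have "\<dots> = (\<lambda>v. list_head tail v (i + 1))" using assms by (auto simp: lists_inv_def i_def)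
  finally have 1: "arr ?s aFIRST = (\<lambda>v. list_head tail v (i + 1))" .
  have "arr ?s aNEXT = (arr s aNEXT)(i := arr s aFIRST (tail i))" by (simp add: prog)
  also have "\<dots> = (\<lambda>h. if h < i + 1 then list_head tail (tail h) h else 0)"
    using assms by (auto simp: lists_inv_def i_def)
  finally have 2: "arr ?s aNEXT = (\<lambda>h. if h < i + 1 then list_head tail (tail h) h else 0)" .
  have "arr ?s aDEG = (arr s aDEG)(tail i := arr s aDEG (tail i) + 1)" by (simp add: prog)
  also have "\<dots> = (\<lambda>v. card {h. h < i + 1 \<and> tail h = v})"
    using assms by (auto simp: lists_inv_def i_def[symmetric] set)
  finally have 3: "arr ?s aDEG = (\<lambda>v. card {h. h < i + 1 \<and> tail h = v})" .
  have "arr ?s aLOAD = (arr s aLOAD)(tail i := arr s aLOAD (tail i) + start_own i)" by (simp add: prog)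
  also have "\<dots> = (\<lambda>v. \<Sum>h | h < i + 1 \<and> tail h = v. start_own h)"
    using assms by (auto simp: lists_inv_def i_def[symmetric] set)
  finally have 4: "arr ?s aLOAD = (\<lambda>v. \<Sum>h | h < i + 1 \<and> tail h = v. start_own h)" .
  have "reg ?s rI = i + 1" "reg ?s rM = 2 * m" "arr ?s aTAIL = tail" "arr ?s aOWN = start_own"
    using assms by (simp_all add: lists_inv_def lists_body_def incr_def i_def)
  then show ?thesis using 1 2 3 4 assms(2) by (simp add: lists_inv_def i_def[symmetric])
qed

definition degree_inv :: "state \<Rightarrow> bool" where
  "degree_inv s \<longleftrightarrow> reg s rN = n \<and> reg s rI \<le> n \<and> arr s aDEG = deg \<and>
     reg s rN2 = reg s rI * n \<and> reg s rDMAX = Max (insert 0 (deg ` {..<reg s rI}))"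

lemma degree_step:
  assumes "degree_inv s" "reg s rI < n"
  shows "degree_inv (exec degree_body s) \<and> reg (exec degree_body s) rI = reg s rI + 1"
proof -
  have "Max (insert 0 (deg ` {..<Suc i})) = max (deg i) (Max (insert 0 (deg ` {..<i})))" for i
  proof -
    have "insert 0 (deg ` {..<Suc i}) = insert (deg i) (insert 0 (deg ` {..<i}))"
      by (auto simp: lessThan_Suc)
    then show ?thesis by simp
  qed
  then show ?thesis using assms by (auto simp: degree_inv_def degree_body_def incr_def)
qed

definition depth_inv :: "state \<Rightarrow> bool" where
  "depth_inv s \<longleftrightarrow> reg s rME = m \<and> reg s rN2 = n^2 \<and> reg s rD \<ge> 1 \<and> reg s rSQ = (reg s rD)^2 \<and>
     reg s rCUBE = (reg s rD)^3 \<and>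
     (reg s rD = 1 \<or> (reg s rD - 1)^2 < m \<and> (reg s rD - 1)^3 < n^2)"

lemma depth_step:
  assumes "depth_inv s" "val s depth_cond \<noteq> 0"
  shows "depth_inv (exec depth_body s) \<and>
    m - reg (exec depth_body s) rSQ < m - reg s rSQ"
  using assms by (auto simp: depth_inv_def depth_cond_def depth_body_def incr_def
      power2_eq_square power3_eq_cube algebra_simps)

text \<open>
The first disjunction makes \<open>D\<close> large enough for \<open>small_cut\<close>, the second, that \<open>D\<close> is the least such
number, gives the time bound.
\<close>

definition prepared :: "state \<Rightarrow> bool" where
  "prepared s \<longleftrightarrow> check_pre \<kappa> (reg s rD) s \<and> reg s rD \<ge> 1 \<and> reg s rDMAX = max_deg \<and>
     (m \<le> (reg s rD)^2 \<or> n^2 \<le> (reg s rD)^3) \<and>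
     (reg s rD = 1 \<or> (reg s rD - 1)^2 < m \<and> (reg s rD - 1)^3 < n^2)"

lemma prepare_terminates:
  assumes init: "input_ok s" "\<And>r. reg s r = 0" "\<And>a i. a \<noteq> 0 \<Longrightarrow> arr s a i = 0"
  shows "terminates prepare s (prepare_cost * (n + 2 * m + 1)) prepared"
proof -
  define X where "X = n + 2 * m + 1"
  let ?Ta = "(len edges_body + 4) * X" and ?Tb = "(len lists_body + 4) * X"
    and ?Tc = "(len degree_body + 4) * X" and ?Td = "(len depth_body + 14) * X"
  have X: "X \<ge> 1" by (simp add: X_def)
  have Tx: "(l + 4) * (2 * m) + 4 \<le> (l + 4) * X" "(l + 4) * n + 4 \<le> (l + 4) * X" for l
    by (simp_all add: X_def algebra_simps)
  have Td: "(m - 1) * (len depth_body + cost depth_cond + 1) + cost depth_cond + 1 \<le> ?Td"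
  proof -
    have "(m - 1) * (len depth_body + cost depth_cond + 1) \<le> (m - 1) * (len depth_body + 14)"
      by (rule mult_left_mono) (simp_all add: depth_cond_def)
    moreover have "cost depth_cond + 1 \<le> len depth_body + 14" by (simp add: depth_cond_def)
    ultimately have "(m - 1) * (len depth_body + cost depth_cond + 1) + cost depth_cond + 1 \<le>
        (m - 1) * (len depth_body + 14) + (len depth_body + 14)" by linarith
    also have "\<dots> = (m - 1 + 1) * (len depth_body + 14)" by (simp add: algebra_simps)
    also have "\<dots> \<le> X * (len depth_body + 14)" by (rule mult_right_mono) (auto simp: X_def)
    finally show ?thesis by (simp add: mult.commute)
  qed
  have total: "10 + (?Ta + (2 + (?Tb + (2 + (?Tc + (6 + ?Td)))))) \<le> prepare_cost * (n + 2 * m + 1)"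
    using X unfolding X_def[symmetric] by (simp add: prepare_cost_def algebra_simps)
  let ?zero = "\<lambda>s. arr s aFIRST = (\<lambda>v. 0) \<and> arr s aNEXT = (\<lambda>v. 0) \<and> arr s aDEG = (\<lambda>v. 0) \<and>
    arr s aLOAD = (\<lambda>v. 0)"
  let ?zreg = "\<lambda>s. reg s rDMAX = 0 \<and> reg s rN2 = 0"
  let ?in = "\<lambda>s. reg s rN = n \<and> reg s rM = 2 * m \<and> reg s rME = m \<and> input_ok s"
  let ?graph = "\<lambda>s. env s \<and> arr s aOWN = start_own \<and> arr s aLOAD = load start_own"
  show ?thesis
    unfolding prepare_def
  proof (rule terminates_Seq[OF _ _ total])
    show "terminates (Assign rN (Read aIN (Const 0)) ;; Assign rME (Read aIN (Const 1)) ;;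
        Assign rM (Plus (Reg rME) (Reg rME))) s 10 (\<lambda>s. edges_inv s \<and> ?zero s \<and> ?zreg s \<and> ?in s)"
      using init by (intro terminates_straight) (auto simp: input_ok_def edges_inv_def fun_eq_iff)
    fix s1 assume s1: "edges_inv s1 \<and> ?zero s1 \<and> ?zreg s1 \<and> ?in s1"
    show "terminates (While (Minus (Reg rM) (Reg rI)) edges_body ;;
       Assign rI (Const 0) ;;
       While (Minus (Reg rM) (Reg rI)) lists_body ;;
       Assign rI (Const 0) ;;
       While (Minus (Reg rN) (Reg rI)) degree_body ;;
       (Assign rD (Const 1) ;; Assign rSQ (Const 1) ;; Assign rCUBE (Const 1)) ;;
       While depth_cond depth_body) s1 (?Ta + (2 + (?Tb + (2 + (?Tc + (6 + ?Td)))))) prepared"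
    proof (rule terminates_Seq[OF _ _ order_refl])
      have "terminates (While (Minus (Reg rM) (Reg rI)) edges_body) s1 ?Ta
          (\<lambda>s. edges_inv s \<and> reg s rM \<le> reg s rI)"
      proof (rule terminates_for)
        have "(len edges_body + 4) * (reg s1 rM - reg s1 rI) \<le> (len edges_body + 4) * (2 * m)"
          using s1 by (intro mult_left_mono) auto
        then show "(len edges_body + 4) * (reg s1 rM - reg s1 rI) + 4 \<le> ?Ta"
          using Tx(1)[of "len edges_body"] by linarith
        fix t assume t: "edges_inv t" "reg t rI < reg t rM"
        then have "reg t rM = 2 * m" by (simp add: edges_inv_def)
        then show "edges_inv (exec edges_body t) \<and>
            reg (exec edges_body t) rM - reg (exec edges_body t) rI < reg t rM - reg t rI"
          using edges_step[OF t(1)] t(2) by (auto simp: edges_inv_def)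
      qed (use s1 in \<open>auto simp: edges_body_def\<close>)
      then show "terminates (While (Minus (Reg rM) (Reg rI)) edges_body) s1 ?Ta
          (\<lambda>s. (edges_inv s \<and> reg s rI = 2 * m) \<and> ?zero s \<and> ?zreg s \<and> ?in s)"
        by (rule terminates_mono)
          (use s1 in \<open>auto simp: edges_inv_def same_def edges_body_def input_ok_def\<close>)
    next
      fix s2 assume s2: "(edges_inv s2 \<and> reg s2 rI = 2 * m) \<and> ?zero s2 \<and> ?zreg s2 \<and> ?in s2"
      have arrs: "arr s2 aTAIL = tail" "arr s2 aPAR = mate m" "arr s2 aOWN = start_own"
        using s2 tail_beyond by (auto simp: edges_inv_def fun_eq_iff mate_def start_own_def not_less)
      let ?tp = "\<lambda>s. arr s aPAR = mate m"
      show "terminates (Assign rI (Const 0) ;;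
         While (Minus (Reg rM) (Reg rI)) lists_body ;;
         Assign rI (Const 0) ;;
         While (Minus (Reg rN) (Reg rI)) degree_body ;;
         (Assign rD (Const 1) ;; Assign rSQ (Const 1) ;; Assign rCUBE (Const 1)) ;;
         While depth_cond depth_body) s2 (2 + (?Tb + (2 + (?Tc + (6 + ?Td))))) prepared"
      proof (rule terminates_Seq[OF _ _ order_refl])
        show "terminates (Assign rI (Const 0)) s2 2 (\<lambda>s. lists_inv s \<and> reg s rI = 0 \<and> ?zreg s \<and> ?in s \<and> ?tp s)"
          using s2 arrs by (intro terminates_straight) (auto simp: lists_inv_def input_ok_def)
        fix s3 assume s3: "lists_inv s3 \<and> reg s3 rI = 0 \<and> ?zreg s3 \<and> ?in s3 \<and> ?tp s3"
        show "terminates (While (Minus (Reg rM) (Reg rI)) lists_body ;;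
           Assign rI (Const 0) ;;
           While (Minus (Reg rN) (Reg rI)) degree_body ;;
           (Assign rD (Const 1) ;; Assign rSQ (Const 1) ;; Assign rCUBE (Const 1)) ;;
           While depth_cond depth_body) s3 (?Tb + (2 + (?Tc + (6 + ?Td)))) prepared"
        proof (rule terminates_Seq[OF _ _ order_refl])
          have "terminates (While (Minus (Reg rM) (Reg rI)) lists_body) s3 ?Tb
              (\<lambda>s. lists_inv s \<and> reg s rM \<le> reg s rI)"
          proof (rule terminates_for)
            show "(len lists_body + 4) * (reg s3 rM - reg s3 rI) + 4 \<le> ?Tb"
              using Tx(1)[of "len lists_body"] s3 by simp
            fix t assume t: "lists_inv t" "reg t rI < reg t rM"
            then have "reg t rM = 2 * m" by (simp add: lists_inv_def)
            then show "lists_inv (exec lists_body t) \<and>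
                reg (exec lists_body t) rM - reg (exec lists_body t) rI < reg t rM - reg t rI"
              using lists_step[OF t(1)] t(2) by (auto simp: lists_inv_def)
          qed (use s3 in \<open>auto simp: lists_body_def incr_def\<close>)
          then show "terminates (While (Minus (Reg rM) (Reg rI)) lists_body) s3 ?Tb
              (\<lambda>s. (lists_inv s \<and> reg s rI = 2 * m) \<and> ?zreg s \<and> ?in s \<and> ?tp s)"
            by (rule terminates_mono)
              (use s3 in \<open>auto simp: lists_inv_def same_def lists_body_def incr_def input_ok_def\<close>)
        next
          fix s4 assume s4: "(lists_inv s4 \<and> reg s4 rI = 2 * m) \<and> ?zreg s4 \<and> ?in s4 \<and> ?tp s4"
          have graph: "?graph s4"
            using s4 by (auto simp: lists_inv_def env_def deg_def[abs_def] load_def[abs_def])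
          show "terminates (Assign rI (Const 0) ;;
             While (Minus (Reg rN) (Reg rI)) degree_body ;;
             (Assign rD (Const 1) ;; Assign rSQ (Const 1) ;; Assign rCUBE (Const 1)) ;;
             While depth_cond depth_body) s4 (2 + (?Tc + (6 + ?Td))) prepared"
          proof (rule terminates_Seq[OF _ _ order_refl])
            show "terminates (Assign rI (Const 0)) s4 2
                (\<lambda>s. degree_inv s \<and> reg s rI = 0 \<and> ?graph s \<and> ?in s)"
              using s4 graph by (intro terminates_straight) (auto simp: degree_inv_def input_ok_def env_def)
            fix s5 assume s5: "degree_inv s5 \<and> reg s5 rI = 0 \<and> ?graph s5 \<and> ?in s5"
            show "terminates (While (Minus (Reg rN) (Reg rI)) degree_body ;;
               (Assign rD (Const 1) ;; Assign rSQ (Const 1) ;; Assign rCUBE (Const 1)) ;;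
               While depth_cond depth_body) s5 (?Tc + (6 + ?Td)) prepared"
            proof (rule terminates_Seq[OF _ _ order_refl])
              have "terminates (While (Minus (Reg rN) (Reg rI)) degree_body) s5 ?Tc
                  (\<lambda>s. degree_inv s \<and> reg s rN \<le> reg s rI)"
              proof (rule terminates_for)
                show "(len degree_body + 4) * (reg s5 rN - reg s5 rI) + 4 \<le> ?Tc"
                  using Tx(2)[of "len degree_body"] s5 by simp
                fix t assume t: "degree_inv t" "reg t rI < reg t rN"
                then have "reg t rN = n" by (simp add: degree_inv_def)
                then show "degree_inv (exec degree_body t) \<and>
                    reg (exec degree_body t) rN - reg (exec degree_body t) rI < reg t rN - reg t rI"
                  using degree_step[OF t(1)] t(2) by (auto simp: degree_inv_def)
              qed (use s5 in \<open>auto simp: degree_body_def incr_def\<close>)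
              then show "terminates (While (Minus (Reg rN) (Reg rI)) degree_body) s5 ?Tc
                  (\<lambda>s. reg s rDMAX = max_deg \<and> reg s rN2 = n^2 \<and> ?graph s \<and> ?in s)"
                by (rule terminates_mono)
                  (use s5 in \<open>auto simp: degree_inv_def same_def degree_body_def incr_def input_ok_def
                    env_def max_deg_def power2_eq_square\<close>)
            next
              fix s6 assume s6: "reg s6 rDMAX = max_deg \<and> reg s6 rN2 = n^2 \<and> ?graph s6 \<and> ?in s6"
              show "terminates ((Assign rD (Const 1) ;; Assign rSQ (Const 1) ;; Assign rCUBE (Const 1)) ;;
                 While depth_cond depth_body) s6 (6 + ?Td) prepared"
              proof (rule terminates_Seq[OF _ _ order_refl])
                show "terminates (Assign rD (Const 1) ;; Assign rSQ (Const 1) ;; Assign rCUBE (Const 1))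
                    s6 6 (\<lambda>s. (depth_inv s \<and> reg s rSQ = 1) \<and> reg s rDMAX = max_deg \<and> ?graph s \<and> ?in s)"
                  using s6 by (intro terminates_straight) (auto simp: depth_inv_def env_def input_ok_def)
                fix s7 assume s7: "(depth_inv s7 \<and> reg s7 rSQ = 1) \<and> reg s7 rDMAX = max_deg \<and> ?graph s7 \<and> ?in s7"
                have "terminates (While depth_cond depth_body) s7 ?Td
                    (\<lambda>s. depth_inv s \<and> val s depth_cond = 0)"
                proof (rule terminates_While_straight[where f = "\<lambda>s. m - reg s rSQ"])
                  show "(m - reg s7 rSQ) * (len depth_body + cost depth_cond + 1) + cost depth_cond + 1 \<le> ?Td"
                    using Td s7 by simp
                qed (use s7 depth_step in \<open>auto simp: depth_body_def incr_def\<close>)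
                then show "terminates (While depth_cond depth_body) s7 ?Td prepared"
                proof (rule terminates_mono)
                  fix s8 assume s8: "depth_inv s8 \<and> val s8 depth_cond = 0"
                    and same: "same (While depth_cond depth_body) s7 s8"
                  have "?graph s8 \<and> ?in s8 \<and> reg s8 rDMAX = max_deg"
                    using same s7 by (auto simp: same_def depth_body_def incr_def env_def input_ok_def)
                  then show "prepared s8"
                    using s8 orientation_start_own
                    by (auto simp: prepared_def check_pre_def depth_inv_def depth_cond_def input_ok_def)
                qed simp
              qed
            qed
          qed
        qed
      qed
    qed
  qed
qed

end


section \<open>Binary search\<close>

text \<open>
The midpoint \<open>rK\<close> is found by moving both ends inwards, one step at a time. This takes \<open>O(\<Delta>)\<close> steps,
less than the test that follows.
\<close>

definition search_body :: com where
  "search_body =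
     (Assign rA (Reg rLO) ;; Assign rK (Reg rHI)) ;;
     While (Minus (Reg rK) (Reg rA)) (incr rA ;; Assign rK (Minus (Reg rK) (Const 1))) ;;
     check ;;
     If (Reg rFLAG) (Assign rHI (Reg rK)) (Assign rLO (Plus (Reg rK) (Const 1)))"

text \<open>
The search counts the infeasible values in \<open>0..\<Delta>\<close>. If all \<open>\<Delta> + 1\<close> of them are infeasible, there is no
valid coloring and the result is \<open>0\<close>.
\<close>

definition star_program :: com where
  "star_program =
     prepare ;;
     (Assign rLO (Const 0) ;; Assign rHI (Plus (Reg rDMAX) (Const 1))) ;;
     While (Minus (Reg rHI) (Reg rLO)) search_body ;;
     If (Minus (Plus (Reg rDMAX) (Const 1)) (Reg rLO))
       (Assign 0 (Plus (Reg rLO) (Const 1)))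
       (Assign 0 (Const 0))"

definition star_cost :: nat where
  "star_cost = prepare_cost + check_cost + 100"

text \<open>
The length of the binary representation, which bounds the number of halvings.
\<close>

fun bits :: "nat \<Rightarrow> nat" where
  "bits x = (if x = 0 then 0 else Suc (bits (x div 2)))"

declare bits.simps [simp del]

lemma bits_mono: "x \<le> y \<Longrightarrow> bits x \<le> bits y"
proof (induction y arbitrary: x rule: less_induct)
  case (less y)
  show ?case
  proof (cases "x = 0")
    case True
    then show ?thesis by (simp add: bits.simps)
  next
    case False
    then have "bits (x div 2) \<le> bits (y div 2)"
      using less.prems by (intro less.IH div_le_mono) auto
    then show ?thesis using False less.prems by (simp add: bits.simps[of x] bits.simps[of y])
  qed
qed

lemma power_bits_le: "x > 0 \<Longrightarrow> 2 ^ bits x \<le> 2 * x"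
proof (induction x rule: less_induct)
  case (less x)
  show ?case
  proof (cases "x div 2 = 0")
    case True
    then show ?thesis using less.prems by (simp add: bits.simps[of x] bits.simps[of 0])
  next
    case False
    then have "2 ^ bits (x div 2) \<le> 2 * (x div 2)" using less.prems by (intro less.IH) auto
    then show ?thesis using less.prems by (simp add: bits.simps[of x])
  qed
qed

lemma check_frame:
  assumes "same check s s'" "r \<in> {rK, rLO, rHI, rDMAX}"
  shows "reg s' r = reg s r"
  by (rule same_reg[OF assms(1)])
    (use assms(2) in \<open>auto simp: check_def setup_body_def push_relabel_body_def augment_def
      augment_body_def bfs_reset_body_def bfs_body_def trace_body_def flip_def incr_def\<close>)

context linked_graph
begin

lemma cap_of_mono: "k \<le> k' \<Longrightarrow> cap_of \<kappa> k v \<le> cap_of \<kappa> k' v"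
  by (auto simp: cap_of_def min_def)

lemma feasible_mono: "k \<le> k' \<Longrightarrow> feasible (cap_of \<kappa> k) \<Longrightarrow> feasible (cap_of \<kappa> k')"
  unfolding feasible_def using cap_of_mono order_less_le_trans by blast

end

context encoded_graph
begin

lemma deg_le_max_deg: "v < n \<Longrightarrow> deg v \<le> max_deg"
  by (simp add: max_deg_def)

lemma max_deg_le: "max_deg \<le> 2 * m"
proof -
  have "deg v \<le> 2 * m" for v
    using card_mono[of "{..<2 * m}" "{h. h < 2 * m \<and> tail h = v}"] by (auto simp: deg_def)
  then show ?thesis by (auto simp: max_deg_def)
qed

text \<open>
From the maximum degree on, \<open>k\<close> no longer affects the bounds.
\<close>

lemma feasible_max_deg:
  assumes "feasible (cap_of \<kappa> k)"
  shows "feasible (cap_of \<kappa> max_deg)"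
proof (cases "k \<le> max_deg")
  case True
  then show ?thesis using feasible_mono assms by blast
next
  case False
  have "feasible (cap_of \<kappa> k) = feasible (cap_of \<kappa> max_deg)"
  proof (rule feasible_cong)
    fix v assume "v < n"
    then show "cap_of \<kappa> k v = cap_of \<kappa> max_deg v"
      using False deg_le_max_deg[of v] by (auto simp: cap_of_def min_def)
  qed
  then show ?thesis using assms by simp
qed

definition answer :: enat where
  "answer = (if \<exists>k. feasible (cap_of \<kappa> k) then enat (LEAST k. feasible (cap_of \<kappa> k)) else \<infinity>)"

definition search_inv :: "nat \<Rightarrow> state \<Rightarrow> bool" where
  "search_inv D s \<longleftrightarrow> prepared s \<and> reg s rD = D \<and> reg s rLO \<le> reg s rHI \<and> reg s rHI \<le> max_deg + 1 \<and>
     (\<forall>k<reg s rLO. \<not> feasible (cap_of \<kappa> k)) \<and>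
     (reg s rHI \<le> max_deg \<longrightarrow> feasible (cap_of \<kappa> (reg s rHI)))"

lemma answer_search:
  assumes "search_inv D s" "reg s rHI \<le> reg s rLO"
  shows "encode_result answer = (if reg s rLO \<le> max_deg then reg s rLO + 1 else 0)"
proof (cases "reg s rLO \<le> max_deg")
  case True
  then have "feasible (cap_of \<kappa> (reg s rLO))" "\<And>k. k < reg s rLO \<Longrightarrow> \<not> feasible (cap_of \<kappa> k)"
    using assms by (auto simp: search_inv_def)
  then have "(LEAST k. feasible (cap_of \<kappa> k)) = reg s rLO"
    by (intro Least_equality) (auto simp: not_less[symmetric])
  then show ?thesis
    using True \<open>feasible (cap_of \<kappa> (reg s rLO))\<close> by (auto simp: answer_def encode_result_def)
next
  case False
  then have "\<not> feasible (cap_of \<kappa> max_deg)" using assms by (auto simp: search_inv_def)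
  then have "\<not> (\<exists>k. feasible (cap_of \<kappa> k))" using feasible_max_deg by blast
  then show ?thesis using False by (auto simp: answer_def encode_result_def)
qed

lemma search_step:
  assumes inv: "search_inv D s" and lt: "reg s rLO < reg s rHI"
  shows "terminates search_body s ((check_cost + 40) * ((D + 1) * (n + 2 * m + 1)))
    (\<lambda>s'. search_inv D s' \<and> bits (reg s' rHI - reg s' rLO) < bits (reg s rHI - reg s rLO))"
proof -
  define Y where "Y = (D + 1) * (n + 2 * m + 1)"
  define lo where "lo = reg s rLO"
  define hi where "hi = reg s rHI"
  define mid where "mid = (lo + hi) div 2"
  have lohi: "lo < hi" "hi \<le> max_deg + 1" using inv lt by (auto simp: search_inv_def lo_def hi_def)
  have mid: "lo \<le> mid" "mid < hi" "mid \<le> max_deg" using lohi by (auto simp: mid_def)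
  have pre: "prepared s" "reg s rD = D" using inv by (auto simp: search_inv_def)
  have D: "D \<ge> 1" "2 * m \<le> 2 * D^2 \<or> n^2 \<le> D^3" using pre by (auto simp: prepared_def)
  let ?mid = "incr rA ;; Assign rK (Minus (Reg rK) (Const 1))"
  let ?keep = "\<lambda>s'. prepared s' \<and> reg s' rD = D \<and> reg s' rLO = lo \<and> reg s' rHI = hi"
  let ?post = "\<lambda>s'. search_inv D s' \<and> bits (reg s' rHI - reg s' rLO) < bits (reg s rHI - reg s rLO)"
  have half: "bits ((hi - lo) div 2) < bits (hi - lo)"
    using lohi by (simp add: bits.simps[of "hi - lo"])
  have "max_deg + 2 \<le> 2 * (n + 2 * m + 1)" using max_deg_le by simp
  also have "\<dots> \<le> 2 * Y" by (simp add: Y_def)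
  finally have Y: "max_deg + 2 \<le> 2 * Y" "Y \<ge> 1" by (simp_all add: Y_def)
  have total: "4 + (12 * (max_deg + 2) + (check_cost * Y + 6)) \<le> (check_cost + 40) * ((D + 1) * (n + 2 * m + 1))"
    using Y unfolding Y_def[symmetric] by (simp add: algebra_simps)
  show ?thesis
    unfolding search_body_def
  proof (rule terminates_Seq[OF _ _ total])
    show "terminates (Assign rA (Reg rLO) ;; Assign rK (Reg rHI)) s 4
        (\<lambda>s'. ?keep s' \<and> reg s' rA = lo \<and> reg s' rK = hi)"
      using pre lo_def hi_def
      by (intro terminates_straight) (auto simp: prepared_def check_pre_def env_def)
    fix s1 assume s1: "?keep s1 \<and> reg s1 rA = lo \<and> reg s1 rK = hi"
    show "terminates (While (Minus (Reg rK) (Reg rA)) ?mid ;; check ;;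
        If (Reg rFLAG) (Assign rHI (Reg rK)) (Assign rLO (Plus (Reg rK) (Const 1))))
        s1 (12 * (max_deg + 2) + (check_cost * Y + 6)) ?post"
    proof (rule terminates_Seq[OF _ _ order_refl])
      have "terminates (While (Minus (Reg rK) (Reg rA)) ?mid) s1 (12 * (max_deg + 2))
          (\<lambda>s. (?keep s \<and> reg s rA + reg s rK = lo + hi \<and> reg s rA \<le> reg s rK + 1) \<and> reg s rK \<le> reg s rA)"
      proof (rule terminates_for)
        have "hi - lo \<le> max_deg + 1" using lohi by simp
        then show "(len ?mid + 4) * (reg s1 rK - reg s1 rA) + 4 \<le> 12 * (max_deg + 2)"
          using s1 by (simp add: incr_def)
      qed (use s1 lohi in \<open>auto simp: incr_def prepared_def check_pre_def env_def\<close>)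
      then show "terminates (While (Minus (Reg rK) (Reg rA)) ?mid) s1 (12 * (max_deg + 2))
          (\<lambda>s. ?keep s \<and> reg s rK = mid)"
        by (rule terminates_mono) (auto simp: mid_def)
    next
      fix s2 assume s2: "?keep s2 \<and> reg s2 rK = mid"
      show "terminates (check ;;
          If (Reg rFLAG) (Assign rHI (Reg rK)) (Assign rLO (Plus (Reg rK) (Const 1))))
          s2 (check_cost * Y + 6) ?post"
      proof (rule terminates_Seq[OF _ _ order_refl])
        have "check_pre \<kappa> D s2" "reg s2 rK = mid" using s2 by (auto simp: prepared_def)
        from check_terminates[OF this D]
        show "terminates check s2 (check_cost * Y)
            (\<lambda>s. (?keep s \<and> reg s rK = mid) \<and> reg s rFLAG = of_bool (feasible (cap_of \<kappa> mid)))"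
        proof (rule terminates_mono)
          fix s3 assume s3: "check_pre \<kappa> D s3 \<and> reg s3 rFLAG = of_bool (feasible (cap_of \<kappa> mid))"
            and same: "same check s2 s3"
          have "reg s3 rK = mid" "reg s3 rLO = lo" "reg s3 rHI = hi" "reg s3 rDMAX = max_deg"
            using s2 check_frame[OF same] by (simp_all add: prepared_def)
          moreover have "reg s3 rD = D" using s3 by (simp add: check_pre_def)
          ultimately show "(?keep s3 \<and> reg s3 rK = mid) \<and> reg s3 rFLAG = of_bool (feasible (cap_of \<kappa> mid))"
            using s2 s3 by (auto simp: prepared_def)
        qed (simp add: Y_def)
      next
        fix s3 assume s3: "(?keep s3 \<and> reg s3 rK = mid) \<and> reg s3 rFLAG = of_bool (feasible (cap_of \<kappa> mid))"
        show "terminates (If (Reg rFLAG) (Assign rHI (Reg rK)) (Assign rLO (Plus (Reg rK) (Const 1))))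
            s3 6 ?post"
        proof (rule terminates_If[where Ta = 4])
          assume "val s3 (Reg rFLAG) \<noteq> 0"
          then have f: "feasible (cap_of \<kappa> mid)" using s3 by (auto split: if_splits)
          have "mid - lo = (hi - lo) div 2" using lohi by (auto simp: mid_def)
          then have "bits (mid - lo) < bits (hi - lo)" using half by simp
          then show "terminates (Assign rHI (Reg rK)) s3 4 ?post"
            using s3 f mid inv
            by (intro terminates_straight)
              (auto simp: search_inv_def prepared_def check_pre_def env_def lo_def hi_def)
        next
          assume "val s3 (Reg rFLAG) = 0"
          then have f: "\<not> feasible (cap_of \<kappa> mid)" using s3 by (auto split: if_splits)
          then have f': "\<not> feasible (cap_of \<kappa> k)" if "k < Suc mid" for k
            using feasible_mono[of k mid] that by auto
          have "hi - Suc mid \<le> (hi - lo) div 2" using lohi by (auto simp: mid_def)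
          then have "bits (hi - Suc mid) < bits (hi - lo)" using half bits_mono le_less_trans by blast
          then show "terminates (Assign rLO (Plus (Reg rK) (Const 1))) s3 4 ?post"
            using s3 f' mid inv
            by (intro terminates_straight)
              (auto simp: search_inv_def prepared_def check_pre_def env_def lo_def hi_def)
        qed simp
      qed
    qed
  qed
qed

text \<open>
The number \<open>D\<close> is computed by the program, so the bound is stated with the property that defines it.
\<close>

lemma star_program_terminates:
  assumes init: "input_ok s" "\<And>r. reg s r = 0" "\<And>a i. a \<noteq> 0 \<Longrightarrow> arr s a i = 0"
  obtains D where "D = 1 \<or> (D - 1)^2 < m \<and> (D - 1)^3 < n^2"
    "terminates star_program s (star_cost * ((bits (max_deg + 1) + 1) * ((D + 1) * (n + 2 * m + 1))))
      (\<lambda>s'. reg s' 0 = encode_result answer)"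
proof -
  obtain t s1 where t: "run prepare s t s1" "t \<le> prepare_cost * (n + 2 * m + 1)" "prepared s1"
    using prepare_terminates[OF init] by (auto simp: terminates_def)
  define D where "D = reg s1 rD"
  define B where "B = bits (max_deg + 1)"
  define Y where "Y = (D + 1) * (n + 2 * m + 1)"
  let ?post = "\<lambda>s'. reg s' 0 = encode_result answer"
  have Y: "n + 2 * m + 1 \<le> Y" "Y \<ge> 1" by (simp_all add: Y_def)
  let ?Tp = "prepare_cost * (n + 2 * m + 1)" and ?Ts = "B * ((check_cost + 40) * Y + 4) + 4"
  have total: "?Tp + (6 + (?Ts + 10)) \<le> star_cost * ((B + 1) * Y)"
  proof -
    have "?Tp \<le> prepare_cost * Y" using Y(1) by (rule mult_left_mono) simp
    moreover have "B * 1 \<le> B * Y" using Y(2) by (rule mult_left_mono) simp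
    moreover have "star_cost * ((B + 1) * Y) = prepare_cost * (B * Y) + prepare_cost * Y +
        check_cost * (B * Y) + check_cost * Y + 100 * (B * Y) + 100 * Y"
      by (simp add: star_cost_def algebra_simps)
    moreover have "?Ts = check_cost * (B * Y) + 40 * (B * Y) + 4 * B + 4"
      by (simp add: algebra_simps)
    ultimately show ?thesis using Y(2) by linarith
  qed
  have "terminates star_program s (star_cost * ((B + 1) * Y)) ?post"
    unfolding star_program_def
  proof (rule terminates_Seq[OF _ _ total])
    show "terminates prepare s ?Tp (\<lambda>s. prepared s \<and> reg s rD = D)"
      using t by (auto simp: terminates_def D_def)
    fix s1 assume s1: "prepared s1 \<and> reg s1 rD = D"
    show "terminates ((Assign rLO (Const 0) ;; Assign rHI (Plus (Reg rDMAX) (Const 1))) ;;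
       While (Minus (Reg rHI) (Reg rLO)) search_body ;;
       If (Minus (Plus (Reg rDMAX) (Const 1)) (Reg rLO))
         (Assign 0 (Plus (Reg rLO) (Const 1)))
         (Assign 0 (Const 0))) s1 (6 + (?Ts + 10)) ?post"
    proof (rule terminates_Seq[OF _ _ order_refl])
      show "terminates (Assign rLO (Const 0) ;; Assign rHI (Plus (Reg rDMAX) (Const 1))) s1 6
          (\<lambda>s. search_inv D s \<and> bits (reg s rHI - reg s rLO) = B)"
        using s1 by (intro terminates_straight)
          (auto simp: search_inv_def prepared_def check_pre_def env_def B_def)
      fix s2 assume s2: "search_inv D s2 \<and> bits (reg s2 rHI - reg s2 rLO) = B"
      show "terminates (While (Minus (Reg rHI) (Reg rLO)) search_body ;;
         If (Minus (Plus (Reg rDMAX) (Const 1)) (Reg rLO))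
           (Assign 0 (Plus (Reg rLO) (Const 1)))
           (Assign 0 (Const 0))) s2 (?Ts + 10) ?post"
      proof (rule terminates_Seq[OF _ _ order_refl])
        show "terminates (While (Minus (Reg rHI) (Reg rLO)) search_body) s2 ?Ts
            (\<lambda>s. search_inv D s \<and> val s (Minus (Reg rHI) (Reg rLO)) = 0)"
          by (rule terminates_While[where f = "\<lambda>s. bits (reg s rHI - reg s rLO)" and
                c = "(check_cost + 40) * Y"])
            (use s2 search_step in \<open>auto simp: Y_def algebra_simps\<close>)
      next
        fix s3 assume s3: "search_inv D s3 \<and> val s3 (Minus (Reg rHI) (Reg rLO)) = 0"
        then have "encode_result answer = (if reg s3 rLO \<le> max_deg then reg s3 rLO + 1 else 0)"
            using answer_search[of D s3] by simp
        moreover have "reg s3 rDMAX = max_deg" using s3 by (simp add: search_inv_def prepared_def)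
        ultimately show "terminates (If (Minus (Plus (Reg rDMAX) (Const 1)) (Reg rLO))
           (Assign 0 (Plus (Reg rLO) (Const 1))) (Assign 0 (Const 0))) s3 10 ?post"
          by (intro terminates_straight) auto
      qed
    qed
  qed
  moreover have "D = 1 \<or> (D - 1)^2 < m \<and> (D - 1)^3 < n^2"
    using t by (simp add: prepared_def D_def)
  ultimately show ?thesis using that by (simp add: B_def Y_def)
qed

end


section \<open>Star colorings as orientations\<close>

lemma nth_concat_pairs:
  "i < 2 * length es \<Longrightarrow> concat (map (\<lambda>(i, j). [i, j]) es) ! i =
    (if even i then fst (es ! (i div 2)) else snd (es ! (i div 2)))"
proof (induction es arbitrary: i)
  case (Cons e es)
  consider "i = 0" | "i = 1" | j where "i = Suc (Suc j)"
    by (metis One_nat_def not0_implies_Suc)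
  then show ?case
  proof cases
    case 3
    then show ?thesis using Cons by (simp add: case_prod_beta)
  qed (auto simp: case_prod_beta)
qed simp

lemma length_concat_pairs: "length (concat (map (\<lambda>(i, j). [i, j]) es)) = 2 * length es"
  by (induction es) auto

text \<open>
The endpoint at half-edge \<open>h\<close>, as a node number, in the layout that \<open>edges_body\<close> produces.
\<close>

definition half_edge_tail :: "(nat \<times> nat) list \<Rightarrow> nat \<Rightarrow> nat" where
  "half_edge_tail es h = (if h < 2 * length es then
     if even h then fst (es ! (h div 2)) else snd (es ! (h div 2)) else 0)"

locale encoded_star_graph =
  fixes V :: "nat set" and E :: "nat set set" and \<kappa> :: "nat \<Rightarrow> nat"
    and vs :: "nat list" and es :: "(nat \<times> nat) list"
  assumes graph: "simple_graph V E" and nonempty: "V \<noteq> {}"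
    and vs: "distinct vs" "set vs = V"
    and es_less: "\<forall>(i, j)\<in>set es. i < length vs \<and> j < length vs"
    and es_distinct: "distinct (map (\<lambda>(i, j). {vs ! i, vs ! j}) es)"
    and es_set: "set (map (\<lambda>(i, j). {vs ! i, vs ! j}) es) = E"
begin

abbreviation "m \<equiv> length es"
abbreviation "n \<equiv> length vs"
abbreviation "tail \<equiv> half_edge_tail es"

definition edge :: "nat \<Rightarrow> nat set" where
  "edge h = {vs ! tail h, vs ! tail (mate m h)}"

lemma mate_less: "h < 2 * m \<Longrightarrow> mate m h < 2 * m"
  by (auto simp: mate_def elim!: evenE)

lemma mate_mate: "h < 2 * m \<Longrightarrow> mate m (mate m h) = h"
  by (auto simp: mate_def elim!: evenE oddE)

lemma same_div: "h < 2 * m \<Longrightarrow> g div 2 = h div 2 \<Longrightarrow> g = h \<or> g = mate m h"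
  unfolding mate_def by (cases "even h"; cases "even g") (auto elim!: evenE oddE)

lemma edge_nth: "h < 2 * m \<Longrightarrow> edge h = map (\<lambda>(i, j). {vs ! i, vs ! j}) es ! (h div 2)"
  by (auto simp: edge_def half_edge_tail_def mate_def case_prod_beta elim!: evenE oddE)

lemma edge_in: "h < 2 * m \<Longrightarrow> edge h \<in> E"
  unfolding es_set[symmetric] edge_nth by (rule nth_mem) auto

lemma tail_n: "h < 2 * m \<Longrightarrow> tail h < n"
  using es_less nth_mem[of "h div 2" es]
  by (fastforce simp: half_edge_tail_def case_prod_beta)

lemma edge_eq: "h < 2 * m \<Longrightarrow> g < 2 * m \<Longrightarrow> edge g = edge h \<longleftrightarrow> g = h \<or> g = mate m h"
proof
  assume h: "h < 2 * m" "g < 2 * m" and "edge g = edge h"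
  then have "g div 2 = h div 2"
    using nth_eq_iff_index_eq[OF es_distinct, of "g div 2" "h div 2"] by (auto simp: edge_nth)
  then show "g = h \<or> g = mate m h" using same_div h by blast
next
  assume "h < 2 * m" "g < 2 * m" "g = h \<or> g = mate m h"
  then show "edge g = edge h" using mate_mate by (auto simp: edge_def)
qed

lemma edges: "E = edge ` {..<2 * m}"
proof
  show "E \<subseteq> edge ` {..<2 * m}"
  proof
    fix e assume "e \<in> E"
    then obtain j where "j < m" "e = map (\<lambda>(i, j). {vs ! i, vs ! j}) es ! j"
      unfolding es_set[symmetric] by (auto simp: in_set_conv_nth)
    then have "e = edge (2 * j)" "2 * j < 2 * m" by (auto simp: edge_nth)
    then show "e \<in> edge ` {..<2 * m}" by blast
  qed
qed (use edge_in in auto)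

lemma tail_mate_neq: "h < 2 * m \<Longrightarrow> tail (mate m h) \<noteq> tail h"
proof
  assume h: "h < 2 * m" and "tail (mate m h) = tail h"
  then have "card (edge h) = 1" by (simp add: edge_def)
  then show False using edge_in[OF h] graph by (auto simp: simple_graph_def)
qed

lemma nth_tail_eq: "h < 2 * m \<Longrightarrow> v < n \<Longrightarrow> vs ! tail h = vs ! v \<longleftrightarrow> tail h = v"
  using nth_eq_iff_index_eq[OF vs(1)] tail_n by blast

sublocale encoded_graph n m tail "\<lambda>v. \<kappa> (vs ! v)"
proof
  show "inj_on (\<lambda>h. (tail h, tail (mate m h))) {..<2 * m}"
  proof (rule inj_onI)
    fix g h assume gh: "g \<in> {..<2 * m}" "h \<in> {..<2 * m}"
      and eq: "(tail g, tail (mate m g)) = (tail h, tail (mate m h))"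
    then have "edge g = edge h" by (simp add: edge_def)
    then have "g = h \<or> g = mate m h" using gh edge_eq by simp
    then show "g = h" using eq tail_mate_neq gh by auto
  qed
qed (use mate_less mate_mate tail_n tail_mate_neq in \<open>auto simp: half_edge_tail_def\<close>)

definition halves :: "nat \<Rightarrow> nat set" where
  "halves v = {h. h < 2 * m \<and> tail h = v}"

lemma in_edge: "h < 2 * m \<Longrightarrow> v < n \<Longrightarrow> vs ! v \<in> edge h \<longleftrightarrow> h \<in> halves v \<or> mate m h \<in> halves v"
  using nth_tail_eq[of h v] nth_tail_eq[of "mate m h" v] mate_less[of h]
  by (auto simp: edge_def halves_def)

lemma edge_mate: "h < 2 * m \<Longrightarrow> edge (mate m h) = edge h"
  using edge_eq[of h "mate m h"] mate_less by blast

lemma incident: "v < n \<Longrightarrow> {e \<in> E. vs ! v \<in> e} = edge ` halves v"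
proof
  assume v: "v < n"
  show "{e \<in> E. vs ! v \<in> e} \<subseteq> edge ` halves v"
  proof
    fix e assume "e \<in> {e \<in> E. vs ! v \<in> e}"
    then obtain h where h: "h < 2 * m" "e = edge h" "vs ! v \<in> edge h" by (auto simp: edges)
    then consider "h \<in> halves v" | "mate m h \<in> halves v" using in_edge[OF _ v] by blast
    then show "e \<in> edge ` halves v"
      by cases (use h edge_mate[OF h(1)] in \<open>auto intro: rev_image_eqI\<close>)
  qed
  show "edge ` halves v \<subseteq> {e \<in> E. vs ! v \<in> e}"
    using in_edge[OF _ v] edge_in by (auto simp: halves_def)
qed

lemma inj_edge_at: "inj_on edge (halves v)"
proof (rule inj_onI)
  fix g h assume gh: "g \<in> halves v" "h \<in> halves v" and "edge g = edge h"
  then have "g = h \<or> g = mate m h" using edge_eq by (simp add: halves_def)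
  then show "g = h" using tail_mate_neq[of h] gh by (auto simp: halves_def)
qed

lemma degree_deg: "v < n \<Longrightarrow> degree E (vs ! v) = deg v"
  using card_image[OF inj_edge_at] by (simp add: degree_def incident deg_def halves_def)

lemma V_nth: "V = (\<lambda>v. vs ! v) ` {..<n}"
  using vs by (auto simp: set_conv_nth)

lemma n_pos: "n > 0"
  using nonempty vs by auto

lemma max_degree_eq: "max_degree V E = max_deg"
proof -
  have "degree E ` V = deg ` {..<n}" unfolding V_nth image_image by (intro image_cong) (auto simp: degree_deg)
  moreover have "Max (insert 0 (deg ` {..<n})) = Max (deg ` {..<n})"
    using n_pos by (subst Max_insert) auto
  ultimately show ?thesis by (simp add: max_degree_def max_deg_def)
qed

text \<open>
The orientation that belongs to a star coloring. Its loads count the colors of other nodes.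
\<close>

definition foreign :: "(nat \<Rightarrow> nat) \<Rightarrow> (nat set \<Rightarrow> nat) \<Rightarrow> nat \<Rightarrow> nat" where
  "foreign c C h = of_bool (C (edge h) = c (vs ! tip h))"

lemma c_tip_neq:
  assumes "inj_on c V" "h < 2 * m"
  shows "c (vs ! tip h) \<noteq> c (vs ! tail h)"
proof
  assume "c (vs ! tip h) = c (vs ! tail h)"
  moreover have "vs ! tip h \<in> V" "vs ! tail h \<in> V"
    using vs(2) tail_n[OF assms(2)] tail_n[OF mate_less[OF assms(2)]] by auto
  ultimately have "vs ! tip h = vs ! tail h" using assms(1) by (simp add: inj_on_eq_iff)
  then have "tip h = tail h"
    using nth_tail_eq[OF mate_less[OF assms(2)] tail_n[OF assms(2)]] by simp
  then show False using tail_mate_neq[OF assms(2)] by simp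
qed

lemma orientation_foreign:
  assumes "star_coloring V E c C"
  shows "orientation (foreign c C)"
  unfolding orientation_def
proof (intro allI impI)
  fix h assume h: "h < 2 * m"
  have "C (edge h) = c (vs ! tail h) \<or> C (edge h) = c (vs ! tip h)"
    using assms edge_in[OF h] by (fastforce simp: star_coloring_def edge_def)
  moreover have "c (vs ! tip h) \<noteq> c (vs ! tail h)"
    using c_tip_neq[of c, OF _ h] assms by (simp add: star_coloring_def)
  ultimately show "foreign c C h + foreign c C (mate m h) = 1"
    using edge_mate[OF h] mate_mate[OF h] by (auto simp: foreign_def)
qed

text \<open>
The owned edges have pairwise distinct colors, as their other endpoints are distinct in a simple graph.
The remaining edges share the color of the node itself.
\<close>

lemma colors_at_load:
  assumes sc: "star_coloring V E c C" and v: "v < n"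
  shows "colors_at E C (vs ! v) = load (foreign c C) v + of_bool (load (foreign c C) v < deg v)"
proof -
  have inj: "inj_on c V" using sc by (simp add: star_coloring_def)
  define A where "A = {h \<in> halves v. C (edge h) = c (vs ! tip h)}"
  have fin: "finite (halves v)" by (simp add: halves_def)
  have load: "load (foreign c C) v = card A"
  proof -
    have "load (foreign c C) v = (\<Sum>h\<in>halves v. of_bool (C (edge h) = c (vs ! tip h)))"
      unfolding load_def halves_def foreign_def ..
    also have "\<dots> = (\<Sum>h\<in>A. 1)"
      unfolding A_def using fin by (intro sum.mono_neutral_cong_right) auto
    finally show ?thesis by simp
  qed
  have "colors_at E C (vs ! v) = card (C ` {e \<in> E. vs ! v \<in> e})"
    unfolding colors_at_def by (rule arg_cong[where f = card]) auto
  also have "C ` {e \<in> E. vs ! v \<in> e} = (\<lambda>h. C (edge h)) ` halves v"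
    by (simp add: incident[OF v] image_image)
  also have "\<dots> = (\<lambda>h. c (vs ! tip h)) ` A \<union> (if A = halves v then {} else {c (vs ! v)})"
  proof -
    have "C (edge h) = c (vs ! v)" if "h \<in> halves v - A" for h
      using that sc edge_in[of h] by (fastforce simp: A_def halves_def star_coloring_def edge_def)
    moreover have "A \<subseteq> halves v" by (auto simp: A_def)
    moreover have "C (edge h) = c (vs ! tip h)" if "h \<in> A" for h using that by (simp add: A_def)
    ultimately show ?thesis by (auto simp: image_iff) (metis DiffI subsetD)+
  qed
  also have "card \<dots> = card ((\<lambda>h. c (vs ! tip h)) ` A) + card (if A = halves v then {} else {c (vs ! v)})"
  proof (rule card_Un_disjoint)
    have "c (vs ! v) \<notin> (\<lambda>h. c (vs ! tip h)) ` A"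
    proof
      assume "c (vs ! v) \<in> (\<lambda>h. c (vs ! tip h)) ` A"
      then obtain h where "h \<in> A" "c (vs ! v) = c (vs ! tip h)" by (rule imageE)
      then show False using c_tip_neq[OF inj, of h] by (simp add: A_def halves_def)
    qed
    then show "(\<lambda>h. c (vs ! tip h)) ` A \<inter> (if A = halves v then {} else {c (vs ! v)}) = {}" by simp
  qed (use fin in \<open>auto simp: A_def\<close>)
  also have "card ((\<lambda>h. c (vs ! tip h)) ` A) = card A"
  proof (rule card_image, rule inj_onI)
    fix g h assume gh: "g \<in> A" "h \<in> A" "c (vs ! tip g) = c (vs ! tip h)"
    then have M: "g < 2 * m" "h < 2 * m" "tail g = tail h" by (auto simp: A_def halves_def)
    then have "vs ! tip g = vs ! tip h"
      using inj_onD[OF inj gh(3)] vs tail_n mate_less by auto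
    then have "tip g = tip h" using nth_tail_eq[OF mate_less] tail_n mate_less M by blast
    then show "g = h" using inj_onD[OF simple, of g h] M by simp
  qed
  also have "card (if A = halves v then {} else {c (vs ! v)}) = of_bool (card A < deg v)"
  proof -
    have "A \<subseteq> halves v" by (auto simp: A_def)
    then have "card A < card (halves v) \<longleftrightarrow> A \<noteq> halves v"
      using fin by (metis less_irrefl psubsetI psubset_card_mono)
    then show ?thesis by (simp add: deg_def halves_def)
  qed
  finally show ?thesis by (simp add: load)
qed

lemma load_le_deg: "orientation own \<Longrightarrow> load own v \<le> deg v"
proof -
  assume "orientation own"
  then have "load own v \<le> (\<Sum>h | h < 2 * m \<and> tail h = v. 1)"
    unfolding load_def by (intro sum_mono) (use own_cases in fastforce)
  then show ?thesis by (simp add: deg_def)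
qed

text \<open>
Nodes are natural numbers here and can serve as their own colors. Each edge takes the color of the
endpoint that does not own it.
\<close>

lemma star_coloring_of_orientation:
  assumes own: "orientation own"
  obtains C where "star_coloring V E id C" "\<And>v. load (foreign id C) v = load own v"
proof -
  define owner where "owner e = (SOME h. h < 2 * m \<and> edge h = e \<and> own h = 1)" for e
  define C where "C e = vs ! tip (owner e)" for e
  have owner: "owner (edge h) = (if own h = 1 then h else mate m h)" if h: "h < 2 * m" for h
    unfolding owner_def
  proof (rule some_equality)
    show "(if own h = 1 then h else mate m h) < 2 * m \<and> edge (if own h = 1 then h else mate m h) = edge h \<and>
        own (if own h = 1 then h else mate m h) = 1"
      using own_cases[OF own h] own_par[OF own h] h mate_less edge_mate by auto
    fix g assume g: "g < 2 * m \<and> edge g = edge h \<and> own g = 1"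
    then have "g = h \<or> g = mate m h" using edge_eq h by blast
    then show "g = (if own h = 1 then h else mate m h)"
      using g own_par[OF own h] by auto
  qed
  have C: "C (edge h) = (if own h = 1 then vs ! tip h else vs ! tail h)" if "h < 2 * m" for h
    using owner[OF that] mate_mate[OF that] by (simp add: C_def)
  have "star_coloring V E id C"
    unfolding star_coloring_def edges using C by (auto simp: edge_def)
  moreover have "foreign id C h = own h" if h: "h < 2 * m" for h
    using C[OF h] own_cases[OF own h] c_tip_neq[of id h] h by (auto simp: foreign_def)
  then have "load (foreign id C) v = load own v" for v
    unfolding load_def by (intro sum.cong) auto
  ultimately show ?thesis using that by blast
qed

text \<open>
If \<open>deg v \<le> min k (\<kappa> v)\<close>, both conditions at \<open>v\<close> always hold. Otherwise both say that the load is below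
\<open>min k (\<kappa> v)\<close>, since a load equal to the degree is excluded.
\<close>

lemma feasible_iff_coloring:
  "feasible (cap_of (\<lambda>v. \<kappa> (vs ! v)) k) \<longleftrightarrow>
    (\<exists>c C. valid_star_coloring V E \<kappa> c C \<and> max_colors V E C \<le> k)"
proof -
  have fits: "valid_star_coloring V E \<kappa> c C \<and> max_colors V E C \<le> k \<longleftrightarrow>
      (\<forall>v<n. load (foreign c C) v < cap_of (\<lambda>v. \<kappa> (vs ! v)) k v)"
    if sc: "star_coloring V E c C" for c C
  proof -
    have "finite (colors_at E C ` V)" "colors_at E C ` V \<noteq> {}" using nonempty vs by auto
    then have "valid_star_coloring V E \<kappa> c C \<and> max_colors V E C \<le> k \<longleftrightarrow>
        (\<forall>x\<in>V. colors_at E C x \<le> \<kappa> x \<and> colors_at E C x \<le> k)"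
      using sc by (auto simp: valid_star_coloring_def max_colors_def)
    also have "\<dots> \<longleftrightarrow> (\<forall>v<n. colors_at E C (vs ! v) \<le> min k (\<kappa> (vs ! v)))"
      unfolding V_nth by auto
    also have "\<dots> \<longleftrightarrow> (\<forall>v<n. load (foreign c C) v < cap_of (\<lambda>v. \<kappa> (vs ! v)) k v)"
    proof (intro all_cong)
      fix v assume "v < n"
      show "colors_at E C (vs ! v) \<le> min k (\<kappa> (vs ! v)) \<longleftrightarrow>
          load (foreign c C) v < cap_of (\<lambda>v. \<kappa> (vs ! v)) k v"
        using load_le_deg[OF orientation_foreign[OF sc], of v]
        unfolding colors_at_load[OF sc \<open>v < n\<close>] cap_of_def by (auto simp: of_bool_def)
    qed
    finally show ?thesis .
  qed
  show ?thesis
  proof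
    assume "feasible (cap_of (\<lambda>v. \<kappa> (vs ! v)) k)"
    then obtain own where own: "orientation own" "\<forall>v<n. load own v < cap_of (\<lambda>v. \<kappa> (vs ! v)) k v"
      by (auto simp: feasible_def)
    obtain C where "star_coloring V E id C" "\<And>v. load (foreign id C) v = load own v"
      using star_coloring_of_orientation[OF own(1)] by blast
    then show "\<exists>c C. valid_star_coloring V E \<kappa> c C \<and> max_colors V E C \<le> k"
      using fits own(2) by metis
  next
    assume "\<exists>c C. valid_star_coloring V E \<kappa> c C \<and> max_colors V E C \<le> k"
    then obtain c C where cC: "valid_star_coloring V E \<kappa> c C \<and> max_colors V E C \<le> k" by blast
    then have "star_coloring V E c C" by (simp add: valid_star_coloring_def)
    then show "feasible (cap_of (\<lambda>v. \<kappa> (vs ! v)) k)"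
      using fits cC orientation_foreign unfolding feasible_def by blast
  qed
qed

lemma min_star_colors_answer: "min_star_colors V E \<kappa> = answer"
proof (cases "\<exists>k. feasible (cap_of (\<lambda>v. \<kappa> (vs ! v)) k)")
  case False
  then have "\<not> valid_star_coloring V E \<kappa> c C" for c C
    using feasible_iff_coloring by blast
  then show ?thesis using False by (auto simp: min_star_colors_def answer_def top_enat_def)
next
  case True
  define k where "k = (LEAST k. feasible (cap_of (\<lambda>v. \<kappa> (vs ! v)) k))"
  have k: "feasible (cap_of (\<lambda>v. \<kappa> (vs ! v)) k)" using True unfolding k_def by (rule LeastI_ex)
  have least: "k \<le> max_colors V E C" if "valid_star_coloring V E \<kappa> c C" for c C
    unfolding k_def using that feasible_iff_coloring by (intro Least_le) blast
  obtain c C where cC: "valid_star_coloring V E \<kappa> c C" "max_colors V E C \<le> k"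
    using k feasible_iff_coloring by blast
  have "min_star_colors V E \<kappa> = enat k"
    unfolding min_star_colors_def
  proof (rule Inf_eqI)
    show "enat k \<le> x" if "x \<in> {enat (max_colors V E C) |c C. valid_star_coloring V E \<kappa> c C}" for x
      using that least by auto
    show "y \<le> enat k"
      if "\<And>x. x \<in> {enat (max_colors V E C) |c C. valid_star_coloring V E \<kappa> c C} \<Longrightarrow> y \<le> x" for y
    proof -
      have "y \<le> enat (max_colors V E C)" using that cC(1) by blast
      also have "\<dots> \<le> enat k" using cC(2) by simp
      finally show ?thesis .
    qed
  qed
  then show ?thesis using True by (simp add: answer_def k_def)
qed

end


section \<open>The running time\<close>

context encoded_star_graph
begin

lemma card_V: "card V = n" and card_E: "card E = m"
proof -
  show "card V = n" using vs distinct_card by metis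
  have "card (set (map (\<lambda>(i, j). {vs ! i, vs ! j}) es)) = m"
    by (subst distinct_card[OF es_distinct]) simp
  then show "card E = m" unfolding es_set .
qed

lemma no_isolated_node:
  assumes con: "connected_graph V E" and n: "n \<ge> 2"
  shows "n \<le> 2 * m"
proof -
  have "deg v \<ge> 1" if v: "v < n" for v
  proof -
    obtain u where u: "u < n" "u \<noteq> v"
    proof (cases "v = 0")
      case True
      then show ?thesis using that[of 1] n by auto
    next
      case False
      then show ?thesis using that[of 0] n_pos by auto
    qed
    have "(vs ! v, vs ! u) \<in> {(a, b). {a, b} \<in> E}\<^sup>*"
      using con u v vs(2) by (auto simp: connected_graph_def)
    moreover have "vs ! v \<noteq> vs ! u" using u v vs(1) by (simp add: nth_eq_iff_index_eq)
    ultimately obtain b where "{vs ! v, b} \<in> E" by (auto elim: converse_rtranclE)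
    then have "{vs ! v, b} \<in> edge ` halves v" using incident[OF v] by blast
    then have "halves v \<noteq> {}" by auto
    moreover have "finite (halves v)" by (simp add: halves_def)
    ultimately have "card (halves v) \<ge> 1" by (simp add: Suc_le_eq card_gt_0_iff)
    then show ?thesis by (simp add: deg_def halves_def)
  qed
  then have "(\<Sum>v<n. 1) \<le> (\<Sum>v<n. deg v)" by (intro sum_mono) auto
  then show ?thesis using sum_deg by simp
qed

text \<open>
With maximum degree at most one, an edge and its two endpoints are closed under adjacency.
\<close>

lemma two_nodes:
  assumes con: "connected_graph V E" and deg: "max_deg \<le> 1"
  shows "n \<le> 2"
proof -
  have le1: "card {e \<in> E. x \<in> e} \<le> 1" if "x \<in> V" for x
  proof -
    obtain v where "v < n" "x = vs ! v" using \<open>x \<in> V\<close> V_nth by auto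
    then show ?thesis using degree_deg deg_le_max_deg deg by (force simp: degree_def)
  qed
  have "finite E" using edges by simp
  have unique: "e = f" if "x \<in> V" "e \<in> E" "x \<in> e" "f \<in> E" "x \<in> f" for x e f
  proof -
    have "card {e \<in> E. x \<in> e} \<le> Suc 0" using le1 that(1) by simp
    then show ?thesis using that \<open>finite E\<close> by (subst (asm) card_le_Suc0_iff_eq) auto
  qed
  have E2: "e \<subseteq> V \<and> card e = 2" if "e \<in> E" for e using graph that by (simp add: simple_graph_def)
  obtain u where u: "u \<in> V" using nonempty by blast
  show ?thesis
  proof (cases "\<exists>e\<in>E. u \<in> e")
    case False
    have "x = u" if "x \<in> V" for x
    proof -
      have "(u, x) \<in> {(a, b). {a, b} \<in> E}\<^sup>*" using con u that by (auto simp: connected_graph_def)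
      then show ?thesis using False by (auto elim: converse_rtranclE)
    qed
    then have "V \<subseteq> {u}" by blast
    then have "card V \<le> 1" using card_mono[of "{u}" V] by simp
    then show ?thesis by (simp add: card_V)
  next
    case True
    then obtain e where e: "e \<in> E" "u \<in> e" by blast
    have "x \<in> e" if "x \<in> V" for x
    proof -
      have "(u, x) \<in> {(a, b). {a, b} \<in> E}\<^sup>*" using con u that by (auto simp: connected_graph_def)
      then show ?thesis
      proof (induction rule: rtrancl_induct)
        case base
        show ?case by (fact e(2))
      next
        case (step a b)
        then have ab: "{a, b} \<in> E" "a \<in> e" by auto
        have "a \<in> V" using E2[OF e(1)] ab by auto
        then have "{a, b} = e" using unique e(1) ab by blast
        then show ?case by auto
      qed
    qed
    then have "V \<subseteq> e" by blast
    moreover have "finite e" using E2[OF e(1)] by (metis card.infinite zero_neq_numeral)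
    ultimately have "card V \<le> 2" using card_mono[of e V] E2[OF e(1)] by simp
    then show ?thesis by (simp add: card_V)
  qed
qed

text \<open>
If the maximum degree is at most one, the graph has at most two nodes and everything is constant.
Otherwise \<open>bits (\<Delta> + 1) + 1 \<le> 4 log \<Delta>\<close>, \<open>D + 1 \<le> 3 min(n\<^sup>2\<^sup>/\<^sup>3, m\<^sup>1\<^sup>/\<^sup>2)\<close> and \<open>n + 2 m + 1 \<le> 5 m\<close>.
\<close>

lemma steps_bound:
  assumes con: "connected_graph V E" and D: "D = 1 \<or> (D - 1)^2 < m \<and> (D - 1)^3 < n^2"
  shows "real ((bits (max_deg + 1) + 1) * ((D + 1) * (n + 2 * m + 1))) \<le>
    60 * (if max_deg \<le> 1 then 1
          else log 2 (real max_deg) * real m * min (real n powr (2/3)) (real m powr (1/2)))"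
proof (cases "max_deg \<le> 1")
  case True
  then have n: "n \<le> 2" using two_nodes con by simp
  have "2 * m = (\<Sum>v<n. deg v)" by (rule sum_deg[symmetric])
  also have "\<dots> \<le> (\<Sum>v<n. max_deg)" by (intro sum_mono) (auto simp: deg_le_max_deg)
  also have "\<dots> = n * max_deg" by simp
  also have "\<dots> \<le> 2 * 1" using n True by (intro mult_mono) auto
  finally have m: "m \<le> 1" by simp
  have D1: "D \<le> 1"
  proof (rule ccontr)
    assume "\<not> D \<le> 1"
    then have "(D - 1)^2 < m" using D by auto
    then have "(D - 1)^2 < 1" using m by linarith
    then show False using \<open>\<not> D \<le> 1\<close> by simp
  qed
  have "bits (max_deg + 1) \<le> bits 2" using True by (intro bits_mono) simp
  also have "bits 2 = 2" by (simp add: bits.simps)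
  finally have "(bits (max_deg + 1) + 1) * ((D + 1) * (n + 2 * m + 1)) \<le> 3 * (2 * 5)"
    using n m D1 by (intro mult_mono) auto
  then have "real ((bits (max_deg + 1) + 1) * ((D + 1) * (n + 2 * m + 1))) \<le> real (3 * (2 * 5))"
    by (rule of_nat_mono)
  then show ?thesis using True by (simp del: of_nat_mult of_nat_add)
next
  case False
  define L where "L = log 2 (real max_deg)"
  define R where "R = min (real n powr (2/3)) (real m powr (1/2))"
  have L: "L \<ge> 1"
  proof -
    have "log 2 2 \<le> log 2 (real max_deg)" using False by (subst log_le_cancel_iff) auto
    then show ?thesis by (simp add: L_def)
  qed
  have m: "m \<ge> 1" using max_deg_le False by simp
  have "n \<ge> 2"
  proof -
    have "0 < 2 * m" using m by linarith
    then have "tail 0 < n" "tip 0 < n" "tip 0 \<noteq> tail 0"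
      by (rule tail_n, rule tail_n[OF mate_less], rule tail_mate_neq)
    then show ?thesis by linarith
  qed
  then have nm: "n \<le> 2 * m" using no_isolated_node con by simp
  have "real (bits (max_deg + 1)) \<le> 2 + L"
  proof -
    have "2 ^ bits (max_deg + 1) \<le> 2 * (max_deg + 1)" by (rule power_bits_le) simp
    also have "\<dots> \<le> 4 * max_deg" using False by simp
    finally have "real (2 ^ bits (max_deg + 1)) \<le> real (4 * max_deg)" by (rule of_nat_mono)
    then have "log 2 (2 ^ bits (max_deg + 1)) \<le> log 2 (4 * real max_deg)"
      using False by (subst log_le_cancel_iff) auto
    also have "\<dots> = log 2 4 + L" using False by (simp add: L_def log_mult)
    also have "log 2 4 = (2::real)" using log_pow_cancel[of 2 2] by simp
    finally show ?thesis by simp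
  qed
  then have b: "real (bits (max_deg + 1) + 1) \<le> 4 * L" using L by simp
  have R1: "R \<ge> 1"
    using \<open>n \<ge> 2\<close> m by (auto simp: R_def intro!: ge_one_powr_ge_zero)
  have "real D - 1 \<le> R"
  proof (cases "D \<le> 1")
    case True
    then show ?thesis using R1 by simp
  next
    case D1: False
    define d where "d = D - 1"
    have d: "d \<ge> 1" "d^2 \<le> m" "d^3 \<le> n^2" using D D1 by (auto simp: d_def)
    have "(real d)^2 \<le> real m" using d(2) by (metis of_nat_le_iff of_nat_power)
    then have "real d \<le> real m powr (1/2)" by (simp add: powr_half_sqrt real_le_rsqrt)
    moreover have "real d \<le> real n powr (2/3)"
    proof -
      have "real (d^3) \<le> real (n^2)" using d(3) by (rule of_nat_mono)
      then have "real d powr 3 \<le> real n powr 2"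
        using d(1) \<open>n \<ge> 2\<close> by (simp add: powr_numeral)
      then have "(real d powr 3) powr (1/3) \<le> (real n powr 2) powr (1/3)"
        by (intro powr_mono2) auto
      then have "real d powr (3 * (1/3)) \<le> real n powr (2 * (1/3))" by (simp only: powr_powr)
      then show ?thesis using d(1) by simp
    qed
    ultimately show ?thesis using D1 by (simp add: R_def d_def of_nat_diff)
  qed
  then have Db: "real (D + 1) \<le> 3 * R" using R1 by simp
  have X: "real (n + 2 * m + 1) \<le> 5 * real m" using nm m by simp
  have "real ((bits (max_deg + 1) + 1) * ((D + 1) * (n + 2 * m + 1))) =
      real (bits (max_deg + 1) + 1) * (real (D + 1) * real (n + 2 * m + 1))" by (simp only: of_nat_mult)
  also have "\<dots> \<le> (4 * L) * ((3 * R) * (5 * real m))"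
    using b Db X L R1 by (intro mult_mono) auto
  also have "\<dots> = 60 * (L * real m * R)" by simp
  finally show ?thesis using False by (simp add: L_def R_def)
qed

lemma input_ok_initial:
  assumes "w = [n, m] @ map \<kappa> vs @ concat (map (\<lambda>(i, j). [i, j]) es)"
  shows "input_ok (initial_state w)"
proof -
  have len: "length w = 2 + n + 2 * m"
    using assms by (simp add: length_concat_pairs)
  have "w ! (2 + v) = \<kappa> (vs ! v)" if "v < n" for v
    using that assms by (simp add: nth_append)
  moreover have "w ! (2 + n + h) = tail h" if "h < 2 * m" for h
    using that assms by (simp add: nth_append nth_concat_pairs half_edge_tail_def)
  ultimately show ?thesis
    using len assms by (simp add: input_ok_def initial_state_def)
qed

end

theorem theorem2:
  "\<exists>(P :: com) (c :: real).
     \<forall>(V :: nat set) (E :: nat set set) (\<kappa> :: nat \<Rightarrow> nat) (w :: nat list).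
       simple_graph V E \<and> V \<noteq> {} \<and> connected_graph V E \<and> encodes V E \<kappa> w \<longrightarrow>
       computes_within P w (min_star_colors V E \<kappa>)
         (c * (if max_degree V E \<le> 1 then 1
               else log 2 (real (max_degree V E)) * real (card E) *
                    min (real (card V) powr (2/3)) (real (card E) powr (1/2))))"
proof (intro exI[of _ star_program] exI[of _ "60 * real star_cost"] allI impI)
  fix V :: "nat set" and E :: "nat set set" and \<kappa> :: "nat \<Rightarrow> nat" and w :: "nat list"
  assume asm: "simple_graph V E \<and> V \<noteq> {} \<and> connected_graph V E \<and> encodes V E \<kappa> w"
  then obtain vs es where enc: "distinct vs" "set vs = V"
      "\<forall>(i, j)\<in>set es. i < length vs \<and> j < length vs"
      "distinct (map (\<lambda>(i, j). {vs ! i, vs ! j}) es)"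
      "set (map (\<lambda>(i, j). {vs ! i, vs ! j}) es) = E"
      "w = [length vs, length es] @ map \<kappa> vs @ concat (map (\<lambda>(i, j). [i, j]) es)"
    unfolding encodes_def by blast
  interpret encoded_star_graph V E \<kappa> vs es
    by unfold_locales (use asm enc in auto)
  have init: "input_ok (initial_state w)" "\<And>r. reg (initial_state w) r = 0"
      "\<And>a i. a \<noteq> 0 \<Longrightarrow> arr (initial_state w) a i = 0"
    using input_ok_initial[OF enc(6)] by (auto simp: initial_state_def)
  obtain D where D: "D = 1 \<or> (D - 1)^2 < m \<and> (D - 1)^3 < n^2"
    and run: "terminates star_program (initial_state w)
      (star_cost * ((bits (max_deg + 1) + 1) * ((D + 1) * (n + 2 * m + 1))))
      (\<lambda>s'. reg s' 0 = encode_result answer)"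
    using star_program_terminates[OF init] by blast
  obtain t s' where t: "run star_program (initial_state w) t s'"
      "t \<le> star_cost * ((bits (max_deg + 1) + 1) * ((D + 1) * (n + 2 * m + 1)))"
      "reg s' 0 = encode_result answer"
    using run by (auto simp: terminates_def)
  have con: "connected_graph V E" using asm by simp
  have "real t \<le> real star_cost * real ((bits (max_deg + 1) + 1) * ((D + 1) * (n + 2 * m + 1)))"
    using t(2) by (metis of_nat_le_iff of_nat_mult)
  also have "\<dots> \<le> real star_cost * (60 * (if max_deg \<le> 1 then 1
      else log 2 (real max_deg) * real m * min (real n powr (2/3)) (real m powr (1/2))))"
    using steps_bound[OF con D] by (rule mult_left_mono) simp
  also have "\<dots> = 60 * real star_cost * (if max_degree V E \<le> 1 then 1
      else log 2 (real (max_degree V E)) * real (card E) *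
        min (real (card V) powr (2/3)) (real (card E) powr (1/2)))"
    by (simp add: max_degree_eq card_V card_E)
  finally show "computes_within star_program w (min_star_colors V E \<kappa>)
      (60 * real star_cost * (if max_degree V E \<le> 1 then 1
        else log 2 (real (max_degree V E)) * real (card E) *
          min (real (card V) powr (2/3)) (real (card E) powr (1/2))))"
    using t(1,3) unfolding computes_within_def min_star_colors_answer by blast
qed

end
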